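(* Suppose that all agents $i\in\mathcal N$, with dynamics $\dot x_i(t)=u_i(t)$, $x_i(t),u_i(t)\in\mathbb R^2$, and local LTL tasks $\varphi_i$ over their service sets $\Sigma_i$, run, starting at time $0$, the distributed leader-election and control procedure described in the context. Then the procedure yields, for each agent $i\in\mathcal N$, a control input $u_i$, a time sequence $\mathbb T^A_i$ and an action sequence $\mathbb A_i$ such that the resulting trace $\mathrm{trace}_i=(\mathbf x_i(t),\mathbb T^A_i,\mathbb A_i,\mathbb T^S_i,\mathbb S_i)$ is valid and satisfies $\varphi_i$.
   Context: Agents and network. $\mathcal N=\{1,\ldots,N\}$; agent $i$ has position $x_i(t)\in\mathbb R^2$, given $x_i(0)$, and trajectory $\mathbf x_i(t)$; $x_{ij}=x_i-x_j$. Communication radius $r>0$; $\varepsilon\in(0,r)$ is a given constant. The undirected connectivity graph $G(t)=(\mathcal N,E(t))$ has $E(0)=\{(i,j)\mid\|x_i(0)-x_j(0)\|<r\}$ and, for $t>0$, $(i,j)\in E(t)$ iff either $\|x_{ij}(t)\|\le r-\varepsilon$, or $r-\varepsilon<\|x_{ij}(t)\|\le r$ and $(i,j)\in E(t^-)$ (the edge was present immediately before $t$). $\mathcal N_i(t)$ is the set of neighbours of $i$ in $G(t)$. $G(0)$ is connected. Two agents can exchange messages directly at time $t$ iff their distance is at most $r$; a message sent by an agent is reliably received by all agents connected to it, directly or indirectly. Services and regions. Agent $i$ has a finite set of services $\Sigma_i=\{\sigma_{ih}\mid h\in\{1,\ldots,M_i\}\}$, a finite set of regions $R_{ig}=\{y\in\mathbb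 R^2\mid\|y-c_{ig}\|\le r_{ig}\}$, $g\in\{1,\ldots,K_i\}$, $r_{ig}\ge r_{\min}>0$, each reachable for each agent, and a labeling $L_i$ assigning to $R_{ig}$ the set $L_i(R_{ig})\subseteq\Sigma_i$ of services that can be provided there. Agent $i$ has a set $\Pi_i$ of actions of two types: $\pi_{ih}$, providing its service $\sigma_{ih}\in\Sigma_i$; and $\varpi_{ii'h'}$, cooperating with agent $i'$ in providing $\sigma_{i'h'}\in\Sigma_{i'}$. A service has the form $\sigma_{ih}=\pi_{ih}\wedge\bigwedge_{i'\in\mathcal C_{ih}}\varpi_{i'ih}$ for a (possibly empty) set of cooperating agents $\mathcal C_{ih}\subseteq\mathcal N\setminus\{i\}$. Valid trace. A valid trace of agent $i$ is a tuple $(\mathbf x_i(t),\mathbb T^A_i,\mathbb A_i,\mathbb T^S_i,\mathbb S_i)$ where $\mathbf x_i(t)$ is a trajectory of $i$; $\mathbb T^A_i=t_1,t_2,\ldots$ is the sequence of times when $i$ executes actions from $\Pi_i$; $\mathbb A_i:\mathbb T^A_i\to\Pi_i$ gives the executed actions (both service-providing and cooperating); $\mathbb T^S_i=\tau_1,\tau_2,\ldots$ is the sequence of times when services from $\Sigma_i$ are provided, a subsequence of $\mathbb T^A_i$ equal to the times when service-providing actions are executed; and $\mathbb S_i:\mathbb T^S_i\to\Sigma_i$ gives the provided services, such that for all $l\ge1$ there is $g\in\{1,\ldots,K_i\}$ with: (i) $\mathbf x_i(\tau_l)\in R_{ig}$, $\mathbb S_i(\tau_l)\in L_i(R_{ig})$,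 and $\mathbb S_i(\tau_l)=\sigma_{ih}\Rightarrow\mathbb A_i(\tau_l)=\pi_{ih}$; (ii) for all $i'\in\mathcal C_{ih}$, $\mathbf x_{i'}(\tau_l)\in R_{ig}$ and $\mathbb A_{i'}(\tau_l)=\varpi_{i'ih}$. The trace satisfies $\varphi_i$ iff the infinite word $\mathbb S_i(\tau_1)\mathbb S_i(\tau_2)\ldots$ satisfies $\varphi_i$, where LTL formulas over $\Sigma_i$ (built from services, $\lor,\lnot$, next, until, eventually, always) are interpreted over infinite sequences of services, each service regarded as a singleton letter. Urge. Agent $i$ has a high-level plan $\Omega_i=\sigma_{i1}\ldots\sigma_{ip_i}(\sigma_{ip_i+1}\ldots\sigma_{is_i})^\omega$, an infinite sequence of services with $\Omega_i\models\varphi_i$ (the second index denotes position in the plan), computed from a B\"uchi automaton for $\varphi_i$. Let $\tau_{i\lambda}$ be the time at which the latest service of $\Omega_i$ so far was provided, or $0$ if none has been. The urge of $i$ at time $t$ is $\Upsilon_i(t)=(t-\tau_{i\lambda},\,i)$. Urges are ordered lexicographically: $\Upsilon_i(t)>\Upsilon_j(t)$ iff $t-\tau_{i\lambda}>t-\tau_{j\lambda}$, or $t-\tau_{i\lambda}=t-\tau_{j\lambda}$ and $i>j$. Procedure (run by every agent). Each agent computes $\Omega_i$, sets $\tau_{i\lambda}:=0$ and its next service $\sigma_{i\nu}:=\sigma_{i1}$, and waits until all agents report being ready; then agent $N$ triggers the first leader election, stamped with the current time. In an election stamped with time $t$, all agents exchange $\Upsilon_i(t)$, and the agent $\ell$ maximizing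 $\Upsilon_\ell(t)$ becomes the leader for all agents. Put $b_\ell=1$ and $b_i=0$ for $i\ne\ell$. The leader picks a goal region $R_{\ell g}$ with $\sigma_{\ell\nu}\in L_\ell(R_{\ell g})$, and every agent $i$ applies $$u_i(t)=-b_i(x_i-c_{ig})-\sum_{j\in\mathcal N_i(t)}\frac{2r^2}{(r^2-\|x_{ij}\|^2)^2}(x_i-x_j)$$ (interaction term defined for $\|x_{ij}\|\in[0,r)$) until the leader and all agents cooperating in $\sigma_{\ell\nu}$ are in $R_{\ell g}$. Then the leader requests the cooperating agents to execute their cooperating actions for $\sigma_{\ell\nu}$ and executes its own service-providing action, all executions being synchronized, so that $\sigma_{\ell\nu}$ is provided. The leader then sets $\tau_{\ell\lambda}$ to the time at which the service was provided, sets $\sigma_{\ell\nu}$ to the following service of $\Omega_\ell$ (after $\sigma_{\ell s_\ell}$ comes $\sigma_{\ell p_\ell+1}$), and triggers a new leader election stamped with the current time. This is repeated forever. The sequences $\mathbb T^A_i,\mathbb A_i,\mathbb T^S_i,\mathbb S_i$ are initially empty, and a time instant, action or service is appended whenever agent $i$ executes an action or a service of $\Sigma_i$ is provided; $\mathbf x_i(t)$ is the trajectory resulting from the applied controller.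
   Formalization: The formal version lets time elapse, with agents at rest, between a service and the next election; a run is shown to exist when these delays are positive, and with zero delay the claim covers runs in which no agent executes two actions at one instant (otherwise the statement fails). *)

theory Defs
  imports "HOL-Analysis.Analysis" "HOL-Library.Omega_Words_Fun"
begin

section \<open>Linear temporal logic over services\<close>

text \<open>Words are infinite sequences of services; every service is a singleton letter, so an atom
  holds at a position iff it is the letter there.\<close>

datatype (atoms: 'a) ltl =
    Atom 'a
  | Or "'a ltl" "'a ltl"
  | Neg "'a ltl"
  | Nxt "'a ltl"
  | Until "'a ltl" "'a ltl"
  | Eventually "'a ltl"
  | Always "'a ltl"

primrec models :: "'a word \<Rightarrow> 'a ltl \<Rightarrow> bool" where
  "models w (Atom a) \<longleftrightarrow> w 0 = a"
| "models w (Or \<phi> \<psi>) \<longleftrightarrow> models w \<phi> \<or> models w \<psi>"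
| "models w (Neg \<phi>) \<longleftrightarrow> \<not> models w \<phi>"
| "models w (Nxt \<phi>) \<longleftrightarrow> models (suffix 1 w) \<phi>"
| "models w (Until \<phi> \<psi>) \<longleftrightarrow>
     (\<exists>n. models (suffix n w) \<psi> \<and> (\<forall>m<n. models (suffix m w) \<phi>))"
| "models w (Eventually \<phi>) \<longleftrightarrow> (\<exists>n. models (suffix n w) \<phi>)"
| "models w (Always \<phi>) \<longleftrightarrow> (\<forall>n. models (suffix n w) \<phi>)"


section \<open>Agents, services, regions\<close>

text \<open>\<open>(i, h)\<close> stands for the service \<open>\<sigma>\<^sub>i\<^sub>h\<close> of agent \<open>i\<close>.\<close>
type_synonym service = "nat \<times> nat"

text \<open>\<open>Provide i h\<close> is \<open>\<pi>\<^sub>i\<^sub>h\<close>; \<open>Cooperate i j h\<close> is the action of agent \<open>i\<close> that helps agent \<open>j\<close>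
  to provide \<open>\<sigma>\<^sub>j\<^sub>h\<close>.\<close>
datatype action = Provide nat nat | Cooperate nat nat nat

text \<open>The conjunction \<open>\<sigma>\<^sub>i\<^sub>h = \<pi>\<^sub>i\<^sub>h \<and> \<dots>\<close> is represented by its set of cooperating agents
  \<open>cooperators i h\<close>. The fields \<open>plan_prefix\<close> and \<open>plan_cycle\<close> are the two finite parts of the
  high-level plan.\<close>
record mas =
  num_agents :: nat
  comm_radius :: real
  hysteresis :: real
  init_pos :: "nat \<Rightarrow> real^2"
  num_services :: "nat \<Rightarrow> nat"
  num_regions :: "nat \<Rightarrow> nat"
  centre :: "nat \<Rightarrow> nat \<Rightarrow> real^2"
  region_radius :: "nat \<Rightarrow> nat \<Rightarrow> real"
  min_radius :: real
  labelling :: "nat \<Rightarrow> (real^2) set \<Rightarrow> service set"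
  actions :: "nat \<Rightarrow> action set"
  cooperators :: "nat \<Rightarrow> nat \<Rightarrow> nat set"
  task :: "nat \<Rightarrow> service ltl"
  plan_prefix :: "nat \<Rightarrow> service list"
  plan_cycle :: "nat \<Rightarrow> service list"

definition agents :: "mas \<Rightarrow> nat set" where
  "agents S = {1..num_agents S}"

definition services :: "mas \<Rightarrow> nat \<Rightarrow> service set" where
  "services S i = {(i, h) | h. h \<in> {1..num_services S i}}"

definition region :: "mas \<Rightarrow> nat \<Rightarrow> nat \<Rightarrow> (real^2) set" where
  "region S i g = cball (centre S i g) (region_radius S i g)"

definition plan :: "mas \<Rightarrow> nat \<Rightarrow> service word" where
  "plan S i = conc (plan_prefix S i) (iter (plan_cycle S i))"

definition connected_graph :: "nat set \<Rightarrow> (nat \<times> nat) set \<Rightarrow> bool" where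
  "connected_graph V E \<longleftrightarrow> (\<forall>i\<in>V. \<forall>j\<in>V. (i, j) \<in> E\<^sup>*)"

definition initial_edges :: "mas \<Rightarrow> (nat \<times> nat) set" where
  "initial_edges S = {(i, j). i \<in> agents S \<and> j \<in> agents S \<and> i \<noteq> j \<and>
     norm (init_pos S i - init_pos S j) < comm_radius S}"

definition multi_agent_system :: "mas \<Rightarrow> bool" where
  "multi_agent_system S \<longleftrightarrow>
     1 \<le> num_agents S \<and>
     0 < hysteresis S \<and> hysteresis S < comm_radius S \<and>
     connected_graph (agents S) (initial_edges S) \<and>
     0 < min_radius S \<and>
     (\<forall>i\<in>agents S.
        (\<forall>g\<in>{1..num_regions S i}.
           min_radius S \<le> region_radius S i g \<and>
           labelling S i (region S i g) \<subseteq> services S i) \<and>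
        actions S i \<subseteq>
          {Provide i h | h. h \<in> {1..num_services S i}} \<union>
          {Cooperate i j h | j h. j \<in> agents S \<and> j \<noteq> i \<and> h \<in> {1..num_services S j}} \<and>
        (\<forall>h\<in>{1..num_services S i}.
           Provide i h \<in> actions S i \<and>
           cooperators S i h \<subseteq> agents S - {i} \<and>
           (\<forall>j\<in>cooperators S i h. Cooperate j i h \<in> actions S j)) \<and>
        atoms (task S i) \<subseteq> services S i \<and>
        set (plan_prefix S i) \<subseteq> services S i \<and>
        set (plan_cycle S i) \<subseteq> services S i \<and>
        plan_cycle S i \<noteq> [] \<and>
        models (plan S i) (task S i))"


section \<open>Trajectories and the connectivity graph\<close>

text \<open>The control input jumps at elections and when edges appear, so \<open>x' = u\<close> is required of a
  continuous \<open>x\<close> outside a locally finite set of instants. The time domain is \<open>[0, T)\<close>.\<close>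
definition trajectory ::
  "ereal \<Rightarrow> real^2 \<Rightarrow> (real \<Rightarrow> real^2) \<Rightarrow> (real \<Rightarrow> real^2) \<Rightarrow> bool" where
  "trajectory T x0 u x \<longleftrightarrow>
     x 0 = x0 \<and>
     continuous_on {t. 0 \<le> t \<and> ereal t < T} x \<and>
     (\<exists>D. (\<forall>b. ereal b < T \<longrightarrow> finite (D \<inter> {0..b})) \<and>
          (\<forall>t. 0 < t \<and> ereal t < T \<and> t \<notin> D \<longrightarrow> (x has_vector_derivative u t) (at t)))"

text \<open>The last two conjuncts are needed because the rule for \<open>t > 0\<close>, which refers to the edges
  immediately before \<open>t\<close>, does not by itself exclude that an edge vanishes or appears right after
  an instant without any threshold being crossed. With them, \<open>E\<close> is uniquely determined on
  \<open>[0, T)\<close> by a continuous \<open>x\<close>.\<close>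
definition connectivity_graph ::
  "mas \<Rightarrow> ereal \<Rightarrow> (nat \<Rightarrow> real \<Rightarrow> real^2) \<Rightarrow> (real \<Rightarrow> (nat \<times> nat) set) \<Rightarrow> bool" where
  "connectivity_graph S T x E \<longleftrightarrow>
     (let r = comm_radius S; \<epsilon> = hysteresis S; d = (\<lambda>i j t. norm (x i t - x j t)) in
      (\<forall>t. E t \<subseteq> {(i, j). i \<in> agents S \<and> j \<in> agents S \<and> i \<noteq> j}) \<and>
      (\<forall>i\<in>agents S. \<forall>j\<in>agents S. i \<noteq> j \<longrightarrow>
         ((i, j) \<in> E 0 \<longleftrightarrow> d i j 0 < r) \<and>
         (\<forall>t. 0 < t \<and> ereal t < T \<longrightarrow>
            ((i, j) \<in> E t \<longleftrightarrow>
               d i j t \<le> r - \<epsilon> \<or>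
               r - \<epsilon> < d i j t \<and> d i j t \<le> r \<and> (\<forall>\<^sub>F s in at_left t. (i, j) \<in> E s))) \<and>
         (\<forall>t. 0 \<le> t \<and> ereal t < T \<longrightarrow>
            ((i, j) \<in> E t \<and> (\<forall>\<^sub>F s in at_right t. d i j s \<le> r) \<longrightarrow>
               (\<forall>\<^sub>F s in at_right t. (i, j) \<in> E s)) \<and>
            ((i, j) \<notin> E t \<longrightarrow> (\<forall>\<^sub>F s in at_right t. (i, j) \<notin> E s)))))"

definition message_links :: "mas \<Rightarrow> (nat \<Rightarrow> real \<Rightarrow> real^2) \<Rightarrow> real \<Rightarrow> (nat \<times> nat) set" where
  "message_links S x t = {(i, j). i \<in> agents S \<and> j \<in> agents S \<and>
     norm (x i t - x j t) \<le> comm_radius S}"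


section \<open>Runs of the procedure\<close>

text \<open>Rounds are numbered from 0. Round \<open>k\<close> consists of the leader election stamped \<open>elect k\<close> and
  the motion up to the time \<open>serve k\<close> at which the leader's service is provided; the value \<open>\<infinity>\<close>
  means that the event never happens, so a run may get stuck in a round.\<close>
record run =
  position :: "nat \<Rightarrow> real \<Rightarrow> real^2"
  edges :: "real \<Rightarrow> (nat \<times> nat) set"
  input :: "nat \<Rightarrow> real \<Rightarrow> real^2"
  elect :: "nat \<Rightarrow> ereal"
  serve :: "nat \<Rightarrow> ereal"
  leader :: "nat \<Rightarrow> nat"

text \<open>The supremum is \<open>\<infinity>\<close> if some round is never completed, and may be finite if infinitely many
  rounds take place in bounded time.\<close>
definition horizon :: "run \<Rightarrow> ereal" where
  "horizon \<rho> = (SUP k. elect \<rho> k)"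

text \<open>State of agent \<open>i\<close> at the beginning of round \<open>k\<close>.\<close>
primrec last_served :: "run \<Rightarrow> nat \<Rightarrow> nat \<Rightarrow> real" where
  "last_served \<rho> i 0 = 0"
| "last_served \<rho> i (Suc k) =
     (if leader \<rho> k = i then real_of_ereal (serve \<rho> k) else last_served \<rho> i k)"

primrec plan_index :: "run \<Rightarrow> nat \<Rightarrow> nat \<Rightarrow> nat" where
  "plan_index \<rho> i 0 = 0"
| "plan_index \<rho> i (Suc k) =
     (if leader \<rho> k = i then Suc (plan_index \<rho> i k) else plan_index \<rho> i k)"

definition next_service :: "mas \<Rightarrow> run \<Rightarrow> nat \<Rightarrow> nat \<Rightarrow> service" where
  "next_service S \<rho> i k = plan S i (plan_index \<rho> i k)"

definition urge :: "run \<Rightarrow> nat \<Rightarrow> nat \<Rightarrow> real \<times> nat" where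
  "urge \<rho> k i = (real_of_ereal (elect \<rho> k) - last_served \<rho> i k, i)"

text \<open>\<open>HOL-Library.Product_Lexorder\<close> is incompatible with the componentwise order that
  \<open>HOL-Analysis\<close> puts on products.\<close>
definition urge_less :: "real \<times> nat \<Rightarrow> real \<times> nat \<Rightarrow> bool" where
  "urge_less a b \<longleftrightarrow> fst a < fst b \<or> fst a = fst b \<and> snd a < snd b"

definition round_service :: "mas \<Rightarrow> run \<Rightarrow> nat \<Rightarrow> service" where
  "round_service S \<rho> k = next_service S \<rho> (leader \<rho> k) k"

definition team :: "mas \<Rightarrow> run \<Rightarrow> nat \<Rightarrow> nat set" where
  "team S \<rho> k = insert (leader \<rho> k) (cooperators S (leader \<rho> k) (snd (round_service S \<rho> k)))"

definition round_action :: "mas \<Rightarrow> run \<Rightarrow> nat \<Rightarrow> nat \<Rightarrow> action" where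
  "round_action S \<rho> k i =
     (let h = snd (round_service S \<rho> k)
      in if i = leader \<rho> k then Provide i h else Cooperate i (leader \<rho> k) h)"

text \<open>\<open>pick k i \<sigma>\<close> is the region that agent \<open>i\<close> picks when it is the leader of round \<open>k\<close> and its
  next service is \<open>\<sigma>\<close>.\<close>
definition goal_selection :: "mas \<Rightarrow> (nat \<Rightarrow> nat \<Rightarrow> service \<Rightarrow> nat) \<Rightarrow> bool" where
  "goal_selection S pick \<longleftrightarrow>
     (\<forall>k. \<forall>i\<in>agents S. \<forall>\<sigma>\<in>range (plan S i).
        pick k i \<sigma> \<in> {1..num_regions S i} \<and> \<sigma> \<in> labelling S i (region S i (pick k i \<sigma>)))"

definition goal ::
  "mas \<Rightarrow> (nat \<Rightarrow> nat \<Rightarrow> service \<Rightarrow> nat) \<Rightarrow> run \<Rightarrow> nat \<Rightarrow> nat" where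
  "goal S pick \<rho> k = pick k (leader \<rho> k) (round_service S \<rho> k)"

definition feedback ::
  "mas \<Rightarrow> (nat \<Rightarrow> nat \<Rightarrow> service \<Rightarrow> nat) \<Rightarrow> run \<Rightarrow> nat \<Rightarrow> nat \<Rightarrow> real \<Rightarrow> real^2" where
  "feedback S pick \<rho> k i t =
     (let r = comm_radius S; x = position \<rho>; b = (if i = leader \<rho> k then 1 else 0 :: real) in
      - (b *\<^sub>R (x i t - centre S i (goal S pick \<rho> k)))
      - (\<Sum>j\<in>{j. (i, j) \<in> edges \<rho> t}.
           (2 * r\<^sup>2 / (r\<^sup>2 - (norm (x i t - x j t))\<^sup>2)\<^sup>2) *\<^sub>R (x i t - x j t)))"

text \<open>\<open>election_time S x s\<close> is \<open>s\<close> if all agents can exchange messages at time \<open>s\<close>, and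
  \<open>\<infinity>\<close> otherwise.\<close>
definition election_time :: "mas \<Rightarrow> (nat \<Rightarrow> real \<Rightarrow> real^2) \<Rightarrow> ereal \<Rightarrow> ereal" where
  "election_time S x s =
     (if connected_graph (agents S) (message_links S x (real_of_ereal s)) then s else \<infinity>)"

text \<open>\<open>ready\<close> is the time at which all agents have reported being ready, and \<open>delay k\<close> the time
  that elapses between the service of round \<open>k\<close> and the next election. The controller is applied
  only from an election until the service is provided; otherwise the agents rest. The clause on
  disjoint teams says that an agent executes at most one action at any instant, so that the executed
  actions form a function of time.\<close>
definition procedure_run ::
  "mas \<Rightarrow> real \<Rightarrow> (nat \<Rightarrow> real) \<Rightarrow> (nat \<Rightarrow> nat \<Rightarrow> service \<Rightarrow> nat) \<Rightarrow> run \<Rightarrow> bool" where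
  "procedure_run S ready delay pick \<rho> \<longleftrightarrow>
     elect \<rho> 0 = election_time S (position \<rho>) (ereal ready) \<and>
     (\<forall>k. elect \<rho> (Suc k) =
        election_time S (position \<rho>) (serve \<rho> k + ereal (delay k))) \<and>
     (\<forall>k. elect \<rho> k < \<infinity> \<longrightarrow>
        leader \<rho> k \<in> agents S \<and>
        (\<forall>j\<in>agents S - {leader \<rho> k}. urge_less (urge \<rho> k j) (urge \<rho> k (leader \<rho> k)))) \<and>
     (\<forall>k. serve \<rho> k =
        Inf (ereal ` {t. elect \<rho> k \<le> ereal t \<and>
          (\<forall>i\<in>team S \<rho> k.
             position \<rho> i t \<in> region S (leader \<rho> k) (goal S pick \<rho> k) \<and>
             (leader \<rho> k, i) \<in> (message_links S (position \<rho>) t)\<^sup>*)})) \<and>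
     (\<forall>k m. k \<noteq> m \<and> serve \<rho> k = serve \<rho> m \<and> serve \<rho> k < \<infinity> \<longrightarrow>
        team S \<rho> k \<inter> team S \<rho> m = {}) \<and>
     (\<forall>i\<in>agents S.
        (\<forall>t. ereal t < elect \<rho> 0 \<longrightarrow> input \<rho> i t = 0) \<and>
        (\<forall>k t. elect \<rho> k \<le> ereal t \<and> ereal t < serve \<rho> k \<longrightarrow>
           input \<rho> i t = feedback S pick \<rho> k i t) \<and>
        (\<forall>k t. serve \<rho> k \<le> ereal t \<and> ereal t < elect \<rho> (Suc k) \<longrightarrow> input \<rho> i t = 0) \<and>
        trajectory (horizon \<rho>) (init_pos S i) (input \<rho> i) (position \<rho> i)) \<and>
     connectivity_graph S (horizon \<rho>) (position \<rho>) (edges \<rho>)"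


section \<open>Traces\<close>

text \<open>\<open>action_at\<close> and \<open>service_at\<close> are meaningful only on the ranges of \<open>action_times\<close> and
  \<open>service_times\<close>.\<close>
record trace =
  traj :: "real \<Rightarrow> real^2"
  action_times :: "nat \<Rightarrow> real"
  action_at :: "real \<Rightarrow> action"
  service_times :: "nat \<Rightarrow> real"
  service_at :: "real \<Rightarrow> service"

definition resulting_trace :: "mas \<Rightarrow> run \<Rightarrow> nat \<Rightarrow> trace \<Rightarrow> bool" where
  "resulting_trace S \<rho> i \<theta> \<longleftrightarrow>
     traj \<theta> = position \<rho> i \<and>
     strict_mono (action_times \<theta>) \<and>
     range (action_times \<theta>) = {t. \<exists>k. serve \<rho> k = ereal t \<and> i \<in> team S \<rho> k} \<and>
     (\<forall>k t. serve \<rho> k = ereal t \<and> i \<in> team S \<rho> k \<longrightarrow> action_at \<theta> t = round_action S \<rho> k i) \<and>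
     strict_mono (service_times \<theta>) \<and>
     range (service_times \<theta>) = {t. \<exists>k. serve \<rho> k = ereal t \<and> i = leader \<rho> k} \<and>
     (\<forall>k t. serve \<rho> k = ereal t \<and> i = leader \<rho> k \<longrightarrow> service_at \<theta> t = round_service S \<rho> k)"

definition valid_trace ::
  "mas \<Rightarrow> ereal \<Rightarrow> (nat \<Rightarrow> real \<Rightarrow> real^2) \<Rightarrow> (nat \<Rightarrow> trace) \<Rightarrow> nat \<Rightarrow> bool" where
  "valid_trace S T u \<theta> i \<longleftrightarrow>
     trajectory T (init_pos S i) (u i) (traj (\<theta> i)) \<and>
     strict_mono (action_times (\<theta> i)) \<and>
     (\<forall>n. 0 \<le> action_times (\<theta> i) n \<and> ereal (action_times (\<theta> i) n) < T \<and>
          action_at (\<theta> i) (action_times (\<theta> i) n) \<in> actions S i) \<and>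
     (\<exists>f. strict_mono f \<and> service_times (\<theta> i) = action_times (\<theta> i) \<circ> f) \<and>
     range (service_times (\<theta> i)) =
       {t \<in> range (action_times (\<theta> i)). \<exists>h. action_at (\<theta> i) t = Provide i h} \<and>
     (\<forall>l. let \<tau> = service_times (\<theta> i) l in
        service_at (\<theta> i) \<tau> \<in> services S i \<and>
        (\<exists>g\<in>{1..num_regions S i}.
           traj (\<theta> i) \<tau> \<in> region S i g \<and>
           service_at (\<theta> i) \<tau> \<in> labelling S i (region S i g) \<and>
           (\<forall>h. service_at (\<theta> i) \<tau> = (i, h) \<longrightarrow>
              action_at (\<theta> i) \<tau> = Provide i h \<and>
              (\<forall>j\<in>cooperators S i h.
                 traj (\<theta> j) \<tau> \<in> region S i g \<and>
                 \<tau> \<in> range (action_times (\<theta> j)) \<and>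
                 action_at (\<theta> j) \<tau> = Cooperate j i h))))"

definition satisfies :: "trace \<Rightarrow> service ltl \<Rightarrow> bool" where
  "satisfies \<theta> \<phi> \<longleftrightarrow> models (\<lambda>l. service_at \<theta> (service_times \<theta> l)) \<phi>"

end

(* The energy |x_l - c|^2 / 2 + sum over edges of r^2 / (r^2 - |x_ij|^2), where l is the leader and c
   the centre of its goal region, decreases along the closed loop at the rate sum_i |u_i|^2. It
   blows up as an edge gets as long as r, so no edge is ever lost and the graph stays connected; an
   edge only appears at distance r - eps, where pairs outside the graph are charged the same amount,
   so growth of the graph does not raise the energy. As long as the agents are not all close to c,
   sum_i |u_i|^2 is bounded away from 0, so every round ends. The urge makes every agent lead
   infinitely often, hence each agent works off its whole plan.

   For the existence of a run, truncating the interaction makes the closed loop with a fixed graph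
   globally Lipschitz, and the energy bound shows that the truncation is never active. The graph
   can only grow finitely often in a round, and the rounds are glued together by dependent choice. *)

theory Submission
  imports Defs "HOL-Probability.Discrete_Topology"
begin

section \<open>Real analysis\<close>

text \<open>The energy estimate and the survival of the edges presuppose each other: the energy
  controls the motion only while all edges are shorter than \<open>r\<close>, and they stay shorter
  only because the energy is bounded. Continuity induction (\<open>real_induct\<close>) breaks the
  circle, for a given run in \<open>safe_preserved\<close> and for the truncated equation in
  \<open>fixed_graph_solution_0\<close>. Since the graph switches and the input jumps, the energy
  along a run is not differentiable everywhere; its decay comes from a right Dini estimate that
  tolerates finitely many bad instants.

  A run might a priori get stuck in a round, or complete infinitely many rounds in bounded time. The
  first is excluded by an explicit decay rate. The second is never excluded: all arguments take
  place below the horizon, and it is enough that only finitely many rounds share an instant, which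
  follows from the disjointness of simultaneous teams.\<close>

text \<open>Consider the infimum of the failures: \<open>left\<close> shows that it is not itself a
  failure, and \<open>right\<close> pushes the next failure away from it.\<close>

lemma real_induct:
  fixes a b :: real
  assumes "a \<le> b" and base: "P a"
    and right: "\<And>t. a \<le> t \<Longrightarrow> t < b \<Longrightarrow> \<forall>s\<in>{a..t}. P s \<Longrightarrow> eventually P (at_right t)"
    and left: "\<And>t. a < t \<Longrightarrow> t \<le> b \<Longrightarrow> \<forall>s\<in>{a..<t}. P s \<Longrightarrow> P t"
  shows "\<forall>t\<in>{a..b}. P t"
proof (rule ccontr)
  define B where "B = {t\<in>{a..b}. \<not> P t}"
  assume "\<not> ?thesis"
  then have ne: "B \<noteq> {}" by (auto simp: B_def)
  have bdd: "bdd_below B" by (auto simp: B_def)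
  define t where "t = Inf B"
  have at: "a \<le> t" unfolding t_def using ne by (intro cInf_greatest) (auto simp: B_def)
  have lower: "\<And>s. s \<in> B \<Longrightarrow> t \<le> s" unfolding t_def using bdd by (simp add: cInf_lower)
  then have tb: "t \<le> b" using ne by (force simp: B_def)
  have before: "\<forall>s\<in>{a..<t}. P s" using lower tb by (force simp: B_def)
  have Pt: "P t" using left[OF _ tb before] base at by (cases "a = t") auto
  have "t \<noteq> b"
  proof
    assume "t = b"
    then have "B \<subseteq> {b}" using lower by (force simp: B_def)
    then show False using ne Pt \<open>t = b\<close> by (auto simp: B_def)
  qed
  then have "t < b" using tb by simp
  have "\<forall>s\<in>{a..t}. P s" using before Pt by (auto simp: less_le)
  from right[OF at \<open>t < b\<close> this] obtain d where d: "t < d" "\<And>s. t < s \<Longrightarrow> s < d \<Longrightarrow> P s"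
    by (auto simp: eventually_at_right_field)
  obtain x where x: "x \<in> B" "x < d" using cInf_lessD[OF ne, of d] d(1) by (auto simp: t_def)
  show False
  proof (cases "x = t")
    case True then show False using x Pt by (simp add: B_def)
  next
    case False
    then show False using x lower[OF x(1)] d(2)[of x] by (auto simp: B_def)
  qed
qed

text \<open>One witness \<open>t0\<close> reduces the search to a compact set, which has a least
  element.\<close>

lemma first_time:
  assumes "a \<le> t0" "P t0" "closed {s \<in> {a..t0}. P s}"
  shows "\<exists>t\<ge>a. P (t :: real) \<and> (\<forall>s. a \<le> s \<and> s < t \<longrightarrow> \<not> P s)"
proof -
  let ?K = "{s \<in> {a..t0}. P s}"
  have "?K = {a..t0} \<inter> ?K" by auto
  then have "compact ?K" using assms(3) by (metis compact_Icc compact_Int_closed)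
  moreover have "?K \<noteq> {}" using assms(1,2) by auto
  ultimately obtain t where t: "t \<in> ?K" "\<forall>s\<in>?K. t \<le> s" using compact_attains_inf by blast
  have "\<not> P s" if "a \<le> s" "s < t" for s using t that by force
  then show ?thesis using t(1) by auto
qed

text \<open>One-sided limits can be checked piece by piece after gluing; this turns them back into
  continuity on the time domain.\<close>

lemma continuous_on_one_sided:
  fixes f :: "real \<Rightarrow> 'b::t2_space"
  assumes right: "\<And>t. a \<le> t \<Longrightarrow> ereal t < T \<Longrightarrow> (f \<longlongrightarrow> f t) (at_right t)"
    and left: "\<And>t. a < t \<Longrightarrow> ereal t < T \<Longrightarrow> (f \<longlongrightarrow> f t) (at_left t)"
  shows "continuous_on {t. a \<le> t \<and> ereal t < T} f"
  unfolding continuous_on_def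
proof
  let ?S = "{t. a \<le> t \<and> ereal t < T}"
  fix t assume t: "t \<in> ?S"
  show "(f \<longlongrightarrow> f t) (at t within ?S)"
  proof (cases "t = a")
    case True
    have "at t within ?S \<le> at_right t"
      unfolding at_within_def using True by (intro inf_mono order_refl) auto
    then show ?thesis using right[of t] t by (auto intro: tendsto_mono)
  next
    case False
    then have "(f \<longlongrightarrow> f t) (at t)"
      using t left right by (intro filterlim_split_at) auto
    then show ?thesis by (rule tendsto_within_subset) simp
  qed
qed

lemma deriv_cong:
  assumes "(x has_vector_derivative v) (at t)" "t \<in> {a<..<b}" "\<And>q. q \<in> {a<..<b} \<Longrightarrow> x' q = x q"
  shows "(x' has_vector_derivative v) (at (t :: real))"
  by (rule has_vector_derivative_transform_within_open[OF assms(1) _ assms(2)]) (use assms(3) in auto)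

text \<open>The function stays below a barrier of slope \<open>e\<close> that also jumps by
  \<open>e\<close> at each point of \<open>D\<close>; letting \<open>e\<close> tend to 0 gives the
  claim. The assumption \<open>left\<close> lets \<open>f\<close> jump down, but not up, when an
  instant is reached from the left.\<close>

lemma dini_nonincreasing:
  fixes f :: "real \<Rightarrow> real"
  assumes "a \<le> b" "finite D"
    and right: "\<And>t e. a \<le> t \<Longrightarrow> t < b \<Longrightarrow> t \<notin> D \<Longrightarrow> 0 < e \<Longrightarrow>
      \<forall>\<^sub>F s in at_right t. f s \<le> f t + e * (s - t)"
    and jump: "\<And>t e. a \<le> t \<Longrightarrow> t < b \<Longrightarrow> t \<in> D \<Longrightarrow> 0 < e \<Longrightarrow>
      \<forall>\<^sub>F s in at_right t. f s \<le> f t + e"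
    and left: "\<And>t e. a < t \<Longrightarrow> t \<le> b \<Longrightarrow> 0 < e \<Longrightarrow> \<forall>\<^sub>F s in at_left t. f t \<le> f s + e"
  shows "f b \<le> f a"
proof -
  have main: "f b \<le> f a + e * (b - a + card D)" if "0 < e" for e
  proof -
    \<comment> \<open>The barrier: the cardinality counts the exceptional instants already passed,
      and each of them is granted an allowance \<open>e\<close>.\<close>
    define g where "g t = e * (t - a + card (D \<inter> {a..<t}))" for t
    have g_mono: "g s \<le> g t" if "s \<le> t" for s t
    proof -
      have "card (D \<inter> {a..<s}) \<le> card (D \<inter> {a..<t})"
        using assms(2) that by (intro card_mono) auto
      then show ?thesis using that \<open>0 < e\<close> by (simp add: g_def)
    qed
    have g_step: "g t + e * (s - t) \<le> g s" if "t < s" for s t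
    proof -
      have "card (D \<inter> {a..<t}) \<le> card (D \<inter> {a..<s})"
        using assms(2) that by (intro card_mono) auto
      then have "e * (s - a + card (D \<inter> {a..<t})) \<le> e * (s - a + card (D \<inter> {a..<s}))"
        using that \<open>0 < e\<close> by simp
      then show ?thesis by (simp add: g_def algebra_simps)
    qed
    have g_jump: "g t + e \<le> g s" if "t < s" "t \<in> D" "a \<le> t" for s t
    proof -
      have "card (insert t (D \<inter> {a..<t})) \<le> card (D \<inter> {a..<s})"
        using assms(2) that by (intro card_mono) auto
      then have "real (card (D \<inter> {a..<t})) + 1 \<le> card (D \<inter> {a..<s})"
        using assms(2) by simp
      then have "e * (t - a + (real (card (D \<inter> {a..<t})) + 1)) \<le> e * (s - a + card (D \<inter> {a..<s}))"
        using that \<open>0 < e\<close> by (intro mult_left_mono) auto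
      then show ?thesis by (simp add: g_def algebra_simps)
    qed
    have "\<forall>t\<in>{a..b}. f t \<le> f a + g t"
    proof (rule real_induct)
      show "a \<le> b" by fact
      show "f a \<le> f a + g a" by (simp add: g_def)
    next
      fix t assume t: "a \<le> t" "t < b" and IH: "\<forall>s\<in>{a..t}. f s \<le> f a + g s"
      have IHt: "f t \<le> f a + g t" using IH t by auto
      have "\<forall>\<^sub>F s in at_right t. t < s" by (rule eventually_at_right_less)
      show "\<forall>\<^sub>F s in at_right t. f s \<le> f a + g s"
      proof (cases "t \<in> D")
        case True
        show ?thesis using jump[OF t True that] \<open>\<forall>\<^sub>F s in at_right t. t < s\<close>
          by eventually_elim (use g_jump[OF _ True t(1)] IHt in fastforce)
      next
        case False
        show ?thesis using right[OF t False that] \<open>\<forall>\<^sub>F s in at_right t. t < s\<close>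
          by eventually_elim (use g_step IHt in fastforce)
      qed
    next
      fix t assume t: "a < t" "t \<le> b" and IH: "\<forall>s\<in>{a..<t}. f s \<le> f a + g s"
      show "f t \<le> f a + g t"
      proof (rule field_le_epsilon)
        fix e' :: real assume "0 < e'"
        have "\<forall>\<^sub>F s in at_left t. s \<in> {a<..<t}"
          using t(1) by (rule eventually_at_left_real)
        with left[OF t \<open>0 < e'\<close>] have "\<forall>\<^sub>F s in at_left t. f t \<le> f s + e' \<and> s \<in> {a<..<t}"
          by eventually_elim auto
        then obtain s where "f t \<le> f s + e'" "s \<in> {a<..<t}"
          using eventually_happens'[of "at_left t"] trivial_limit_at_left_real by blast
        then show "f t \<le> f a + g t + e'" using bspec[OF IH, of s] g_mono[of s t] by simp
      qed
    qed
    then have "f b \<le> f a + g b" using assms(1) by auto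
    also have "g b \<le> e * (b - a + card D)"
      using \<open>0 < e\<close> assms(2) by (simp add: g_def card_mono)
    finally show ?thesis by simp
  qed
  show ?thesis
  proof (rule field_le_epsilon)
    fix e :: real assume "0 < e"
    define c where "c = b - a + card D + 1"
    have "0 < c" using assms(1) by (simp add: c_def)
    have "f b \<le> f a + e / c * (b - a + card D)" using \<open>0 < e\<close> \<open>0 < c\<close> by (intro main) simp
    also have "e / c * (b - a + card D) \<le> e / c * c" using \<open>0 < e\<close> \<open>0 < c\<close>
      by (intro mult_left_mono) (auto simp: c_def)
    finally show "f b \<le> f a + e" using \<open>0 < c\<close> by simp
  qed
qed

text \<open>Picard iteration on the whole half-line: with the weight \<open>exp (- K t)\<close> the integral operator is
  a contraction of the space of bounded continuous functions.\<close>
lemma lipschitz_ode_exists: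
  fixes F :: "'b::banach \<Rightarrow> 'b"
  assumes lip: "\<And>y z. dist (F y) (F z) \<le> L * dist y z" and "0 \<le> L"
  shows "\<exists>x. x 0 = x0 \<and> (\<forall>t\<ge>0. (x has_vector_derivative F (x t)) (at t within {0..}))"
proof -
  \<comment> \<open>The weight makes the contraction constant \<open>L / K\<close> less than 1; the
    summand 1 keeps \<open>K\<close> positive when \<open>L = 0\<close>.\<close>
  define K where "K = 2 * L + 1"
  have "0 < K" using \<open>0 \<le> L\<close> by (simp add: K_def)
  have contF: "continuous_on UNIV F"
    using lip \<open>0 \<le> L\<close> by (intro lipschitz_on_continuous_on[of L] lipschitz_onI) auto
  \<comment> \<open>The unknown is the rescaled curve
    \<open>y s = exp (- K * s) *\<^sub>R x s\<close>, which is bounded although \<open>x\<close> may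
    grow exponentially.\<close>
  define G where "G y s = F (exp (K * s) *\<^sub>R apply_bcontfun y s)" for y :: "real \<Rightarrow>\<^sub>C 'b" and s
  have contG: "continuous_on X (G y)" for X y
    unfolding G_def by (intro continuous_on_compose2[OF contF] continuous_intros) auto
  have intG: "G y integrable_on {0..t}" for y t
    by (intro integrable_continuous_real contG)
  define z where "z y t = x0 + integral {0..t} (G y)" for y t
  \<comment> \<open>Bounded continuous functions live on the whole line; \<open>m\<close> freezes
    the operator at its value at 0 for negative times.\<close>
  define m where "m t = max 0 t" for t :: real
  define T where "T y t = exp (- K * m t) *\<^sub>R z y (m t)" for y t
  have growth: "norm (F y) \<le> norm (F 0) + L * norm y" for y
    using lip[of y 0] norm_triangle_ineq2[of "F y" "F 0"] by (simp add: dist_norm)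
  have intexp: "((\<lambda>s. exp (K * s)) has_integral (exp (K * t) - 1) / K) {0..t}" if "0 \<le> t" for t
  proof -
    have "((\<lambda>s. exp (K * s)) has_integral (exp (K * t) / K - exp (K * 0) / K)) {0..t}"
      using that \<open>0 < K\<close>
      by (intro fundamental_theorem_of_calculus)
         (auto intro!: derivative_eq_intros simp: has_real_derivative_iff_has_vector_derivative[symmetric])
    then show ?thesis by (simp add: diff_divide_distrib)
  qed
  have intexp_le: "exp (- K * t) * integral {0..t} (\<lambda>s. B * exp (K * s)) \<le> B / K"
    if "0 \<le> t" "0 \<le> B" for t B
  proof -
    have "integral {0..t} (\<lambda>s. B * exp (K * s)) = B * ((exp (K * t) - 1) / K)"
      using integral_unique[OF has_integral_mult_right[OF intexp[OF that(1)], of B]] by simp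
    then have "exp (- K * t) * integral {0..t} (\<lambda>s. B * exp (K * s)) = B / K * (1 - exp (- K * t))"
      by (simp add: field_simps exp_minus)
    also have "\<dots> \<le> B / K * 1" using that \<open>0 < K\<close> by (intro mult_left_mono) auto
    finally show ?thesis by simp
  qed
  have Tcont: "continuous_on UNIV (T y)" for y
  proof -
    have c: "continuous_on {0..} (\<lambda>t. integral {0..t} (G y))"
    proof (rule continuous_on_eq_continuous_within[THEN iffD2], intro ballI)
      fix t :: real assume "t \<in> {0..}"
      have "continuous_on {0..t+1} (\<lambda>t. integral {0..t} (G y))"
        by (intro indefinite_integral_continuous_1 intG)
      then have "continuous (at t within {0..t+1}) (\<lambda>t. integral {0..t} (G y))"
        using \<open>t \<in> {0..}\<close> by (auto simp: continuous_on_eq_continuous_within)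
      moreover have "at t within {0..t+1} = at t within {0..}"
        using \<open>t \<in> {0..}\<close> by (intro at_within_nhd[of _ "{..<t+1}"]) auto
      ultimately show "continuous (at t within {0..}) (\<lambda>t. integral {0..t} (G y))" by simp
    qed
    have mc: "continuous_on UNIV m" unfolding m_def by (intro continuous_intros)
    have "continuous_on UNIV (\<lambda>t. integral {0..m t} (G y))"
      by (rule continuous_on_compose2[OF c mc]) (auto simp: m_def)
    then show ?thesis unfolding T_def z_def
      by (intro continuous_intros mc)
  qed
  have Tbnd: "norm (T y t) \<le> norm x0 + (norm (F 0) + L * norm y) / K" for y t
  proof -
    have m0: "0 \<le> m t" by (simp add: m_def)
    define B where "B = norm (F 0) + L * norm y"
    have B0: "0 \<le> B" using \<open>0 \<le> L\<close> by (simp add: B_def)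
    have "norm (integral {0..m t} (G y)) \<le> integral {0..m t} (\<lambda>s. B * exp (K * s))"
    proof (rule integral_norm_bound_integral[OF intG])
      show "(\<lambda>s. B * exp (K * s)) integrable_on {0..m t}"
        by (intro integrable_continuous_real continuous_intros)
      fix s assume s: "s \<in> {0..m t}"
      have e1: "1 \<le> exp (K * s)" using s \<open>0 < K\<close> by simp
      have "norm (G y s) \<le> norm (F 0) + L * (exp (K * s) * norm (y s))"
        using growth[of "exp (K * s) *\<^sub>R y s"] by (simp add: G_def)
      moreover have "L * (exp (K * s) * norm (y s)) \<le> L * (exp (K * s) * norm y)"
        using \<open>0 \<le> L\<close> norm_bounded[of y s] by (intro mult_left_mono) auto
      moreover have "norm (F 0) * 1 \<le> norm (F 0) * exp (K * s)"
        using e1 by (intro mult_left_mono) auto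
      ultimately show "norm (G y s) \<le> B * exp (K * s)"
        by (simp add: B_def algebra_simps)
    qed
    then have "exp (- K * m t) * norm (integral {0..m t} (G y)) \<le> B / K"
      using intexp_le[OF m0 B0] by (meson dual_order.trans exp_ge_zero mult_left_mono)
    moreover have "exp (- K * m t) * norm x0 \<le> 1 * norm x0"
      using m0 \<open>0 < K\<close> by (intro mult_right_mono) auto
    moreover have "norm (T y t) \<le> exp (- K * m t) * (norm x0 + norm (integral {0..m t} (G y)))"
      unfolding T_def z_def by (simp add: norm_triangle_ineq)
    ultimately show ?thesis by (simp add: B_def algebra_simps)
  qed
  have Tin: "T y \<in> bcontfun" for y
    using Tcont Tbnd by (auto simp: bcontfun_def bounded_iff)
  define TT where "TT y = Bcontfun (T y)" for y
  have TT: "apply_bcontfun (TT y) = T y" for y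
    by (simp add: TT_def Bcontfun_inverse[OF Tin])
  have contr: "dist (TT y) (TT w) \<le> (L / K) * dist y w" for y w
  proof (rule dist_bound)
    fix t
    have m0: "0 \<le> m t" by (simp add: m_def)
    define B where "B = L * dist y w"
    have B0: "0 \<le> B" using \<open>0 \<le> L\<close> by (simp add: B_def)
    have "norm (integral {0..m t} (\<lambda>s. G y s - G w s)) \<le> integral {0..m t} (\<lambda>s. B * exp (K * s))"
    proof (rule integral_norm_bound_integral)
      show "(\<lambda>s. G y s - G w s) integrable_on {0..m t}"
        by (intro integrable_diff intG)
      show "(\<lambda>s. B * exp (K * s)) integrable_on {0..m t}"
        by (intro integrable_continuous_real continuous_intros)
      fix s assume s: "s \<in> {0..m t}"
      have "norm (G y s - G w s) \<le> L * dist (exp (K * s) *\<^sub>R y s) (exp (K * s) *\<^sub>R w s)"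
        using lip by (simp add: G_def dist_norm[symmetric])
      also have "dist (exp (K * s) *\<^sub>R y s) (exp (K * s) *\<^sub>R w s) = exp (K * s) * dist (y s) (w s)"
        by (simp add: dist_norm scaleR_diff_right[symmetric])
      also have "L * (exp (K * s) * dist (y s) (w s)) \<le> L * (exp (K * s) * dist y w)"
        using \<open>0 \<le> L\<close> dist_bounded[of y s w] by (intro mult_left_mono) auto
      finally show "norm (G y s - G w s) \<le> B * exp (K * s)"
        by (simp add: B_def algebra_simps)
    qed
    then have "exp (- K * m t) * norm (integral {0..m t} (\<lambda>s. G y s - G w s)) \<le> B / K"
      using intexp_le[OF m0 B0] by (meson dual_order.trans exp_ge_zero mult_left_mono)
    moreover have "T y t - T w t = exp (- K * m t) *\<^sub>R integral {0..m t} (\<lambda>s. G y s - G w s)"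
      unfolding T_def z_def by (simp add: Henstock_Kurzweil_Integration.integral_diff intG scaleR_diff_right[symmetric])
    ultimately show "dist (TT y t) (TT w t) \<le> (L / K) * dist y w"
      by (simp add: TT dist_norm B_def)
  qed
  have "0 \<le> L / K" "L / K < 1" using \<open>0 \<le> L\<close> \<open>0 < K\<close> by (auto simp: K_def)
  then obtain y where y: "TT y = y"
    using banach_fix_type[of "L / K" TT] contr by blast
  define x where "x t = exp (K * t) *\<^sub>R y t" for t
  have x: "x t = x0 + integral {0..t} (\<lambda>s. F (x s))" if "0 \<le> t" for t
  proof -
    have "y t = exp (- K * t) *\<^sub>R z y t" using that TT[of y] by (simp add: y T_def m_def)
    then have "x t = z y t" by (simp add: x_def exp_add[symmetric])
    also have "\<dots> = x0 + integral {0..t} (\<lambda>s. F (x s))" by (simp add: z_def G_def[abs_def] x_def)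
    finally show ?thesis .
  qed
  have "(x has_vector_derivative F (x t)) (at t within {0..})" if "0 \<le> t" for t
  proof -
    have "continuous_on {0..t+1} (\<lambda>s. F (x s))"
      using contG[of "{0..t+1}" y] by (simp add: G_def[abs_def] x_def)
    then have "((\<lambda>t. integral {0..t} (\<lambda>s. F (x s))) has_vector_derivative F (x t)) (at t within {0..t+1})"
      using that by (intro integral_has_vector_derivative) auto
    then have "((\<lambda>t. x0 + integral {0..t} (\<lambda>s. F (x s))) has_vector_derivative F (x t)) (at t within {0..t+1})"
      by (auto intro!: derivative_eq_intros)
    then have "(x has_vector_derivative F (x t)) (at t within {0..t+1})"
      by (rule has_vector_derivative_transform[rotated 2]) (use that x in auto)
    moreover have "at t within {0..t+1} = at t within {0..}"
      using that by (intro at_within_nhd[of _ "{..<t+1}"]) auto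
    ultimately show ?thesis by simp
  qed
  moreover have "x 0 = x0" using x[of 0] by simp
  ultimately show ?thesis by blast
qed

text \<open>Needed for the state space of \<open>truncated_solution\<close>, which consists of
  bounded functions on the discrete naturals, to be a Banach space.\<close>

instance bcontfun :: (metric_space, banach) banach ..

section \<open>Hybrid trajectories and their energy\<close>

locale agent_network =
  fixes S :: mas
  assumes mas: "multi_agent_system S"
begin

abbreviation "A \<equiv> agents S"
abbreviation "r \<equiv> comm_radius S"
abbreviation "eps \<equiv> hysteresis S"

lemma finite_A [simp]: "finite A" by (simp add: agents_def)

lemma A_nonempty: "A \<noteq> {}" using mas by (auto simp: multi_agent_system_def agents_def)

lemma radius_bounds: "0 < eps" "eps < r" "0 < r" "0 < min_radius S"
  using mas by (auto simp: multi_agent_system_def)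

section \<open>Hybrid dynamics of positions and graph\<close>

definition pairs :: "(nat \<times> nat) set" where
  "pairs = {(i, j). i \<in> A \<and> j \<in> A \<and> i \<noteq> j}"

lemma finite_pairs [simp]: "finite pairs"
  by (rule finite_subset[of _ "A \<times> A"]) (auto simp: pairs_def)

text \<open>The rules of \<open>connectivity_graph\<close> on an interval that starts at
  \<open>a\<close>, without the clause on initial edges, so that they can be restricted and
  glued.\<close>

definition edge_rules :: "real \<Rightarrow> ereal \<Rightarrow> (nat \<Rightarrow> real \<Rightarrow> real^2) \<Rightarrow> (real \<Rightarrow> (nat \<times> nat) set) \<Rightarrow> bool"
  where "edge_rules a T x E \<longleftrightarrow>
    (\<forall>t. a \<le> t \<and> ereal t < T \<longrightarrow> E t \<subseteq> pairs) \<and>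
    (\<forall>(i, j)\<in>pairs.
      (\<forall>t. a < t \<and> ereal t < T \<longrightarrow>
        ((i, j) \<in> E t \<longleftrightarrow>
          norm (x i t - x j t) \<le> r - eps \<or>
          r - eps < norm (x i t - x j t) \<and> norm (x i t - x j t) \<le> r \<and>
            (\<forall>\<^sub>F s in at_left t. (i, j) \<in> E s))) \<and>
      (\<forall>t. a \<le> t \<and> ereal t < T \<longrightarrow>
        ((i, j) \<in> E t \<and> (\<forall>\<^sub>F s in at_right t. norm (x i s - x j s) \<le> r) \<longrightarrow>
          (\<forall>\<^sub>F s in at_right t. (i, j) \<in> E s)) \<and>
        ((i, j) \<notin> E t \<longrightarrow> (\<forall>\<^sub>F s in at_right t. (i, j) \<notin> E s))))"

text \<open>Instead of some exceptional set, the set of instants where the derivative fails is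
  itself required to be locally finite; this set is canonical and needs no witness.\<close>

definition motion :: "real \<Rightarrow> ereal \<Rightarrow> (nat \<Rightarrow> real \<Rightarrow> real^2) \<Rightarrow> (nat \<Rightarrow> real \<Rightarrow> real^2) \<Rightarrow> bool"
  where "motion a T x u \<longleftrightarrow>
    (\<forall>i\<in>A. continuous_on {t. a \<le> t \<and> ereal t < T} (x i) \<and>
      (\<forall>b. ereal b < T \<longrightarrow>
        finite {t. a < t \<and> t \<le> b \<and> \<not> (x i has_vector_derivative u i t) (at t)}))"

definition hybrid :: "real \<Rightarrow> ereal \<Rightarrow> (nat \<Rightarrow> real \<Rightarrow> real^2) \<Rightarrow> (real \<Rightarrow> (nat \<times> nat) set) \<Rightarrow>
    (nat \<Rightarrow> real \<Rightarrow> real^2) \<Rightarrow> bool"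
  where "hybrid a T x E u \<longleftrightarrow> motion a T x u \<and> edge_rules a T x E"

lemma edge_rulesD:
  assumes "edge_rules a T x E"
  shows "\<And>t. a \<le> t \<Longrightarrow> ereal t < T \<Longrightarrow> E t \<subseteq> pairs"
    and "\<And>i j t. (i, j) \<in> pairs \<Longrightarrow> a < t \<Longrightarrow> ereal t < T \<Longrightarrow>
      (i, j) \<in> E t \<longleftrightarrow> norm (x i t - x j t) \<le> r - eps \<or>
        r - eps < norm (x i t - x j t) \<and> norm (x i t - x j t) \<le> r \<and>
          (\<forall>\<^sub>F s in at_left t. (i, j) \<in> E s)"
    and "\<And>i j t. (i, j) \<in> pairs \<Longrightarrow> a \<le> t \<Longrightarrow> ereal t < T \<Longrightarrow> (i, j) \<in> E t \<Longrightarrow>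
      \<forall>\<^sub>F s in at_right t. norm (x i s - x j s) \<le> r \<Longrightarrow> \<forall>\<^sub>F s in at_right t. (i, j) \<in> E s"
    and "\<And>i j t. (i, j) \<in> pairs \<Longrightarrow> a \<le> t \<Longrightarrow> ereal t < T \<Longrightarrow> (i, j) \<notin> E t \<Longrightarrow>
      \<forall>\<^sub>F s in at_right t. (i, j) \<notin> E s"
  using assms unfolding edge_rules_def by blast+

lemma hybrid_restrict:
  assumes "hybrid a T x E u" "a \<le> a'" "T' \<le> T"
  shows "hybrid a' T' x E u"
proof -
  have m: "motion a T x u" and e: "edge_rules a T x E" using assms(1) by (auto simp: hybrid_def)
  have "motion a' T' x u"
    unfolding motion_def
  proof (intro ballI conjI allI impI)
    fix i assume "i \<in> A"
    show "continuous_on {t. a' \<le> t \<and> ereal t < T'} (x i)"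
      using m \<open>i \<in> A\<close> assms(2,3) unfolding motion_def
      by (auto elim!: ballE[of _ _ i] intro: continuous_on_subset dest: less_le_trans)
    fix b assume "ereal b < T'"
    then have "finite {t. a < t \<and> t \<le> b \<and> \<not> (x i has_vector_derivative u i t) (at t)}"
      using m \<open>i \<in> A\<close> assms(3) unfolding motion_def by (blast intro: less_le_trans)
    then show "finite {t. a' < t \<and> t \<le> b \<and> \<not> (x i has_vector_derivative u i t) (at t)}"
      by (rule rev_finite_subset) (use assms(2) in auto)
  qed
  moreover have "edge_rules a' T' x E"
    unfolding edge_rules_def
  proof (intro conjI allI impI ballI; clarify)
    fix t i j assume "a' \<le> t" "ereal t < T'" "(i, j) \<in> E t"
    then show "(i, j) \<in> pairs" using edge_rulesD(1)[OF e, of t] assms(2,3) by (auto dest: less_le_trans)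
  next
    fix i j assume ij: "(i, j) \<in> pairs"
    have dom: "a < t" if "a' < t" for t using that assms(2) by simp
    have dom': "a \<le> t" if "a' \<le> t" for t using that assms(2) by simp
    have up: "ereal t < T" if "ereal t < T'" for t using that assms(3) by (rule less_le_trans)
    show "(\<forall>t. a' < t \<and> ereal t < T' \<longrightarrow>
        ((i, j) \<in> E t \<longleftrightarrow>
          norm (x i t - x j t) \<le> r - eps \<or>
          r - eps < norm (x i t - x j t) \<and> norm (x i t - x j t) \<le> r \<and>
            (\<forall>\<^sub>F s in at_left t. (i, j) \<in> E s))) \<and>
      (\<forall>t. a' \<le> t \<and> ereal t < T' \<longrightarrow>
        ((i, j) \<in> E t \<and> (\<forall>\<^sub>F s in at_right t. norm (x i s - x j s) \<le> r) \<longrightarrow>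
          (\<forall>\<^sub>F s in at_right t. (i, j) \<in> E s)) \<and>
        ((i, j) \<notin> E t \<longrightarrow> (\<forall>\<^sub>F s in at_right t. (i, j) \<notin> E s)))"
      using edge_rulesD(2-4)[OF e ij] dom dom' up by meson
  qed
  ultimately show ?thesis by (simp add: hybrid_def)
qed

lemma hybrid_tendsto:
  assumes "hybrid a T x E u" "i \<in> A"
  shows "\<And>t. a \<le> t \<Longrightarrow> ereal t < T \<Longrightarrow> (x i \<longlongrightarrow> x i t) (at_right t)"
    and "\<And>t. a < t \<Longrightarrow> ereal t < T \<Longrightarrow> (x i \<longlongrightarrow> x i t) (at_left t)"
    and "\<And>s b. a \<le> s \<Longrightarrow> ereal b < T \<Longrightarrow> continuous_on {s..b} (x i)"
proof -
  have c: "continuous_on {t. a \<le> t \<and> ereal t < T} (x i)"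
    using assms by (auto simp: hybrid_def motion_def)
  show sub: "continuous_on {s..b} (x i)" if "a \<le> s" "ereal b < T" for s b
    by (rule continuous_on_subset[OF c])
      (use that in \<open>auto intro: le_less_trans[of "ereal _" "ereal b"]\<close>)
  show "(x i \<longlongrightarrow> x i t) (at_right t)" if "a \<le> t" "ereal t < T" for t
  proof -
    obtain b where "ereal t < ereal b" "ereal b < T" using ereal_dense2 \<open>ereal t < T\<close> by blast
    then show ?thesis using continuous_on_Icc_at_rightD[OF sub[OF that(1)]] by simp
  qed
  show "(x i \<longlongrightarrow> x i t) (at_left t)" if "a < t" "ereal t < T" for t
    using continuous_on_Icc_at_leftD[OF sub[OF order_refl that(2)] that(1)] .
qed

section \<open>The controller as the negative gradient of an energy\<close>

definition ctrl :: "(nat \<times> nat) set \<Rightarrow> nat \<Rightarrow> real^2 \<Rightarrow> (nat \<Rightarrow> real^2) \<Rightarrow> nat \<Rightarrow> real^2" where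
  "ctrl F l c p i =
    - ((if i = l then 1 else 0) *\<^sub>R (p i - c)) -
      (\<Sum>j\<in>{j. (i, j) \<in> F}. (2 * r\<^sup>2 / (r\<^sup>2 - (norm (p i - p j))\<^sup>2)\<^sup>2) *\<^sub>R (p i - p j))"

text \<open>A function of the squared distance, hence smooth where two agents coincide. The gain in
  \<open>ctrl\<close> is twice its derivative.\<close>

definition pot :: "real \<Rightarrow> real" where "pot s = r\<^sup>2 / (r\<^sup>2 - s)"

text \<open>A pair outside the graph is charged the potential at the distance \<open>r - eps\<close>. This is the
  distance at which an edge appears, so the energy does not jump when the graph grows.\<close>
definition energy :: "(nat \<times> nat) set \<Rightarrow> nat \<Rightarrow> real^2 \<Rightarrow> (nat \<Rightarrow> real^2) \<Rightarrow> real" where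
  "energy F l c p = (norm (p l - c))\<^sup>2 / 2 +
    (\<Sum>(i, j)\<in>pairs. if (i, j) \<in> F then pot ((norm (p i - p j))\<^sup>2) else pot ((r - eps)\<^sup>2)) / 2"

text \<open>The invariant of the whole proof. Both distance conditions are strict, so they persist
  for a short time; the second one says that no pair close enough to be forced into the graph is
  missing from it.\<close>

definition safe :: "(nat \<Rightarrow> real^2) \<Rightarrow> (nat \<times> nat) set \<Rightarrow> bool" where
  "safe p F \<longleftrightarrow> F \<subseteq> pairs \<and> sym F \<and> (\<forall>(i, j)\<in>F. norm (p i - p j) < r) \<and>
    (\<forall>(i, j)\<in>pairs - F. r - eps < norm (p i - p j)) \<and> connected_graph A F"

lemma pot_mono: "s \<le> s' \<Longrightarrow> s' < r\<^sup>2 \<Longrightarrow> pot s \<le> pot s'"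
  unfolding pot_def by (intro divide_left_mono mult_pos_pos) auto

lemma pot_pos: "s < r\<^sup>2 \<Longrightarrow> 0 < pot s"
  using radius_bounds(3) by (simp add: pot_def)

lemma pot_derivative:
  assumes "r\<^sup>2 - s \<noteq> 0"
  shows "(pot has_real_derivative r\<^sup>2 / (r\<^sup>2 - s)\<^sup>2) (at s)"
  unfolding pot_def[abs_def] using assms
  by (auto intro!: derivative_eq_intros simp: power2_eq_square)

lemma sq_less: "norm (p - q :: real^2) < r \<Longrightarrow> (norm (p - q))\<^sup>2 < r\<^sup>2"
  using radius_bounds by (intro power_strict_mono) auto

lemma pot_eps_pos: "(r - eps)\<^sup>2 < r\<^sup>2" "0 < pot ((r - eps)\<^sup>2)"
proof -
  show "(r - eps)\<^sup>2 < r\<^sup>2" using radius_bounds by (intro power_strict_mono) auto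
  then show "0 < pot ((r - eps)\<^sup>2)" by (rule pot_pos)
qed

lemma finite_neighbours: "F \<subseteq> pairs \<Longrightarrow> finite {j. (i, j) \<in> F}"
  by (rule finite_subset[of _ A]) (auto simp: pairs_def)

lemma sum_edges: "F \<subseteq> pairs \<Longrightarrow> (\<Sum>(i, j)\<in>F. f i j) = (\<Sum>i\<in>A. \<Sum>j\<in>{j. (i, j) \<in> F}. f i j)"
proof -
  assume F: "F \<subseteq> pairs"
  then have "F = (SIGMA i:A. {j. (i, j) \<in> F})" by (auto simp: pairs_def)
  then show ?thesis
    using sum.Sigma[of A "\<lambda>i. {j. (i, j) \<in> F}" f] finite_neighbours[OF F] by simp
qed

lemma sum_sym_edges:
  assumes "sym F"
  shows "(\<Sum>(i, j)\<in>F. f i j) = (\<Sum>(i, j)\<in>F. f j i)"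
  by (rule sum.reindex_bij_witness[of _ prod.swap prod.swap]) (use assms in \<open>auto dest: symD\<close>)

text \<open>Summation by parts on the graph: every edge occurs in both orientations, and
  \<open>q\<close> is antisymmetric, so the two halves of the difference contribute equally.\<close>

lemma sum_edges_inner:
  fixes v :: "nat \<Rightarrow> real^2" and q :: "nat \<Rightarrow> nat \<Rightarrow> real^2"
  assumes "F \<subseteq> pairs" "sym F" and q: "\<And>i j. q j i = - q i j"
  shows "(\<Sum>(i, j)\<in>F. q i j \<bullet> (v i - v j)) / 2 = (\<Sum>i\<in>A. v i \<bullet> (\<Sum>j\<in>{j. (i, j) \<in> F}. q i j))"
proof -
  have "(\<Sum>(i, j)\<in>F. q i j \<bullet> v j) = (\<Sum>(i, j)\<in>F. q j i \<bullet> v i)"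
    by (rule sum_sym_edges[OF assms(2)])
  also have "\<dots> = (\<Sum>(i, j)\<in>F. - (q i j \<bullet> v i))"
    by (intro sum.cong refl) (simp add: q[of "fst _" "snd _"] case_prod_unfold)
  also have "\<dots> = - (\<Sum>(i, j)\<in>F. q i j \<bullet> v i)"
    by (simp add: sum_negf case_prod_unfold)
  finally have "(\<Sum>(i, j)\<in>F. q i j \<bullet> (v i - v j)) = 2 * (\<Sum>(i, j)\<in>F. q i j \<bullet> v i)"
    by (simp add: inner_diff_right sum_subtractf case_prod_unfold)
  then show ?thesis
    by (simp add: sum_edges[OF assms(1)] inner_sum_right inner_commute)
qed

text \<open>The weak form of the controller. It is tested with velocities for the energy, with the
  constant \<open>p l - c\<close> to cancel the interaction, and with \<open>p i - c\<close> to
  bound the edges.\<close>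

lemma ctrl_inner:
  assumes F: "F \<subseteq> pairs" "sym F" and l: "l \<in> A"
  shows "(\<Sum>i\<in>A. v i \<bullet> ctrl F l c p i) = - (v l \<bullet> (p l - c)) -
    (\<Sum>(i, j)\<in>F. (2 * r\<^sup>2 / (r\<^sup>2 - (norm (p i - p j))\<^sup>2)\<^sup>2) *\<^sub>R (p i - p j) \<bullet> (v i - v j)) / 2"
proof -
  define q where "q i j = (2 * r\<^sup>2 / (r\<^sup>2 - (norm (p i - p j))\<^sup>2)\<^sup>2) *\<^sub>R (p i - p j)" for i j
  have q: "q j i = - q i j" for i j
    by (simp add: q_def norm_minus_commute scaleR_minus_right[symmetric] del: scaleR_minus_right)
  have "(\<Sum>i\<in>A. v i \<bullet> ctrl F l c p i) =
      (\<Sum>i\<in>A. - (if i = l then v i \<bullet> (p i - c) else 0) - v i \<bullet> (\<Sum>j\<in>{j. (i, j) \<in> F}. q i j))"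
    by (intro sum.cong) (auto simp: ctrl_def q_def inner_diff_right)
  also have "\<dots> = - (v l \<bullet> (p l - c)) - (\<Sum>i\<in>A. v i \<bullet> (\<Sum>j\<in>{j. (i, j) \<in> F}. q i j))"
    using l by (simp add: sum_subtractf sum_negf)
  finally show ?thesis
    using sum_edges_inner[where q = q and v = v, OF F q] by (simp add: q_def)
qed

text \<open>The chain rule says that \<open>ctrl\<close> is the negative gradient of the energy. The
  velocities are arbitrary, so that a resting phase is covered as well.\<close>

lemma energy_derivative:
  assumes F: "F \<subseteq> pairs" "sym F" "\<forall>(i, j)\<in>F. norm (x i t - x j t) < r" and l: "l \<in> A"
    and d: "\<And>i. i \<in> A \<Longrightarrow> (x i has_vector_derivative v i) (at t within X)"
  shows "((\<lambda>s. energy F l c (\<lambda>i. x i s)) has_real_derivative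
    - (\<Sum>i\<in>A. v i \<bullet> ctrl F l c (\<lambda>i. x i t) i)) (at t within X)"
proof -
  define q where "q i j = (2 * r\<^sup>2 / (r\<^sup>2 - (norm (x i t - x j t))\<^sup>2)\<^sup>2) *\<^sub>R (x i t - x j t)" for i j
  have sq: "((\<lambda>s. (norm (f s))\<^sup>2) has_real_derivative 2 * (f t \<bullet> f')) (at t within X)"
    if "(f has_vector_derivative f') (at t within X)" for f :: "real \<Rightarrow> real^2" and f'
    using bounded_bilinear.has_vector_derivative[OF bounded_bilinear_inner that that]
    by (simp add: power2_norm_eq_inner has_real_derivative_iff_has_vector_derivative inner_commute)
  have pair: "((\<lambda>s. if (i, j) \<in> F then pot ((norm (x i s - x j s))\<^sup>2) else pot ((r - eps)\<^sup>2))
      has_real_derivative (if (i, j) \<in> F then q i j \<bullet> (v i - v j) else 0)) (at t within X)"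
    if "(i, j) \<in> pairs" for i j
  proof (cases "(i, j) \<in> F")
    case True
    have ij: "i \<in> A" "j \<in> A" using that by (auto simp: pairs_def)
    have "(norm (x i t - x j t))\<^sup>2 < r\<^sup>2" using F(3) True by (intro sq_less) auto
    then have ne: "r\<^sup>2 - (norm (x i t - x j t))\<^sup>2 \<noteq> 0" by simp
    have "((\<lambda>s. (norm (x i s - x j s))\<^sup>2) has_real_derivative
        2 * ((x i t - x j t) \<bullet> (v i - v j))) (at t within X)"
      by (intro sq has_vector_derivative_diff d ij)
    then have "((\<lambda>s. pot ((norm (x i s - x j s))\<^sup>2)) has_real_derivative
        r\<^sup>2 / (r\<^sup>2 - (norm (x i t - x j t))\<^sup>2)\<^sup>2 * (2 * ((x i t - x j t) \<bullet> (v i - v j)))) (at t within X)"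
      by (rule DERIV_chain2[where f = pot and g = "\<lambda>s. (norm (x i s - x j s))\<^sup>2",
          OF pot_derivative[OF ne]])
    moreover have "q i j \<bullet> (v i - v j) =
        r\<^sup>2 / (r\<^sup>2 - (norm (x i t - x j t))\<^sup>2)\<^sup>2 * (2 * ((x i t - x j t) \<bullet> (v i - v j)))"
      unfolding q_def inner_scaleR_left by simp
    ultimately show ?thesis using True by simp
  qed simp
  have "((\<lambda>s. energy F l c (\<lambda>i. x i s)) has_real_derivative
      (2 * ((x l t - c) \<bullet> v l)) / 2 +
      (\<Sum>(i, j)\<in>pairs. if (i, j) \<in> F then q i j \<bullet> (v i - v j) else 0) / 2) (at t within X)"
    unfolding energy_def case_prod_unfold
  proof (intro DERIV_add DERIV_cdivide DERIV_sum)
    have "((\<lambda>s. x l s - c) has_vector_derivative v l) (at t within X)"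
      using has_vector_derivative_diff[OF d[OF l] has_vector_derivative_const] by simp
    then show "((\<lambda>s. (norm (x l s - c))\<^sup>2) has_real_derivative 2 * ((x l t - c) \<bullet> v l)) (at t within X)"
      by (rule sq)
  next
    fix e assume "e \<in> pairs"
    then show "((\<lambda>s. if (fst e, snd e) \<in> F then pot ((norm (x (fst e) s - x (snd e) s))\<^sup>2)
        else pot ((r - eps)\<^sup>2)) has_real_derivative
        (if (fst e, snd e) \<in> F then q (fst e) (snd e) \<bullet> (v (fst e) - v (snd e)) else 0)) (at t within X)"
      by (intro pair) simp
  qed
  also have "(\<Sum>(i, j)\<in>pairs. if (i, j) \<in> F then q i j \<bullet> (v i - v j) else 0) =
      (\<Sum>(i, j)\<in>F. q i j \<bullet> (v i - v j))"
    by (rule sum.mono_neutral_cong_right) (use F(1) in auto)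
  also have "(2 * ((x l t - c) \<bullet> v l)) / 2 + (\<Sum>(i, j)\<in>F. q i j \<bullet> (v i - v j)) / 2 =
      - (\<Sum>i\<in>A. v i \<bullet> ctrl F l c (\<lambda>i. x i t) i)"
    using ctrl_inner[OF F(1,2) l, of v c "\<lambda>i. x i t"] by (simp add: q_def inner_commute)
  finally show ?thesis .
qed

lemma energy_tendsto:
  assumes "F \<subseteq> pairs" "\<forall>(i, j)\<in>F. norm (p i - p j) < r" "l \<in> A"
    and "\<And>i. i \<in> A \<Longrightarrow> (x i \<longlongrightarrow> p i) net"
  shows "((\<lambda>s. energy F l c (\<lambda>i. x i s)) \<longlongrightarrow> energy F l c p) net"
proof -
  have pair: "((\<lambda>s. if (i, j) \<in> F then pot ((norm (x i s - x j s))\<^sup>2) else pot ((r - eps)\<^sup>2)) \<longlongrightarrow>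
      (if (i, j) \<in> F then pot ((norm (p i - p j))\<^sup>2) else pot ((r - eps)\<^sup>2))) net"
    if "(i, j) \<in> pairs" for i j
  proof (cases "(i, j) \<in> F")
    case True
    have ij: "i \<in> A" "j \<in> A" using that by (auto simp: pairs_def)
    have "(norm (p i - p j))\<^sup>2 < r\<^sup>2" using assms(2) True by (intro sq_less) auto
    then show ?thesis using True unfolding pot_def
      by (auto intro!: tendsto_intros assms(4) ij)
  qed simp
  have sums: "((\<lambda>s. \<Sum>(i, j)\<in>pairs. if (i, j) \<in> F then pot ((norm (x i s - x j s))\<^sup>2) else pot ((r - eps)\<^sup>2)) \<longlongrightarrow>
      (\<Sum>(i, j)\<in>pairs. if (i, j) \<in> F then pot ((norm (p i - p j))\<^sup>2) else pot ((r - eps)\<^sup>2))) net"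
    unfolding case_prod_unfold by (intro tendsto_sum pair) simp
  moreover have "((\<lambda>s. (norm (x l s - c))\<^sup>2 / 2) \<longlongrightarrow> (norm (p l - c))\<^sup>2 / 2) net"
    by (intro tendsto_intros assms(3,4)) auto
  ultimately show ?thesis unfolding energy_def
    using tendsto_add[OF _ tendsto_divide[OF sums tendsto_const]] by auto
qed

text \<open>All summands are nonnegative and the sum is halved, so a single edge has potential at
  most \<open>2 * C\<close>; solving \<open>r\<^sup>2 / (r\<^sup>2 - s) \<le> 2 * C\<close> for
  \<open>s\<close> gives a margin below \<open>r\<^sup>2\<close> that depends on \<open>C\<close>
  alone.\<close>

lemma energy_bounds:
  assumes "F \<subseteq> pairs" "\<forall>(i, j)\<in>F. norm (p i - p j) < r"
  shows "0 \<le> energy F l c p"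
    and "(i, j) \<in> F \<Longrightarrow> energy F l c p \<le> C \<Longrightarrow> (norm (p i - p j))\<^sup>2 \<le> r\<^sup>2 - r\<^sup>2 / (2 * C)"
proof -
  let ?g = "\<lambda>(i, j). if (i, j) \<in> F then pot ((norm (p i - p j))\<^sup>2) else pot ((r - eps)\<^sup>2)"
  have pos: "0 \<le> ?g e" for e
    using assms(2) pot_eps_pos(2) by (cases e) (auto intro!: less_imp_le pot_pos sq_less)
  show "0 \<le> energy F l c p" unfolding energy_def using pos by (intro add_nonneg_nonneg) (auto intro!: sum_nonneg)
  assume ij: "(i, j) \<in> F" and C: "energy F l c p \<le> C"
  let ?s = "(norm (p i - p j))\<^sup>2"
  have s: "?s < r\<^sup>2" using assms(2) ij by (intro sq_less) auto
  have "?g (i, j) \<le> sum ?g pairs"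
    using pos ij assms(1) by (intro member_le_sum) auto
  then have "pot ?s \<le> sum ?g pairs" using ij by simp
  moreover have "sum ?g pairs \<le> 2 * C"
    using C zero_le_power2[of "norm (p l - c)"] unfolding energy_def by linarith
  ultimately have "pot ?s \<le> 2 * C" by simp
  moreover from this have "0 < C" using pot_pos[OF s] by simp
  ultimately have "r\<^sup>2 / (2 * C) \<le> r\<^sup>2 - ?s" using s by (simp add: pot_def field_simps)
  then show "?s \<le> r\<^sup>2 - r\<^sup>2 / (2 * C)" by simp
qed

lemma connected_graph_mono: "connected_graph V F \<Longrightarrow> F \<subseteq> F' \<Longrightarrow> connected_graph V F'"
  unfolding connected_graph_def using rtrancl_mono by blast

lemma safeD:
  assumes "safe p F"
  shows "F \<subseteq> pairs" "sym F" "\<forall>(i, j)\<in>F. norm (p i - p j) < r"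
    "\<And>i j. (i, j) \<in> F \<Longrightarrow> norm (p i - p j) < r"
    "\<And>i j. (i, j) \<in> pairs \<Longrightarrow> (i, j) \<notin> F \<Longrightarrow> r - eps < norm (p i - p j)"
    "connected_graph A F"
  using assms by (auto simp: safe_def)

lemma safeI:
  assumes "F \<subseteq> pairs" "sym F" "connected_graph A F"
    and "\<And>i j. (i, j) \<in> F \<Longrightarrow> norm (p i - p j) < r"
    and "\<And>i j. (i, j) \<in> pairs \<Longrightarrow> (i, j) \<notin> F \<Longrightarrow> r - eps < norm (p i - p j)"
  shows "safe p F"
  using assms by (auto simp: safe_def)

lemma safe_cong:
  assumes "\<And>i. i \<in> A \<Longrightarrow> p i = q i" "safe p F"
  shows "safe q F"
proof -
  have eq: "norm (q i - q j) = norm (p i - p j)" if "(i, j) \<in> pairs" for i j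
    using assms(1) that by (simp add: pairs_def)
  show ?thesis unfolding safe_def
  proof (intro conjI ballI; clarify?)
    show "norm (q i - q j) < r" if "(i, j) \<in> F" for i j
      using eq[of i j] safeD(1,4)[OF assms(2)] that by auto
    show "r - eps < norm (q i - q j)" if "(i, j) \<in> pairs" "(i, j) \<notin> F" for i j
      using eq[of i j] safeD(5)[OF assms(2)] that by auto
  qed (use safeD[OF assms(2)] in blast)+
qed

lemma distance_tendsto:
  assumes "hybrid a T x E u" "(i, j) \<in> pairs"
  shows "\<And>t. a \<le> t \<Longrightarrow> ereal t < T \<Longrightarrow>
      ((\<lambda>q. norm (x i q - x j q)) \<longlongrightarrow> norm (x i t - x j t)) (at_right t)"
    and "\<And>t. a < t \<Longrightarrow> ereal t < T \<Longrightarrow>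
      ((\<lambda>q. norm (x i q - x j q)) \<longlongrightarrow> norm (x i t - x j t)) (at_left t)"
  using assms hybrid_tendsto[OF assms(1)] by (auto simp: pairs_def intro!: tendsto_intros)

section \<open>Growth of the graph around an instant\<close>

text \<open>While the state is safe an edge is shorter than \<open>r\<close>, so at a limit from the
  left it is at most \<open>r\<close> long, which the hysteresis rule still accepts. Safety is not
  assumed at \<open>b\<close>, because this lemma helps to establish it there.\<close>

lemma edges_persist:
  assumes h: "hybrid a T x E u" and "a \<le> s" "s \<le> b" "ereal b < T"
    and safe: "\<forall>t\<in>{s..<b}. safe (\<lambda>i. x i t) (E t)" and e: "e \<in> E s"
  shows "e \<in> E b"
proof -
  obtain i j where ij: "e = (i, j)" by (cases e)
  have rules: "edge_rules a T x E" using h by (simp add: hybrid_def)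
  have dom: "a \<le> t" "ereal t < T" if "s \<le> t" "t \<le> b" for t
    using that assms(2,4) by (auto intro: le_less_trans[of "ereal t" "ereal b"])
  have p: "(i, j) \<in> pairs" using edge_rulesD(1)[OF rules dom] e ij assms(3) by blast
  have "\<forall>t\<in>{s..b}. (i, j) \<in> E t"
  proof (rule real_induct)
    fix t assume t: "s \<le> t" "t < b" and IH: "\<forall>q\<in>{s..t}. (i, j) \<in> E q"
    have d: "a \<le> t" "ereal t < T" using dom t by auto
    have "norm (x i t - x j t) < r" using safeD(4)[of "\<lambda>i. x i t" "E t" i j] safe IH t by auto
    then have "\<forall>\<^sub>F q in at_right t. norm (x i q - x j q) < r"
      by (rule order_tendstoD(2)[OF distance_tendsto(1)[OF h p d]])
    then have "\<forall>\<^sub>F q in at_right t. norm (x i q - x j q) \<le> r"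
      by (rule eventually_mono) simp
    then show "\<forall>\<^sub>F q in at_right t. (i, j) \<in> E q"
      using edge_rulesD(3)[OF rules p d] IH t by auto
  next
    fix t assume t: "s < t" "t \<le> b" and IH: "\<forall>q\<in>{s..<t}. (i, j) \<in> E q"
    have d: "a < t" "ereal t < T" using dom t assms(2) by auto
    have ev: "\<forall>\<^sub>F q in at_left t. q \<in> {s<..<t}" by (rule eventually_at_left_real[OF t(1)])
    then have 1: "\<forall>\<^sub>F q in at_left t. (i, j) \<in> E q"
      by eventually_elim (use IH in auto)
    from ev have "\<forall>\<^sub>F q in at_left t. norm (x i q - x j q) \<le> r"
    proof eventually_elim
      case (elim q)
      then show ?case using safeD(4)[of "\<lambda>i. x i q" "E q" i j] safe IH t by force
    qed
    then have "norm (x i t - x j t) \<le> r"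
      by (rule tendsto_upperbound[OF distance_tendsto(2)[OF h p d]]) simp
    then show "(i, j) \<in> E t" using edge_rulesD(2)[OF rules p d] 1 by auto
  qed (use assms ij in auto)
  then show ?thesis using ij assms(3) by auto
qed

text \<open>Edges only accumulate and there are finitely many pairs, so the graph is eventually
  constant before \<open>t\<close>, namely the union of all earlier graphs.\<close>

lemma edges_at_left:
  assumes h: "hybrid a T x E u" and "a \<le> s" "s < t" "ereal t < T"
    and safe: "\<forall>q\<in>{s..<t}. safe (\<lambda>i. x i q) (E q)"
  shows "\<forall>\<^sub>F q in at_left t. q \<in> {s<..<t} \<and> E q = (\<Union>q\<in>{s..<t}. E q)"
proof -
  have sub: "(\<Union>q\<in>{s..<t}. E q) \<subseteq> pairs" using safe safeD(1) by blast
  have "\<forall>\<^sub>F q in at_left t. e \<in> (\<Union>q\<in>{s..<t}. E q) \<longrightarrow> e \<in> E q" if "e \<in> pairs" for e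
  proof (cases "e \<in> (\<Union>q\<in>{s..<t}. E q)")
    case True
    then obtain s' where s': "s' \<in> {s..<t}" "e \<in> E s'" by blast
    have "\<forall>\<^sub>F q in at_left t. q \<in> {s'<..<t}" using s' by (intro eventually_at_left_real) auto
    then show ?thesis
    proof eventually_elim
      case (elim q)
      have "e \<in> E q"
      proof (rule edges_persist[OF h _ _ _ _ s'(2)])
        show "ereal q < T" using elim assms(4) by (auto intro: less_trans[of "ereal q" "ereal t"])
        show "\<forall>t\<in>{s'..<q}. safe (\<lambda>i. x i t) (E t)" using safe elim s' by auto
      qed (use s' elim assms in auto)
      then show ?case by simp
    qed
  qed simp
  then have "\<forall>\<^sub>F q in at_left t. \<forall>e\<in>pairs. e \<in> (\<Union>q\<in>{s..<t}. E q) \<longrightarrow> e \<in> E q"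
    by (intro eventually_ball_finite) auto
  moreover have "\<forall>\<^sub>F q in at_left t. q \<in> {s<..<t}" by (rule eventually_at_left_real[OF assms(3)])
  ultimately show ?thesis
  proof eventually_elim
    case (elim q)
    then have "q \<in> {s..<t}" by auto
    then show ?case using elim sub by blast
  qed
qed

text \<open>Edges stay shorter than \<open>r\<close> for a while by continuity, so the two rules
  about right neighbourhoods freeze every edge and every missing edge.\<close>

lemma edges_at_right:
  assumes h: "hybrid a T x E u" and t: "a \<le> t" "ereal t < T" and safe: "safe (\<lambda>i. x i t) (E t)"
  shows "\<forall>\<^sub>F q in at_right t. a < q \<and> ereal q < T \<and> E q = E t"
proof -
  have rules: "edge_rules a T x E" using h by (simp add: hybrid_def)
  have "\<forall>\<^sub>F q in at_right t. e \<in> E q \<longleftrightarrow> e \<in> E t" if "e \<in> pairs" for e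
  proof -
    obtain i j where e: "e = (i, j)" by (cases e)
    show ?thesis
    proof (cases "e \<in> E t")
      case True
      have "\<forall>\<^sub>F q in at_right t. norm (x i q - x j q) < r"
        using safeD(4)[OF safe, of i j] True e that
        by (intro order_tendstoD(2)[OF distance_tendsto(1)[OF h _ t]]) auto
      then have "\<forall>\<^sub>F q in at_right t. norm (x i q - x j q) \<le> r"
        by (rule eventually_mono) simp
      then show ?thesis using edge_rulesD(3)[OF rules _ t, of i j] True that e by simp
    next
      case False
      then show ?thesis using edge_rulesD(4)[OF rules _ t, of i j] that e by simp
    qed
  qed
  then have 1: "\<forall>\<^sub>F q in at_right t. \<forall>e\<in>pairs. e \<in> E q \<longleftrightarrow> e \<in> E t"
    by (intro eventually_ball_finite) auto
  obtain b where "ereal t < ereal b" "ereal b < T" using ereal_dense2[OF t(2)] by blast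
  then have 2: "\<forall>\<^sub>F q in at_right t. q \<in> {t<..<b}" by (intro eventually_at_right_real) simp
  from 1 2 show ?thesis
  proof eventually_elim
    case (elim q)
    then have q: "a < q" "ereal q < T"
      using t \<open>ereal b < T\<close> by (auto intro: less_trans[of "ereal q" "ereal b"])
    moreover have "E q \<subseteq> pairs" "E t \<subseteq> pairs" using edge_rulesD(1)[OF rules] q t by auto
    ultimately show ?case using elim(1) by blast
  qed
qed

lemma safe_at_right:
  assumes h: "hybrid a T x E u" and t: "a \<le> t" "ereal t < T" and safe: "safe (\<lambda>i. x i t) (E t)"
  shows "\<forall>\<^sub>F q in at_right t. safe (\<lambda>i. x i q) (E q)"
proof -
  have rules: "edge_rules a T x E" using h by (simp add: hybrid_def)
  have "\<forall>\<^sub>F q in at_right t. case e of (i, j) \<Rightarrow> norm (x i q - x j q) < r" if e: "e \<in> E t" for e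
  proof (cases e)
    case (Pair i j)
    then show ?thesis using safeD(1,4)[OF safe] e
      by (auto intro!: order_tendstoD(2)[OF distance_tendsto(1)[OF h _ t]])
  qed
  moreover have "finite (E t)" using safeD(1)[OF safe] finite_subset finite_pairs by blast
  ultimately have "\<forall>\<^sub>F q in at_right t. \<forall>e\<in>E t. case e of (i, j) \<Rightarrow> norm (x i q - x j q) < r"
    by (intro eventually_ball_finite) auto
  with edges_at_right[OF h t safe] show ?thesis
  proof eventually_elim
    case (elim q)
    \<comment> \<open>After \<open>t\<close> the hysteresis rule is in force, and it would have
      added any pair within distance \<open>r - eps\<close>.\<close>
    have "r - eps < norm (x i q - x j q)" if "(i, j) \<in> pairs" "(i, j) \<notin> E q" for i j
      using edge_rulesD(2)[OF rules that(1), of q] that(2) elim by auto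
    then show ?case using elim safe unfolding safe_def by auto
  qed
qed

section \<open>Decay of the energy and invariance of safety\<close>

text \<open>Just after \<open>t\<close> the graph is frozen, so the derivative of the energy with
  fixed graph \<open>E t\<close> applies.\<close>

lemma energy_at_right:
  assumes h: "hybrid a T x E u" and t: "a \<le> t" "ereal t < T" and safe: "safe (\<lambda>i. x i t) (E t)"
    and l: "l \<in> A" and "0 < e"
    and d: "\<And>i. i \<in> A \<Longrightarrow> (x i has_vector_derivative v i) (at t)"
  shows "\<forall>\<^sub>F q in at_right t. energy (E q) l c (\<lambda>i. x i q) \<le> energy (E t) l c (\<lambda>i. x i t) +
    (e - (\<Sum>i\<in>A. v i \<bullet> ctrl (E t) l c (\<lambda>i. x i t) i)) * (q - t)"
proof -
  let ?D = "- (\<Sum>i\<in>A. v i \<bullet> ctrl (E t) l c (\<lambda>i. x i t) i)"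
  have "((\<lambda>s. energy (E t) l c (\<lambda>i. x i s)) has_real_derivative ?D) (at t within {t<..})"
    by (rule energy_derivative[where x = x and v = v, OF safeD(1-3)[OF safe] l
          has_vector_derivative_at_within[OF d]])
  then have "((\<lambda>q. (energy (E t) l c (\<lambda>i. x i q) - energy (E t) l c (\<lambda>i. x i t)) / (q - t)) \<longlongrightarrow> ?D) (at_right t)"
    by (rule has_field_derivative_iff[THEN iffD1])
  then have "\<forall>\<^sub>F q in at_right t.
      (energy (E t) l c (\<lambda>i. x i q) - energy (E t) l c (\<lambda>i. x i t)) / (q - t) < ?D + e"
    by (rule order_tendstoD(2)) (use \<open>0 < e\<close> in simp)
  with edges_at_right[OF h t safe] eventually_at_right_less[of t] show ?thesis
  proof eventually_elim
    case (elim q)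
    then have "energy (E t) l c (\<lambda>i. x i q) - energy (E t) l c (\<lambda>i. x i t) < (?D + e) * (q - t)"
      by (simp add: pos_divide_less_eq)
    then show ?case using elim by (simp add: algebra_simps)
  qed
qed

lemma energy_tendsto_right:
  assumes h: "hybrid a T x E u" and t: "a \<le> t" "ereal t < T" and safe: "safe (\<lambda>i. x i t) (E t)"
    and l: "l \<in> A"
  shows "((\<lambda>q. energy (E q) l c (\<lambda>i. x i q)) \<longlongrightarrow> energy (E t) l c (\<lambda>i. x i t)) (at_right t)"
proof -
  have "((\<lambda>q. energy (E t) l c (\<lambda>i. x i q)) \<longlongrightarrow> energy (E t) l c (\<lambda>i. x i t)) (at_right t)"
    by (intro energy_tendsto safeD(1,3)[OF safe] l hybrid_tendsto(1)[OF h _ t])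
  moreover have "\<forall>\<^sub>F q in at_right t. energy (E t) l c (\<lambda>i. x i q) = energy (E q) l c (\<lambda>i. x i q)"
    using edges_at_right[OF h t safe] by (rule eventually_mono) simp
  ultimately show ?thesis by (rule Lim_transform_eventually)
qed

lemma energy_at_left:
  assumes h: "hybrid a T x E u" and t: "a \<le> s" "s < t" "ereal t < T"
    and safe: "\<forall>q\<in>{s..t}. safe (\<lambda>i. x i q) (E q)"
    and l: "l \<in> A" and "0 < e"
  shows "\<forall>\<^sub>F q in at_left t. energy (E t) l c (\<lambda>i. x i t) \<le> energy (E q) l c (\<lambda>i. x i q) + e"
proof -
  define F where "F = (\<Union>q\<in>{s..<t}. E q)"
  have rules: "edge_rules a T x E" using h by (simp add: hybrid_def)
  have left: "\<forall>\<^sub>F q in at_left t. q \<in> {s<..<t} \<and> E q = F"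
    using edges_at_left[OF h t] safe by (auto simp: F_def)
  have st: "safe (\<lambda>i. x i t) (E t)" using safe t by simp
  have "F \<subseteq> E t"
  proof
    fix e assume "e \<in> F"
    then obtain q where "q \<in> {s..<t}" "e \<in> E q" by (auto simp: F_def)
    then show "e \<in> E t" using edges_persist[OF h, of q t] safe t by auto
  qed
  have "energy (E t) l c (\<lambda>i. x i t) \<le> energy F l c (\<lambda>i. x i t)"
  proof -
    have "(if (i, j) \<in> E t then pot ((norm (x i t - x j t))\<^sup>2) else pot ((r - eps)\<^sup>2)) \<le>
        (if (i, j) \<in> F then pot ((norm (x i t - x j t))\<^sup>2) else pot ((r - eps)\<^sup>2))"
      if "(i, j) \<in> pairs" for i j
    proof (cases "(i, j) \<in> E t \<and> (i, j) \<notin> F")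
      case True
      \<comment> \<open>An edge that is new at \<open>t\<close> was absent just before, so it cannot
        be justified by the hysteresis band and must have length at most \<open>r - eps\<close>,
        where \<open>pot\<close> does not exceed the charge of a missing pair.\<close>
      have "\<not> (\<forall>\<^sub>F q in at_left t. (i, j) \<in> E q)"
      proof
        assume "\<forall>\<^sub>F q in at_left t. (i, j) \<in> E q"
        with left have "\<forall>\<^sub>F q in at_left t. False" by eventually_elim (use True in auto)
        then show False by simp
      qed
      then have "norm (x i t - x j t) \<le> r - eps"
        using edge_rulesD(2)[OF rules that, of t] True t by auto
      then show ?thesis using True pot_eps_pos by (auto intro!: pot_mono power_mono)
    qed (use \<open>F \<subseteq> E t\<close> in auto)
    then show ?thesis unfolding energy_def by (auto intro!: sum_mono)
  qed
  moreover have "((\<lambda>q. energy F l c (\<lambda>i. x i q)) \<longlongrightarrow> energy F l c (\<lambda>i. x i t)) (at_left t)"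
    using safeD(1,3)[OF st] \<open>F \<subseteq> E t\<close> t
    by (intro energy_tendsto l hybrid_tendsto(2)[OF h]) auto
  then have "\<forall>\<^sub>F q in at_left t. energy F l c (\<lambda>i. x i t) - e < energy F l c (\<lambda>i. x i q)"
    by (rule order_tendstoD(1)) (use \<open>0 < e\<close> in simp)
  with left have "\<forall>\<^sub>F q in at_left t. energy F l c (\<lambda>i. x i t) \<le> energy (E q) l c (\<lambda>i. x i q) + e"
    by eventually_elim auto
  ultimately show ?thesis by (auto elim: eventually_mono)
qed

text \<open>The factor \<open>mu\<close> is 1 while the controller acts and 0 while the agents rest.
  The estimate \<open>dini_nonincreasing\<close> is applied to the energy plus
  \<open>eta * (t - a)\<close>.\<close>

lemma energy_decay:
  assumes h: "hybrid a T x E u" and "a \<le> b" "ereal b < T"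
    and safe: "\<forall>t\<in>{a..b}. safe (\<lambda>i. x i t) (E t)" and l: "l \<in> A"
    and u: "\<And>t i. a < t \<Longrightarrow> t < b \<Longrightarrow> i \<in> A \<Longrightarrow> u i t = mu *\<^sub>R ctrl (E t) l c (\<lambda>i. x i t) i"
    and rate: "\<And>t. a < t \<Longrightarrow> t < b \<Longrightarrow>
      eta \<le> mu * (\<Sum>i\<in>A. (norm (ctrl (E t) l c (\<lambda>i. x i t) i))\<^sup>2)"
  shows "energy (E b) l c (\<lambda>i. x i b) \<le> energy (E a) l c (\<lambda>i. x i a) - eta * (b - a)"
proof -
  \<comment> \<open>The instant \<open>a\<close> counts as exceptional, since input and derivative
    are only known after it.\<close>
  define D where "D = insert a (\<Union>i\<in>A. {t. a < t \<and> t \<le> b \<and> \<not> (x i has_vector_derivative u i t) (at t)})"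
  have "finite D" using h assms(3) by (auto simp: D_def hybrid_def motion_def)
  define W where "W t = energy (E t) l c (\<lambda>i. x i t)" for t
  have up: "ereal t < T" if "t \<le> b" for t
    using that assms(3) by (auto intro: le_less_trans[of "ereal t" "ereal b"])
  have "W b + eta * (b - a) \<le> W a + eta * (a - a)"
  proof (rule dini_nonincreasing[OF \<open>a \<le> b\<close> \<open>finite D\<close>])
    fix t e :: real assume t: "a \<le> t" "t < b" and "t \<notin> D" "0 < e"
    then have "a < t" by (auto simp: D_def less_le)
    have d: "(x i has_vector_derivative u i t) (at t)" if "i \<in> A" for i
      using \<open>t \<notin> D\<close> \<open>a < t\<close> t that by (auto simp: D_def)
    have "(\<Sum>i\<in>A. u i t \<bullet> ctrl (E t) l c (\<lambda>i. x i t) i) =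
        mu * (\<Sum>i\<in>A. (norm (ctrl (E t) l c (\<lambda>i. x i t) i))\<^sup>2)"
      using u[OF \<open>a < t\<close> t(2)] by (simp add: sum_distrib_left power2_norm_eq_inner)
    then have rate': "eta \<le> (\<Sum>i\<in>A. u i t \<bullet> ctrl (E t) l c (\<lambda>i. x i t) i)"
      using rate[OF \<open>a < t\<close> t(2)] by simp
    have "safe (\<lambda>i. x i t) (E t)" using safe t by simp
    then have "\<forall>\<^sub>F q in at_right t. W q \<le> W t +
        (e - (\<Sum>i\<in>A. u i t \<bullet> ctrl (E t) l c (\<lambda>i. x i t) i)) * (q - t)"
      unfolding W_def using t \<open>0 < e\<close> d up by (intro energy_at_right[OF h] l) auto
    with eventually_at_right_less[of t]
    show "\<forall>\<^sub>F s in at_right t. W s + eta * (s - a) \<le> W t + eta * (t - a) + e * (s - t)"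
    proof eventually_elim
      case (elim s)
      have "(e - (\<Sum>i\<in>A. u i t \<bullet> ctrl (E t) l c (\<lambda>i. x i t) i)) * (s - t) \<le> (e - eta) * (s - t)"
        using rate' elim by (intro mult_right_mono) auto
      then show ?case using elim by (simp add: algebra_simps)
    qed
  next
    fix t e :: real assume t: "a \<le> t" "t < b" and "t \<in> D" "0 < e"
    have "safe (\<lambda>i. x i t) (E t)" using safe t by simp
    from energy_tendsto_right[OF h t(1) up this l, of c]
    have "(W \<longlongrightarrow> W t) (at_right t)" using t by (simp add: W_def[abs_def])
    then have "((\<lambda>s. W s + eta * (s - a)) \<longlongrightarrow> W t + eta * (t - a)) (at_right t)"
      by (intro tendsto_intros)
    then have "\<forall>\<^sub>F s in at_right t. W s + eta * (s - a) < W t + eta * (t - a) + e"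
      by (rule order_tendstoD(2)) (use \<open>0 < e\<close> in simp)
    then show "\<forall>\<^sub>F s in at_right t. W s + eta * (s - a) \<le> W t + eta * (t - a) + e"
      by (rule eventually_mono) simp
  next
    fix t e :: real assume t: "a < t" "t \<le> b" and "0 < e"
    have "\<forall>\<^sub>F s in at_left t. W t \<le> W s + e / 2"
      unfolding W_def using safe t \<open>0 < e\<close> up l by (intro energy_at_left[OF h order_refl t(1)]) auto
    moreover have "((\<lambda>s. eta * (s - a)) \<longlongrightarrow> eta * (t - a)) (at_left t)"
      by (intro tendsto_intros)
    then have "\<forall>\<^sub>F s in at_left t. eta * (t - a) - e / 2 < eta * (s - a)"
      by (rule order_tendstoD(1)) (use \<open>0 < e\<close> in simp)
    ultimately show "\<forall>\<^sub>F s in at_left t. W t + eta * (t - a) \<le> W s + eta * (s - a) + e"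
      by eventually_elim simp
  qed
  then show ?thesis by (simp add: W_def)
qed

text \<open>The critical case is a limit from the left. Before \<open>t\<close> the state is safe,
  so the energy is at most its initial value and keeps all edges a fixed margin below
  \<open>r\<close>; the margin survives the limit, and then the graph rule yields safety at
  \<open>t\<close>.\<close>

lemma safe_preserved:
  assumes h: "hybrid a T x E u" and "a \<le> b" "ereal b < T"
    and safe: "safe (\<lambda>i. x i a) (E a)" and l: "l \<in> A" and "0 \<le> mu"
    and u: "\<And>t i. a < t \<Longrightarrow> t < b \<Longrightarrow> i \<in> A \<Longrightarrow> u i t = mu *\<^sub>R ctrl (E t) l c (\<lambda>i. x i t) i"
  shows "\<forall>t\<in>{a..b}. safe (\<lambda>i. x i t) (E t)"
proof (rule real_induct[where P = "\<lambda>t. safe (\<lambda>i. x i t) (E t)", OF \<open>a \<le> b\<close> safe])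
  have up: "ereal t < T" if "t \<le> b" for t
    using that assms(3) by (auto intro: le_less_trans[of "ereal t" "ereal b"])
  fix t assume t: "a \<le> t" "t < b" and IH: "\<forall>s\<in>{a..t}. safe (\<lambda>i. x i s) (E s)"
  show "\<forall>\<^sub>F s in at_right t. safe (\<lambda>i. x i s) (E s)"
    using IH t by (intro safe_at_right[OF h t(1) up]) auto
next
  have rules: "edge_rules a T x E" using h by (simp add: hybrid_def)
  fix t assume t: "a < t" "t \<le> b" and IH: "\<forall>s\<in>{a..<t}. safe (\<lambda>i. x i s) (E s)"
  have up: "ereal t < T" using t assms(3) by (auto intro: le_less_trans[of "ereal t" "ereal b"])
  \<comment> \<open>The added 1 makes \<open>C\<close> positive, so that
    \<open>r\<^sup>2 / (2 * C)\<close> is a genuine margin.\<close>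
  define C where "C = energy (E a) l c (\<lambda>i. x i a) + 1"
  have "0 < C" using energy_bounds(1)[OF safeD(1,3)[OF safe], of l c] by (simp add: C_def)
  define F where "F = (\<Union>q\<in>{a..<t}. E q)"
  have left: "\<forall>\<^sub>F q in at_left t. q \<in> {a<..<t} \<and> E q = F"
    unfolding F_def by (rule edges_at_left[OF h order_refl t(1) up IH])
  then obtain q where q: "q \<in> {a<..<t}" "E q = F"
    using eventually_happens'[of "at_left t"] trivial_limit_at_left_real by blast
  have F: "F \<subseteq> pairs" "sym F" using IH safeD(1,2) q by (metis atLeastLessThan_iff greaterThanLessThan_iff less_imp_le)+
  have persist: "e \<in> E t" if "e \<in> E s" "a \<le> s" "s < t" for e s
    using edges_persist[OF h that(2) _ up _ that(1)] that IH by auto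
  have bound: "(norm (x i t - x j t))\<^sup>2 \<le> r\<^sup>2 - r\<^sup>2 / (2 * C)" if "(i, j) \<in> F" for i j
  proof -
    have p: "(i, j) \<in> pairs" using F(1) that by auto
    have "((\<lambda>q. (norm (x i q - x j q))\<^sup>2) \<longlongrightarrow> (norm (x i t - x j t))\<^sup>2) (at_left t)"
      by (intro tendsto_intros distance_tendsto(2)[OF h p t(1) up])
    moreover from left have "\<forall>\<^sub>F q in at_left t. (norm (x i q - x j q))\<^sup>2 \<le> r\<^sup>2 - r\<^sup>2 / (2 * C)"
    proof eventually_elim
      case (elim q)
      have sq: "safe (\<lambda>i. x i q) (E q)" using IH elim by auto
      have "energy (E q) l c (\<lambda>i. x i q) \<le> energy (E a) l c (\<lambda>i. x i a) - 0 * (q - a)"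
      proof (rule energy_decay[OF h _ _ _ l])
        show "ereal q < T" using elim up by (auto intro: less_trans[of "ereal q" "ereal t"])
        show "u i s = mu *\<^sub>R ctrl (E s) l c (\<lambda>i. x i s) i" if "a < s" "s < q" "i \<in> A" for s i
          using that elim t by (intro u) auto
      qed (use elim IH \<open>0 \<le> mu\<close> in \<open>auto intro!: mult_nonneg_nonneg sum_nonneg\<close>)
      then have "energy (E q) l c (\<lambda>i. x i q) \<le> C" by (simp add: C_def)
      then show ?case using energy_bounds(2)[OF safeD(1,3)[OF sq]] that elim by auto
    qed
    ultimately show ?thesis by (rule tendsto_upperbound) simp
  qed
  have dist: "norm (x i t - x j t) < r" if "(i, j) \<in> F" for i j
  proof (rule power2_less_imp_less)
    show "(norm (x i t - x j t))\<^sup>2 < r\<^sup>2"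
      using bound[OF that] \<open>0 < C\<close> radius_bounds(3) by (smt (verit) divide_pos_pos zero_less_power)
  qed (use radius_bounds in simp)
  have evF: "(\<forall>\<^sub>F s in at_left t. e \<in> E s) \<longleftrightarrow> e \<in> F" for e
  proof
    assume "\<forall>\<^sub>F s in at_left t. e \<in> E s"
    with left have "\<forall>\<^sub>F s in at_left t. e \<in> F" by eventually_elim auto
    then show "e \<in> F" by simp
  next
    assume "e \<in> F"
    with left show "\<forall>\<^sub>F s in at_left t. e \<in> E s" by (auto elim: eventually_mono)
  qed
  have Et: "(i, j) \<in> E t \<longleftrightarrow> (i, j) \<in> pairs \<and> (norm (x i t - x j t) \<le> r - eps \<or> (i, j) \<in> F)" for i j
  proof -
    have "E t \<subseteq> pairs" using edge_rulesD(1)[OF rules _ up] t by simp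
    then show ?thesis
      using edge_rulesD(2)[OF rules _ t(1) up, of i j] dist[of i j] F(1) by (auto simp: evF)
  qed
  have "sym (E t)"
    using F(2) by (auto intro!: symI simp: Et norm_minus_commute pairs_def dest: symD)
  moreover have "E a \<subseteq> E t" using persist t by auto
  then have "connected_graph A (E t)" using safeD(6)[OF safe] connected_graph_mono by blast
  ultimately show "safe (\<lambda>i. x i t) (E t)"
    unfolding safe_def using Et dist radius_bounds(1) by fastforce
qed

section \<open>Convergence to the goal region\<close>

lemma path_length:
  fixes m :: real and p :: "nat \<Rightarrow> real^2"
  assumes "(i, j) \<in> F ^^ n" "\<forall>(i, j)\<in>F. norm (p i - p j) \<le> m"
  shows "norm (p i - p j) \<le> n * m"
  using assms(1)
proof (induction n arbitrary: j)
  case (Suc n)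
  then obtain k where k: "(i, k) \<in> F ^^ n" "(k, j) \<in> F" by auto
  have "p i - p j = (p i - p k) + (p k - p j)" by simp
  then have "norm (p i - p j) \<le> norm (p i - p k) + norm (p k - p j)"
    by (metis norm_triangle_ineq)
  also have "\<dots> \<le> n * m + m" using Suc.IH[OF k(1)] k(2) assms(2) by (intro add_mono) auto
  finally show ?case by (simp add: algebra_simps)
qed simp

text \<open>A shortest path uses each edge at most once; \<open>card pairs\<close> bounds its length
  for all graphs at once, which keeps the later thresholds independent of \<open>F\<close>.\<close>

lemma diameter_bound:
  fixes m :: real
  assumes "safe p F" "l \<in> A" "i \<in> A" "\<forall>(i, j)\<in>F. norm (p i - p j) \<le> m" "0 \<le> m"
  shows "norm (p i - c) \<le> norm (p l - c) + card pairs * m"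
proof -
  have F: "finite F" "card F \<le> card pairs"
    using safeD(1)[OF assms(1)] finite_pairs by (auto intro: finite_subset card_mono)
  have "(i, l) \<in> F\<^sup>*" using safeD(6)[OF assms(1)] assms(2,3) by (auto simp: connected_graph_def)
  then obtain n where n: "n \<le> card F" "(i, l) \<in> F ^^ n"
    using rtrancl_finite_eq_relpow[OF F(1)] by auto
  have "norm (p i - p l) \<le> n * m" by (rule path_length[OF n(2) assms(4)])
  also have "\<dots> \<le> card pairs * m" using n F assms(5) by (intro mult_right_mono) auto
  finally have "norm (p i - p l) \<le> card pairs * m" .
  moreover have "norm (p i - c) \<le> norm (p i - p l) + norm (p l - c)"
    using norm_triangle_ineq[of "p i - p l" "p l - c"] by simp
  ultimately show ?thesis by simp
qed

text \<open>Testing the control inputs against the constant vector \<open>p l - c\<close> bounds the distance of the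
  leader from the goal, since the interaction terms cancel. Testing them against \<open>p i - c\<close> then
  bounds the lengths of all edges.\<close>
lemma small_ctrl_imp_close:
  fixes U :: real
  assumes s: "safe p F" and l: "l \<in> A" and small: "\<And>i. i \<in> A \<Longrightarrow> norm (ctrl F l c p i) \<le> U"
    and "0 \<le> U" "i \<in> A"
  shows "norm (p i - c) \<le> card A * U +
    card pairs * sqrt (r\<^sup>2 * (card A * (card A * U + card pairs * r) * U))"
proof -
  note F = safeD(1,2)[OF s]
  let ?w = "\<lambda>i j. 2 * r\<^sup>2 / (r\<^sup>2 - (norm (p i - p j))\<^sup>2)\<^sup>2"
  have lc: "norm (p l - c) \<le> card A * U"
  proof (cases "p l = c")
    case False
    have "norm (p l - c) * norm (p l - c) = - (\<Sum>i\<in>A. (p l - c) \<bullet> ctrl F l c p i)"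
      using ctrl_inner[OF F l, of "\<lambda>_. p l - c" c p]
      by (simp add: power2_norm_eq_inner[symmetric] power2_eq_square)
    also have "\<dots> \<le> (\<Sum>i\<in>A. norm (p l - c) * U)"
      unfolding sum_negf[symmetric]
    proof (rule sum_mono)
      fix i assume "i \<in> A"
      have "- ((p l - c) \<bullet> ctrl F l c p i) \<le> norm (p l - c) * norm (ctrl F l c p i)"
        using Cauchy_Schwarz_ineq2[of "p l - c" "ctrl F l c p i"] by simp
      also have "\<dots> \<le> norm (p l - c) * U" using small[OF \<open>i \<in> A\<close>] by (intro mult_left_mono) auto
      finally show "- ((p l - c) \<bullet> ctrl F l c p i) \<le> norm (p l - c) * U" .
    qed
    also have "\<dots> = norm (p l - c) * (card A * U)" by simp
    finally show ?thesis using False by simp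
  qed (use \<open>0 \<le> U\<close> in auto)
  \<comment> \<open>A crude bound on all distances from the goal, which uses only that edges are
    shorter than \<open>r\<close>; it feeds the finer bound \<open>m\<close> on the edges.\<close>
  define B where "B = card A * U + card pairs * r"
  have B: "norm (p i - c) \<le> B" if "i \<in> A" for i
  proof -
    have "\<forall>(i, j)\<in>F. norm (p i - p j) \<le> r" using safeD(3)[OF s] by fastforce
    from diameter_bound[OF s l that this, of c] lc show ?thesis
      using radius_bounds(3) by (simp add: B_def)
  qed
  have "0 \<le> B" using \<open>0 \<le> U\<close> radius_bounds(3) by (simp add: B_def)
  define m where "m = sqrt (r\<^sup>2 * (card A * B * U))"
  have "0 \<le> m" using \<open>0 \<le> B\<close> \<open>0 \<le> U\<close> by (simp add: m_def)
  have edge: "norm (p i - p j) \<le> m" if ij: "(i, j) \<in> F" for i j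
  proof -
    \<comment> \<open>The gain is smallest at distance 0, where it equals
      \<open>2 / r\<^sup>2\<close>.\<close>
    have w: "2 / r\<^sup>2 \<le> ?w i j" if "(i, j) \<in> F" for i j
    proof -
      define s where "s = (norm (p i - p j))\<^sup>2"
      have s: "0 \<le> s" "s < r\<^sup>2" using sq_less[of "p i" "p j"] safeD(4)[OF \<open>safe p F\<close> that]
        by (auto simp: s_def)
      have "(r\<^sup>2 - s)\<^sup>2 \<le> (r\<^sup>2)\<^sup>2" using s by (intro power_mono) auto
      then show ?thesis unfolding s_def[symmetric] using s radius_bounds(3)
        by (simp add: divide_simps power2_eq_square)
    qed
    have ge: "2 / r\<^sup>2 * (norm (p i - p j))\<^sup>2 \<le> ?w i j *\<^sub>R (p i - p j) \<bullet> ((p i - c) - (p j - c))"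
      if "(i, j) \<in> F" for i j
      using mult_right_mono[OF w[OF that], of "(norm (p i - p j))\<^sup>2"]
      by (simp add: power2_norm_eq_inner)
    have nonneg: "0 \<le> ?w i j *\<^sub>R (p i - p j) \<bullet> ((p i - c) - (p j - c))" for i j
      by simp
    have finF: "finite F" using F(1) finite_pairs finite_subset by blast
    let ?Q = "\<Sum>(i, j)\<in>F. ?w i j *\<^sub>R (p i - p j) \<bullet> ((p i - c) - (p j - c))"
    have sym: "(j, i) \<in> F" using F(2) ij by (auto dest: symD)
    have ne: "(i, j) \<noteq> (j, i)" using F(1) ij by (auto simp: pairs_def)
    \<comment> \<open>Both orientations of the edge occur in \<open>?Q\<close>, so half of the sum
      still dominates one of them; all other terms are nonnegative.\<close>
    have "2 / r\<^sup>2 * (norm (p i - p j))\<^sup>2 + 2 / r\<^sup>2 * (norm (p j - p i))\<^sup>2 \<le>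
        (\<Sum>(i, j)\<in>{(i, j), (j, i)}. ?w i j *\<^sub>R (p i - p j) \<bullet> ((p i - c) - (p j - c)))"
      using ge[OF ij] ge[OF sym] ne by simp
    also have "\<dots> \<le> ?Q"
      using finF ij sym nonneg by (intro sum_mono2) auto
    finally have "2 / r\<^sup>2 * (norm (p i - p j))\<^sup>2 \<le> ?Q / 2"
      by (simp add: norm_minus_commute)
    moreover have "2 / r\<^sup>2 * (norm (p i - p j))\<^sup>2 \<ge> (norm (p i - p j))\<^sup>2 / r\<^sup>2"
      by (simp add: divide_right_mono)
    moreover have "?Q / 2 \<le> card A * B * U"
    proof -
      have "?Q / 2 = - ((p l - c) \<bullet> (p l - c)) - (\<Sum>i\<in>A. (p i - c) \<bullet> ctrl F l c p i)"
        using ctrl_inner[OF F l, of "\<lambda>i. p i - c" c p] by simp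
      also have "\<dots> \<le> (\<Sum>i\<in>A. - ((p i - c) \<bullet> ctrl F l c p i))" by (simp add: sum_negf)
      also have "\<dots> \<le> (\<Sum>i\<in>A. B * U)"
      proof (rule sum_mono)
        fix i assume "i \<in> A"
        have "- ((p i - c) \<bullet> ctrl F l c p i) \<le> norm (p i - c) * norm (ctrl F l c p i)"
          using Cauchy_Schwarz_ineq2[of "p i - c" "ctrl F l c p i"] by simp
        also have "\<dots> \<le> B * U" using small B \<open>i \<in> A\<close> \<open>0 \<le> B\<close> by (intro mult_mono) auto
        finally show "- ((p i - c) \<bullet> ctrl F l c p i) \<le> B * U" .
      qed
      finally show ?thesis by simp
    qed
    ultimately have "(norm (p i - p j))\<^sup>2 / r\<^sup>2 \<le> card A * B * U" by linarith
    then have "(norm (p i - p j))\<^sup>2 \<le> r\<^sup>2 * (card A * B * U)"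
      using radius_bounds(3) by (simp add: divide_simps mult.commute)
    then show ?thesis unfolding m_def by (rule real_le_rsqrt)
  qed
  have "norm (p i - c) \<le> norm (p l - c) + card pairs * m"
    by (rule diameter_bound[OF s l \<open>i \<in> A\<close> _ \<open>0 \<le> m\<close>]) (use edge in auto)
  then show ?thesis using lc by (simp add: m_def B_def)
qed

text \<open>The bound in \<open>small_ctrl_imp_close\<close> depends on \<open>U\<close> alone and
  vanishes with it, so one threshold serves all states, graphs, leaders and goals without any
  compactness argument.\<close>

lemma small_ctrl_threshold:
  assumes "0 < rho"
  obtains eta where "0 < eta"
    "\<And>p F l c i. safe p F \<Longrightarrow> l \<in> A \<Longrightarrow> i \<in> A \<Longrightarrow>
      (\<Sum>i\<in>A. (norm (ctrl F l c p i))\<^sup>2) < eta \<Longrightarrow> norm (p i - c) \<le> rho"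
proof -
  let ?f = "\<lambda>U :: real. card A * U + card pairs * sqrt (r\<^sup>2 * (card A * (card A * U + card pairs * r) * U))"
  have "(?f \<longlongrightarrow> ?f 0) (at_right 0)" by (intro tendsto_intros)
  then have "\<forall>\<^sub>F U in at_right 0. ?f U < rho" by (rule order_tendstoD(2)) (use assms in simp)
  then have "\<forall>\<^sub>F U in at_right 0. ?f U < rho \<and> 0 < U"
    using eventually_at_right_less by (rule eventually_conj)
  then obtain U where U: "?f U < rho" "0 < U"
    using eventually_happens'[of "at_right (0::real)"] trivial_limit_at_right_real by blast
  show thesis
  proof (rule that[of "U\<^sup>2"])
    show "0 < U\<^sup>2" using U by simp
    fix p F l c i assume s: "safe p F" and l: "l \<in> A" and i: "i \<in> A"
      and small: "(\<Sum>i\<in>A. (norm (ctrl F l c p i))\<^sup>2) < U\<^sup>2"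
    have "norm (ctrl F l c p i) \<le> U" if "i \<in> A" for i
    proof (rule power2_le_imp_le)
      have "(norm (ctrl F l c p i))\<^sup>2 \<le> (\<Sum>i\<in>A. (norm (ctrl F l c p i))\<^sup>2)"
        using that by (intro member_le_sum) auto
      then show "(norm (ctrl F l c p i))\<^sup>2 \<le> U\<^sup>2" using small by simp
    qed (use U in simp)
    from small_ctrl_imp_close[OF s l this _ i] U show "norm (p i - c) \<le> rho" by simp
  qed
qed

text \<open>A quantitative replacement for LaSalle's principle, insensitive to switching of the
  graph: away from the goal the nonnegative energy falls at least at rate \<open>eta\<close>, which
  cannot go on forever.\<close>

lemma goal_reached:
  assumes h: "hybrid a \<infinity> x E u" and safe: "safe (\<lambda>i. x i a) (E a)" and l: "l \<in> A"
    and u: "\<And>t i. a < t \<Longrightarrow> i \<in> A \<Longrightarrow> u i t = ctrl (E t) l c (\<lambda>i. x i t) i"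
    and "0 < rho"
  shows "\<exists>t\<ge>a. safe (\<lambda>i. x i t) (E t) \<and> (\<forall>i\<in>A. x i t \<in> cball c rho)"
proof (rule ccontr)
  assume none: "\<not> ?thesis"
  have u': "u i t = 1 *\<^sub>R ctrl (E t) l c (\<lambda>i. x i t) i" if "a < t" "i \<in> A" for t i
    using u that by simp
  have S: "safe (\<lambda>i. x i t) (E t)" if "a \<le> t" for t
    using safe_preserved[OF h that _ safe l, where mu = 1] u' that by auto
  from small_ctrl_threshold[OF \<open>0 < rho\<close>] obtain eta where eta: "0 < eta"
    "\<And>p F l c i. safe p F \<Longrightarrow> l \<in> A \<Longrightarrow> i \<in> A \<Longrightarrow>
      (\<Sum>i\<in>A. (norm (ctrl F l c p i))\<^sup>2) < eta \<Longrightarrow> norm (p i - c) \<le> rho" by blast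
  have rate: "eta \<le> 1 * (\<Sum>i\<in>A. (norm (ctrl (E t) l c (\<lambda>i. x i t) i))\<^sup>2)" if "a < t" for t
  proof (rule ccontr)
    assume "\<not> ?thesis"
    then have "norm (x i t - c) \<le> rho" if "i \<in> A" for i
      using eta(2)[OF S[of t] l that] \<open>a < t\<close> by simp
    then show False using none S[of t] \<open>a < t\<close> by (auto simp: dist_norm norm_minus_commute)
  qed
  let ?W = "\<lambda>t. energy (E t) l c (\<lambda>i. x i t)"
  \<comment> \<open>By this time the energy would have dropped to at most -1.\<close>
  define b where "b = a + (?W a + 1) / eta"
  have "0 \<le> ?W a" by (rule energy_bounds(1)[OF safeD(1,3)[OF safe]])
  then have "a \<le> b" using eta(1) by (simp add: b_def)
  have "?W b \<le> ?W a - eta * (b - a)"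
    by (rule energy_decay[OF h \<open>a \<le> b\<close> _ _ l, where mu = 1]) (use S u' rate in auto)
  also have "\<dots> = - 1" using eta(1) by (simp add: b_def)
  finally show False using energy_bounds(1)[OF safeD(1,3)[OF S[OF \<open>a \<le> b\<close>]], of l c] by simp
qed

lemma safe_message_links:
  assumes "safe (\<lambda>i. x i t) F"
  shows "connected_graph A (message_links S x t)"
proof -
  have "F \<subseteq> message_links S x t"
    using safeD(1,4)[OF assms] by (fastforce simp: message_links_def pairs_def)
  then show ?thesis using connected_graph_mono safeD(6)[OF assms] by blast
qed

lemma safe_initial: "safe (init_pos S) (initial_edges S)"
proof -
  have "connected_graph A (initial_edges S)" using mas by (simp add: multi_agent_system_def)
  then show ?thesis using radius_bounds
    by (auto simp: safe_def initial_edges_def pairs_def sym_def norm_minus_commute)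
qed

text \<open>The set of instants where the derivative fails is contained in every admissible
  exceptional set and is therefore the best witness.\<close>

lemma trajectories_iff:
  "(\<forall>i\<in>A. trajectory T (x0 i) (u i) (x i)) \<longleftrightarrow> (\<forall>i\<in>A. x i 0 = x0 i) \<and> motion 0 T x u"
proof -
  have "(\<exists>D. (\<forall>b. ereal b < T \<longrightarrow> finite (D \<inter> {0..b})) \<and>
      (\<forall>t. 0 < t \<and> ereal t < T \<and> t \<notin> D \<longrightarrow> (y has_vector_derivative w t) (at t))) \<longleftrightarrow>
    (\<forall>b. ereal b < T \<longrightarrow> finite {t. 0 < t \<and> t \<le> b \<and> \<not> (y has_vector_derivative w t) (at t)})"
    (is "(\<exists>D. ?L D) \<longleftrightarrow> ?R") for y w :: "real \<Rightarrow> real^2"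
  proof
    assume "\<exists>D. ?L D"
    then obtain D where D: "?L D" ..
    show ?R
    proof (intro allI impI)
      fix b assume b: "ereal b < T"
      have "{t. 0 < t \<and> t \<le> b \<and> \<not> (y has_vector_derivative w t) (at t)} \<subseteq> D \<inter> {0..b}"
      proof
        fix t assume t: "t \<in> {t. 0 < t \<and> t \<le> b \<and> \<not> (y has_vector_derivative w t) (at t)}"
        then have "ereal t < T" using b by (auto intro: le_less_trans[of "ereal t" "ereal b"])
        then show "t \<in> D \<inter> {0..b}" using D t by auto
      qed
      then show "finite {t. 0 < t \<and> t \<le> b \<and> \<not> (y has_vector_derivative w t) (at t)}"
        using D b by (meson finite_subset)
    qed
  next
    assume R: ?R
    let ?D = "{t. 0 < t \<and> \<not> (y has_vector_derivative w t) (at t)}"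
    have "?D \<inter> {0..b} = {t. 0 < t \<and> t \<le> b \<and> \<not> (y has_vector_derivative w t) (at t)}" for b
      by auto
    then show "\<exists>D. ?L D" using R by (intro exI[of _ ?D]) auto
  qed
  then show ?thesis unfolding trajectory_def motion_def by auto
qed

lemma connectivity_graph_iff:
  "connectivity_graph S T x E \<longleftrightarrow> (\<forall>t. E t \<subseteq> pairs) \<and>
    (\<forall>(i, j)\<in>pairs. (i, j) \<in> E 0 \<longleftrightarrow> norm (x i 0 - x j 0) < r) \<and> edge_rules 0 T x E"
  unfolding connectivity_graph_def edge_rules_def Let_def pairs_def by auto

lemma election_time_ge: "s \<le> election_time S y s"
  by (simp add: election_time_def)

lemma plan_range: "range (plan S i) \<subseteq> services S i" if "i \<in> A"
proof -
  have sets: "set (plan_prefix S i) \<subseteq> services S i" "set (plan_cycle S i) \<subseteq> services S i"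
    "plan_cycle S i \<noteq> []"
    using mas that by (auto simp: multi_agent_system_def)
  have "plan S i n \<in> services S i" for n
  proof (cases "n < length (plan_prefix S i)")
    case True
    then show ?thesis using sets(1) nth_mem by (fastforce simp: plan_def)
  next
    case False
    have "plan_cycle S i ! ((n - length (plan_prefix S i)) mod length (plan_cycle S i)) \<in> set (plan_cycle S i)"
      using sets(3) by (intro nth_mem) simp
    then show ?thesis using False sets(2,3) by (auto simp: plan_def conc_def iter_def)
  qed
  then show ?thesis by auto
qed

section \<open>Existence of hybrid trajectories\<close>

definition repulse :: "real^2 \<Rightarrow> real^2" where
  "repulse z = (2 * r\<^sup>2 / (r\<^sup>2 - (norm z)\<^sup>2)\<^sup>2) *\<^sub>R z"

text \<open>On a ball of radius less than \<open>r\<close> the denominator stays above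
  \<open>r\<^sup>2 - R\<^sup>2\<close>, away from the singularity.\<close>

lemma repulse_lipschitz:
  assumes R: "0 < R" "R < r"
  obtains M where "0 \<le> M"
    "\<And>z w. norm z \<le> R \<Longrightarrow> norm w \<le> R \<Longrightarrow> norm (repulse z - repulse w) \<le> M * norm (z - w)"
proof -
  define d where "d = r\<^sup>2 - R\<^sup>2"
  have "R\<^sup>2 < r\<^sup>2" using R by (intro power_strict_mono) auto
  then have d: "0 < d" by (simp add: d_def)
  \<comment> \<open>The first summand bounds the gain, the second one its variation times the length
    \<open>R\<close> of the vector.\<close>
  define M where "M = 2 * r\<^sup>2 * (1 / d)\<^sup>2 + 2 * r\<^sup>2 * ((2 * R * (1 / d)\<^sup>2) * (2 / d)) * R"
  show thesis
  proof (rule that[of M])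
    show "0 \<le> M" using R d by (simp add: M_def)
    fix z w :: "real^2" assume zw: "norm z \<le> R" "norm w \<le> R"
    define a b where "a = r\<^sup>2 - (norm z)\<^sup>2" and "b = r\<^sup>2 - (norm w)\<^sup>2"
    have "(norm z)\<^sup>2 \<le> R\<^sup>2" "(norm w)\<^sup>2 \<le> R\<^sup>2" using zw by (auto intro: power_mono)
    then have ab: "d \<le> a" "d \<le> b" by (auto simp: a_def b_def d_def)
    define p q where "p = 1 / a" and "q = 1 / b"
    have pq: "0 < p" "0 < q" "p \<le> 1 / d" "q \<le> 1 / d"
      using ab d by (auto simp: p_def q_def intro!: divide_left_mono mult_pos_pos)
    have ba: "\<bar>b - a\<bar> \<le> 2 * R * norm (z - w)"
    proof -
      have "b - a = (norm z - norm w) * (norm z + norm w)"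
        by (simp add: a_def b_def power2_eq_square algebra_simps)
      then have "\<bar>b - a\<bar> = \<bar>norm z - norm w\<bar> * (norm z + norm w)" by (simp add: abs_mult)
      also have "\<dots> \<le> norm (z - w) * (2 * R)"
        using zw norm_triangle_ineq3[of z w] by (intro mult_mono) auto
      finally show ?thesis by (simp add: mult_ac)
    qed
    have "p - q = (b - a) * (p * q)"
      using ab d by (simp add: p_def q_def field_simps)
    then have "\<bar>p - q\<bar> = \<bar>b - a\<bar> * (p * q)" using pq by (simp add: abs_mult)
    also have "\<dots> \<le> (2 * R * norm (z - w)) * (1 / d * (1 / d))"
      using ba pq R d by (intro mult_mono) auto
    finally have diff: "\<bar>p - q\<bar> \<le> 2 * R * (1 / d)\<^sup>2 * norm (z - w)"
      by (simp add: power2_eq_square mult_ac)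
    have "p\<^sup>2 - q\<^sup>2 = (p - q) * (p + q)" by (simp add: power2_eq_square algebra_simps)
    then have "\<bar>p\<^sup>2 - q\<^sup>2\<bar> = \<bar>p - q\<bar> * (p + q)" using pq by (simp add: abs_mult)
    also have "\<dots> \<le> (2 * R * (1 / d)\<^sup>2 * norm (z - w)) * (2 / d)"
      using diff pq R d by (intro mult_mono) auto
    finally have diff2: "\<bar>p\<^sup>2 - q\<^sup>2\<bar> \<le> (2 * R * (1 / d)\<^sup>2) * (2 / d) * norm (z - w)"
      by (simp add: mult_ac)
    have rep: "repulse z = (2 * r\<^sup>2 * p\<^sup>2) *\<^sub>R z" "repulse w = (2 * r\<^sup>2 * q\<^sup>2) *\<^sub>R w"
      by (simp_all add: repulse_def p_def q_def a_def b_def power_divide)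
    have "repulse z - repulse w = (2 * r\<^sup>2 * p\<^sup>2) *\<^sub>R (z - w) + (2 * r\<^sup>2 * (p\<^sup>2 - q\<^sup>2)) *\<^sub>R w"
      unfolding rep by (simp add: algebra_simps)
    then have "norm (repulse z - repulse w) \<le>
        norm ((2 * r\<^sup>2 * p\<^sup>2) *\<^sub>R (z - w)) + norm ((2 * r\<^sup>2 * (p\<^sup>2 - q\<^sup>2)) *\<^sub>R w)"
      by (metis norm_triangle_ineq)
    also have "\<dots> = 2 * r\<^sup>2 * p\<^sup>2 * norm (z - w) + 2 * r\<^sup>2 * \<bar>p\<^sup>2 - q\<^sup>2\<bar> * norm w"
      by (simp add: abs_mult)
    also have "\<dots> \<le> 2 * r\<^sup>2 * (1 / d)\<^sup>2 * norm (z - w) +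
        2 * r\<^sup>2 * ((2 * R * (1 / d)\<^sup>2) * (2 / d) * norm (z - w)) * R"
      using pq diff2 zw R d by (intro add_mono mult_mono mult_left_mono power_mono) auto
    also have "\<dots> = M * norm (z - w)" by (simp add: M_def algebra_simps)
    finally show "norm (repulse z - repulse w) \<le> M * norm (z - w)" .
  qed
qed

lemma ctrl_repulse:
  "ctrl F l c p i = - ((if i = l then 1 else 0) *\<^sub>R (p i - c)) - (\<Sum>j\<in>{j. (i, j) \<in> F}. repulse (p i - p j))"
  by (simp add: ctrl_def repulse_def)

text \<open>The interaction is made globally Lipschitz by projecting the differences of positions onto the
  ball of radius \<open>R\<close>. States are bounded sequences of positions, which form a Banach space.\<close>
lemma truncated_solution:
  assumes R: "0 < R" "R < r" and F: "F \<subseteq> pairs"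
  obtains y where "\<And>i. i \<in> A \<Longrightarrow> y i 0 = p i"
    "\<And>i t. i \<in> A \<Longrightarrow> 0 \<le> t \<Longrightarrow>
      (y i has_vector_derivative - ((if i = l then 1 else 0) *\<^sub>R (y i t - c)) -
        (\<Sum>j\<in>{j. (i, j) \<in> F}. repulse (closest_point (cball 0 R) (y i t - y j t)))) (at t within {0..})"
proof -
  let ?P = "closest_point (cball (0 :: real^2) R)"
  let ?g = "\<lambda>z. repulse (?P z)"
  obtain M where M: "0 \<le> M"
    "\<And>z w. norm z \<le> R \<Longrightarrow> norm w \<le> R \<Longrightarrow> norm (repulse z - repulse w) \<le> M * norm (z - w)"
    using repulse_lipschitz[OF R] by blast
  have ne: "cball (0 :: real^2) R \<noteq> {}" using R by simp
  have in_ball: "norm (?P z) \<le> R" for z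
    using closest_point_in_set[OF closed_cball ne, of z] by (simp add: dist_norm)
  have glip: "norm (?g z - ?g w) \<le> M * norm (z - w)" for z w
  proof -
    have "norm (?g z - ?g w) \<le> M * norm (?P z - ?P w)" using M(2) in_ball by blast
    also have "\<dots> \<le> M * norm (z - w)"
      using closest_point_lipschitz[OF convex_cball closed_cball ne, of z w] M(1)
      by (intro mult_left_mono) (auto simp: dist_norm)
    finally show ?thesis .
  qed
  define f where "f Y i = (if i \<in> A then - ((if i = l then 1 else 0) *\<^sub>R (Y i - c)) -
      (\<Sum>j\<in>{j. (i, j) \<in> F}. ?g (Y i - Y j)) else 0)" for Y :: "nat \<Rightarrow> real^2" and i
  have fin_supp: "(\<lambda>i. h (of_discrete i)) \<in> bcontfun" if "\<And>i. i \<notin> A \<Longrightarrow> h i = 0"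
    for h :: "nat \<Rightarrow> real^2"
  proof -
    have "range (\<lambda>i. h (of_discrete i)) \<subseteq> insert 0 (h ` A)" using that by auto
    then have "finite (range (\<lambda>i. h (of_discrete i)))" by (rule finite_subset) simp
    moreover have "continuous_on UNIV (\<lambda>i. h (of_discrete i))"
      by (simp add: continuous_on_open_vimage open_discrete)
    ultimately show ?thesis by (simp add: bcontfun_def finite_imp_bounded)
  qed
  define val :: "(nat discrete \<Rightarrow>\<^sub>C (real^2)) \<Rightarrow> nat \<Rightarrow> real^2"
    where "val Y i = apply_bcontfun Y (discrete i)" for Y i
  define Phi where "Phi Y = Bcontfun (\<lambda>i. f (val Y) (of_discrete i))" for Y
  have Phi: "val (Phi Y) = f (val Y)" for Y
  proof
    fix i
    have "apply_bcontfun (Phi Y) = (\<lambda>i. f (val Y) (of_discrete i))"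
      unfolding Phi_def by (intro Bcontfun_inverse fin_supp) (simp add: f_def)
    then show "val (Phi Y) i = f (val Y) i" by (simp add: val_def[of "Phi Y"] discrete_inverse)
  qed
  \<comment> \<open>The attraction of the leader contributes 1; each neighbour contributes
    \<open>M\<close> times the change of a difference of two positions, hence the factor 2.\<close>
  define L where "L = 1 + card A * (M * 2)"
  have L: "0 \<le> L" using M(1) by (simp add: L_def)
  have d: "norm (val Y j - val Z j) \<le> dist Y Z" for Y Z j
    using dist_bounded[of Y "discrete j" Z] by (simp add: dist_norm val_def)
  have lip_val: "norm (f (val Y) i - f (val Z) i) \<le> L * dist Y Z" for Y Z i
  proof (cases "i \<in> A")
    case True
    let ?y = "val Y" and ?z = "val Z"
    let ?N = "{j. (i, j) \<in> F}"
    have "?N \<subseteq> A" using F by (auto simp: pairs_def)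
    have "f ?y i - f ?z i = - ((if i = l then 1 else 0) *\<^sub>R (?y i - ?z i)) -
        (\<Sum>j\<in>?N. ?g (?y i - ?y j) - ?g (?z i - ?z j))"
      using True by (simp add: f_def sum_subtractf algebra_simps)
    then have "norm (f ?y i - f ?z i) \<le> norm ((if i = l then 1 else 0 :: real) *\<^sub>R (?y i - ?z i)) +
        norm (\<Sum>j\<in>?N. ?g (?y i - ?y j) - ?g (?z i - ?z j))"
      using norm_triangle_ineq4[of "- ((if i = l then 1 else 0 :: real) *\<^sub>R (?y i - ?z i))"]
      by (simp only: norm_minus_cancel)
    also have "norm ((if i = l then 1 else 0 :: real) *\<^sub>R (?y i - ?z i)) \<le> dist Y Z"
      using d[of Y i Z] by (cases "i = l") auto
    also have "norm (\<Sum>j\<in>?N. ?g (?y i - ?y j) - ?g (?z i - ?z j)) \<le> (\<Sum>j\<in>?N. M * (2 * dist Y Z))"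
    proof (rule sum_norm_le)
      fix j
      have "norm (?g (?y i - ?y j) - ?g (?z i - ?z j)) \<le> M * norm ((?y i - ?y j) - (?z i - ?z j))"
        by (rule glip)
      also have "(?y i - ?y j) - (?z i - ?z j) = (?y i - ?z i) - (?y j - ?z j)" by simp
      also have "norm ((?y i - ?z i) - (?y j - ?z j)) \<le> 2 * dist Y Z"
        using norm_triangle_ineq4[of "?y i - ?z i" "?y j - ?z j"] d[of Y i Z] d[of Y j Z] by linarith
      finally show "norm (?g (?y i - ?y j) - ?g (?z i - ?z j)) \<le> M * (2 * dist Y Z)"
        using M(1) by (simp add: mult_left_mono)
    qed
    also have "(\<Sum>j\<in>?N. M * (2 * dist Y Z)) \<le> card A * (M * (2 * dist Y Z))"
      using card_mono[OF finite_A \<open>?N \<subseteq> A\<close>] M(1) by (simp add: mult_right_mono)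
    finally show ?thesis by (simp add: L_def algebra_simps)
  next
    case False
    then show ?thesis using L by (simp add: f_def)
  qed
  have lip: "dist (Phi Y) (Phi Z) \<le> L * dist Y Z" for Y Z
  proof (rule dist_bound)
    fix i
    show "dist (Phi Y i) (Phi Z i) \<le> L * dist Y Z"
      using lip_val[where Y = Y and Z = Z and i = "of_discrete i"]
      by (simp add: Phi[symmetric] dist_norm val_def of_discrete_inverse)
  qed
  define x0 where "x0 = Bcontfun (\<lambda>i. if of_discrete i \<in> A then p (of_discrete i) else 0)"
  have x0: "val x0 i = (if i \<in> A then p i else 0)" for i
    unfolding x0_def val_def
    using fin_supp[of "\<lambda>i. if i \<in> A then p i else 0"] by (simp add: Bcontfun_inverse discrete_inverse)
  obtain X where X: "X 0 = x0" "\<And>t. 0 \<le> t \<Longrightarrow> (X has_vector_derivative Phi (X t)) (at t within {0..})"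
    using lipschitz_ode_exists[of Phi L x0, OF lip L] by blast
  \<comment> \<open>Evaluation at an agent is bounded and linear, so the derivative in the Banach
    space yields the derivative of each position.\<close>
  have bl: "bounded_linear (\<lambda>Y. val Y i)" for i
    unfolding val_def
    by (rule bounded_linear_intro[of _ 1]) (auto simp: plus_bcontfun.rep_eq scaleR_bcontfun.rep_eq norm_bounded)
  show thesis
  proof (rule that[of "\<lambda>i t. val (X t) i"])
    fix i assume i: "i \<in> A"
    show "val (X 0) i = p i" using i by (simp add: X(1) x0)
    fix t :: real assume "0 \<le> t"
    from bounded_linear.has_vector_derivative[OF bl X(2)[OF this], of i]
    have "((\<lambda>t. val (X t) i) has_vector_derivative f (val (X t)) i) (at t within {0..})" by (simp add: Phi)
    moreover have "f (val (X t)) i = - ((if i = l then 1 else 0) *\<^sub>R (val (X t) i - c)) -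
        (\<Sum>j\<in>{j. (i, j) \<in> F}. ?g (val (X t) i - val (X t) j))" using i by (simp add: f_def)
    ultimately show "((\<lambda>t. val (X t) i) has_vector_derivative - ((if i = l then 1 else 0) *\<^sub>R (val (X t) i - c)) -
        (\<Sum>j\<in>{j. (i, j) \<in> F}. ?g (val (X t) i - val (X t) j))) (at t within {0..})" by simp
  qed
qed

text \<open>As long as edges are shorter than \<open>R\<close>, truncated and true interaction agree
  and the energy does not grow; the energy bound then returns \<open>m < R\<close>, so the level
  \<open>R\<close> is never reached.\<close>

lemma fixed_graph_solution_0:
  assumes F: "F \<subseteq> pairs" "sym F" and init: "\<forall>(i, j)\<in>F. norm (p i - p j) < r" and l: "l \<in> A"
  obtains y where "\<And>i. i \<in> A \<Longrightarrow> y i 0 = p i"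
    "\<And>i t. i \<in> A \<Longrightarrow> 0 \<le> t \<Longrightarrow>
      (y i has_vector_derivative ctrl F l c (\<lambda>j. y j t) i) (at t within {0..})"
    "\<And>i j t. (i, j) \<in> F \<Longrightarrow> 0 \<le> t \<Longrightarrow> norm (y i t - y j t) < r"
proof -
  \<comment> \<open>Here the added 1 ensures \<open>1 \<le> C\<close>, which keeps the radicand in
    \<open>m\<close> nonnegative.\<close>
  define C where "C = energy F l c p + 1"
  have C: "1 \<le> C" using energy_bounds(1)[OF F(1) init, of l c] by (simp add: C_def)
  define m where "m = sqrt (r\<^sup>2 - r\<^sup>2 / (2 * C))"
  have le: "r\<^sup>2 / (2 * C) \<le> r\<^sup>2" using C by (simp add: divide_simps mult_le_cancel_left1)
  have "0 < r\<^sup>2 / (2 * C)" using C radius_bounds(3) by simp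
  then have "m < sqrt (r\<^sup>2)" unfolding m_def by (intro real_sqrt_less_mono) simp
  then have m: "0 \<le> m" "m < r" using le radius_bounds(3) by (auto simp: m_def)
  have bound: "norm (q i - q j) \<le> m"
    if "energy F l c q \<le> C" "\<forall>(i, j)\<in>F. norm (q i - q j) < r" "(i, j) \<in> F" for q i j
    unfolding m_def using energy_bounds(2)[OF F(1) that(2,3,1)] by (rule real_le_rsqrt)
  \<comment> \<open>Any value strictly between the energy bound \<open>m\<close> and
    \<open>r\<close> would do; the room above \<open>m\<close> makes the bootstrap strict.\<close>
  define R where "R = (m + r) / 2"
  have R: "0 < R" "m < R" "R < r" using m radius_bounds(3) by (auto simp: R_def)
  obtain y where y0: "\<And>i. i \<in> A \<Longrightarrow> y i 0 = p i"
    and y: "\<And>i t. i \<in> A \<Longrightarrow> 0 \<le> t \<Longrightarrow>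
      (y i has_vector_derivative - ((if i = l then 1 else 0) *\<^sub>R (y i t - c)) -
        (\<Sum>j\<in>{j. (i, j) \<in> F}. repulse (closest_point (cball 0 R) (y i t - y j t)))) (at t within {0..})"
    using truncated_solution[OF R(1,3) F(1)] by blast
  have deriv: "(y i has_vector_derivative ctrl F l c (\<lambda>j. y j t) i) (at t within {0..})"
    if "i \<in> A" "0 \<le> t" "\<forall>(i, j)\<in>F. norm (y i t - y j t) < R" for i t
  proof -
    have "(\<Sum>j\<in>{j. (i, j) \<in> F}. repulse (closest_point (cball 0 R) (y i t - y j t))) =
        (\<Sum>j\<in>{j. (i, j) \<in> F}. repulse (y i t - y j t))"
      using that(3) by (intro sum.cong refl arg_cong[of _ _ repulse] closest_point_self) (auto simp: less_imp_le)
    then show ?thesis using y[OF that(1,2)] by (simp add: ctrl_repulse)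
  qed
  have cont: "continuous_on {0..} (y i)" if "i \<in> A" for i
    using y[OF that] has_vector_derivative_continuous by (fastforce simp: continuous_on_eq_continuous_within)
  have close: "\<forall>(i, j)\<in>F. norm (y i t - y j t) < R" if "0 \<le> t" for t
  proof -
    have "\<forall>s\<in>{0..t}. \<forall>(i, j)\<in>F. norm (y i s - y j s) < R"
    proof (rule real_induct[OF that])
      have "norm (p i - p j) \<le> m" if "(i, j) \<in> F" for i j
        using bound[OF _ init that] by (simp add: C_def)
      then show "\<forall>(i, j)\<in>F. norm (y i 0 - y j 0) < R"
        using y0 F(1) R(2) by (fastforce simp: pairs_def)
    next
      fix s assume s: "0 \<le> s" "s < t" and IH: "\<forall>q\<in>{0..s}. \<forall>(i, j)\<in>F. norm (y i q - y j q) < R"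
      have lim: "(y i \<longlongrightarrow> y i s) (at_right s)" if "i \<in> A" for i
        by (rule continuous_on_Icc_at_rightD[of s t])
          (use s in \<open>auto intro: continuous_on_subset[OF cont[OF that]]\<close>)
      have "\<forall>\<^sub>F q in at_right s. case e of (i, j) \<Rightarrow> norm (y i q - y j q) < R" if "e \<in> F" for e
      proof (cases e)
        case (Pair i j)
        have "((\<lambda>q. norm (y i q - y j q)) \<longlongrightarrow> norm (y i s - y j s)) (at_right s)"
          using Pair that F(1) by (intro tendsto_intros lim) (auto simp: pairs_def)
        then have "\<forall>\<^sub>F q in at_right s. norm (y i q - y j q) < R"
          by (rule order_tendstoD(2)) (use IH s Pair that in auto)
        then show ?thesis using Pair by simp
      qed
      moreover have "finite F" using F(1) finite_pairs finite_subset by blast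
      ultimately show "\<forall>\<^sub>F q in at_right s. \<forall>(i, j)\<in>F. norm (y i q - y j q) < R"
        by (intro eventually_ball_finite) auto
    next
      fix s assume s: "0 < s" "s \<le> t" and IH: "\<forall>q\<in>{0..<s}. \<forall>(i, j)\<in>F. norm (y i q - y j q) < R"
      have lim: "(y i \<longlongrightarrow> y i s) (at_left s)" if "i \<in> A" for i
        by (rule continuous_on_Icc_at_leftD[of 0 s])
          (use s in \<open>auto intro: continuous_on_subset[OF cont[OF that]]\<close>)
      \<comment> \<open>At \<open>s\<close> the limit gives only a weak inequality, but since
        \<open>R < r\<close> this suffices for the energy to be continuous up to
        \<open>s\<close>.\<close>
      have leR: "norm (y i s - y j s) \<le> R" if "(i, j) \<in> F" for i j
      proof (rule tendsto_upperbound)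
        show "((\<lambda>q. norm (y i q - y j q)) \<longlongrightarrow> norm (y i s - y j s)) (at_left s)"
          using that F(1) by (intro tendsto_intros lim) (auto simp: pairs_def)
        have "\<forall>\<^sub>F q in at_left s. q \<in> {0<..<s}" using s(1) by (rule eventually_at_left_real)
        then show "\<forall>\<^sub>F q in at_left s. norm (y i q - y j q) \<le> R"
        proof eventually_elim
          case (elim q)
          then have "\<forall>(i, j)\<in>F. norm (y i q - y j q) < R" using IH by auto
          then show ?case using that by auto
        qed
      qed simp
      have below: "\<forall>(i, j)\<in>F. norm (y i q - y j q) < r" if "0 \<le> q" "q \<le> s" for q
        using IH leR that R(3) by (cases "q = s") force+
      have "energy F l c (\<lambda>i. y i s) \<le> energy F l c (\<lambda>i. y i 0)"
      proof (rule DERIV_nonpos_imp_decreasing_open[where f = "\<lambda>q. energy F l c (\<lambda>i. y i q)"])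
        show "0 \<le> s" using s by simp
        show "continuous_on {0..s} (\<lambda>q. energy F l c (\<lambda>i. y i q))"
        proof (rule continuous_on_eq_continuous_within[THEN iffD2], intro ballI)
          fix q assume q: "q \<in> {0..s}"
          have "(y i \<longlongrightarrow> y i q) (at q within {0..s})" if "i \<in> A" for i
            using continuous_on_subset[OF cont[OF that], of "{0..s}"] q
            by (auto simp: continuous_on_def)
          then show "continuous (at q within {0..s}) (\<lambda>q. energy F l c (\<lambda>i. y i q))"
            unfolding continuous_within using q by (intro energy_tendsto F l below) auto
        qed
        fix q assume q: "0 < q" "q < s"
        have at: "at q within {0..} = at q" using q by (intro at_within_interior) simp
        have "((\<lambda>q. energy F l c (\<lambda>i. y i q)) has_real_derivative
            - (\<Sum>i\<in>A. ctrl F l c (\<lambda>i. y i q) i \<bullet> ctrl F l c (\<lambda>i. y i q) i)) (at q)"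
        proof (rule energy_derivative[where x = y and v = "ctrl F l c (\<lambda>i. y i q)", OF F _ l])
          show "\<forall>(i, j)\<in>F. norm (y i q - y j q) < r" using q by (intro below) auto
          show "(y i has_vector_derivative ctrl F l c (\<lambda>i. y i q) i) (at q)" if "i \<in> A" for i
            using deriv[OF that, of q] IH q by (simp add: at)
        qed
        moreover have "0 \<le> (\<Sum>i\<in>A. ctrl F l c (\<lambda>i. y i q) i \<bullet> ctrl F l c (\<lambda>i. y i q) i)"
          by (intro sum_nonneg) simp
        ultimately show "\<exists>d. DERIV (\<lambda>q. energy F l c (\<lambda>i. y i q)) q :> d \<and> d \<le> 0"
          by (intro exI conjI) auto
      qed
      also have "energy F l c (\<lambda>i. y i 0) = energy F l c p"
        unfolding energy_def using l y0 by (auto intro!: sum.cong arg_cong2[of _ _ _ _ "(+)"] simp: pairs_def)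
      finally have "energy F l c (\<lambda>i. y i s) \<le> C" by (simp add: C_def)
      then show "\<forall>(i, j)\<in>F. norm (y i s - y j s) < R"
        using bound[of "\<lambda>i. y i s"] below[of s] s R(2) by fastforce
    qed
    then show ?thesis using that by simp
  qed
  show thesis
    by (rule that[of y, OF y0 deriv]) (use close R(3) in force)+
qed

lemma fixed_graph_solution:
  assumes F: "F \<subseteq> pairs" "sym F" and init: "\<forall>(i, j)\<in>F. norm (p i - p j) < r" and l: "l \<in> A"
  obtains y where "\<And>i. y i a = p i"
    "\<And>i t. i \<in> A \<Longrightarrow> a < t \<Longrightarrow> (y i has_vector_derivative ctrl F l c (\<lambda>j. y j t) i) (at t)"
    "\<And>i. i \<in> A \<Longrightarrow> continuous_on {a..} (y i)"
    "\<And>i j t. (i, j) \<in> F \<Longrightarrow> a \<le> t \<Longrightarrow> norm (y i t - y j t) < r"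
proof -
  obtain z where z0: "\<And>i. i \<in> A \<Longrightarrow> z i 0 = p i"
    and z: "\<And>i t. i \<in> A \<Longrightarrow> 0 \<le> t \<Longrightarrow>
      (z i has_vector_derivative ctrl F l c (\<lambda>j. z j t) i) (at t within {0..})"
    and zr: "\<And>i j t. (i, j) \<in> F \<Longrightarrow> 0 \<le> t \<Longrightarrow> norm (z i t - z j t) < r"
    using fixed_graph_solution_0[OF F init l] by blast
  \<comment> \<open>Indices outside \<open>A\<close> are kept constant so that the initial condition
    holds for every index.\<close>
  define y where "y i t = (if i \<in> A then z i (t - a) else p i)" for i t
  have yA: "i \<in> A \<Longrightarrow> y i = (\<lambda>t. z i (t - a))" for i by (auto simp: y_def)
  have ctrl: "ctrl F l c (\<lambda>j. y j t) i = ctrl F l c (\<lambda>j. z j (t - a)) i" if "i \<in> A" for i t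
    unfolding ctrl_def using that F(1) by (intro arg_cong2[of _ _ _ _ "(-)"] sum.cong) (auto simp: y_def pairs_def)
  show thesis
  proof (rule that[of y])
    show "y i a = p i" for i by (simp add: y_def z0)
    fix i assume i: "i \<in> A"
    have c: "continuous_on {0..} (z i)"
      using z[OF i] has_vector_derivative_continuous by (fastforce simp: continuous_on_eq_continuous_within)
    show "continuous_on {a..} (y i)" unfolding yA[OF i]
      by (rule continuous_on_compose2[OF c]) (auto intro!: continuous_intros)
    fix t assume t: "a < t"
    have "at (t - a) within {0..} = at (t - a)" using t by (intro at_within_interior) simp
    then have "(z i has_vector_derivative ctrl F l c (\<lambda>j. z j (t - a)) i) (at (t - a))"
      using z[OF i, of "t - a"] t by simp
    moreover have "((\<lambda>t. t - a) has_vector_derivative 1) (at t)"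
      by (auto intro!: derivative_eq_intros simp: has_real_derivative_iff_has_vector_derivative[symmetric])
    ultimately have "(z i \<circ> (\<lambda>t. t - a) has_vector_derivative 1 *\<^sub>R ctrl F l c (\<lambda>j. z j (t - a)) i) (at t)"
      by (intro vector_diff_chain_at) auto
    then show "(y i has_vector_derivative ctrl F l c (\<lambda>j. y j t) i) (at t)"
      unfolding yA[OF i] ctrl[OF i] by (simp add: o_def)
  next
    fix i j t assume "(i, j) \<in> F" "a \<le> t"
    then show "norm (y i t - y j t) < r" using zr[of i j "t - a"] F(1) by (auto simp: y_def pairs_def)
  qed
qed

section \<open>Gluing of hybrid trajectories\<close>

text \<open>Depends only on the values at \<open>t\<close> and shortly after it. Together with
  \<open>left_ok\<close> it makes \<open>hybrid\<close>, up to derivatives, a local property, so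
  that gluing needs a check at the junction only.\<close>

definition right_ok :: "real \<Rightarrow> (nat \<Rightarrow> real \<Rightarrow> real^2) \<Rightarrow> (real \<Rightarrow> (nat \<times> nat) set) \<Rightarrow> bool" where
  "right_ok t x E \<longleftrightarrow> E t \<subseteq> pairs \<and> (\<forall>i\<in>A. (x i \<longlongrightarrow> x i t) (at_right t)) \<and>
    (\<forall>(i, j)\<in>pairs.
      ((i, j) \<in> E t \<and> (\<forall>\<^sub>F s in at_right t. norm (x i s - x j s) \<le> r) \<longrightarrow>
        (\<forall>\<^sub>F s in at_right t. (i, j) \<in> E s)) \<and>
      ((i, j) \<notin> E t \<longrightarrow> (\<forall>\<^sub>F s in at_right t. (i, j) \<notin> E s)))"

definition left_ok :: "real \<Rightarrow> (nat \<Rightarrow> real \<Rightarrow> real^2) \<Rightarrow> (real \<Rightarrow> (nat \<times> nat) set) \<Rightarrow> bool" where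
  "left_ok t x E \<longleftrightarrow> (\<forall>i\<in>A. (x i \<longlongrightarrow> x i t) (at_left t)) \<and>
    (\<forall>(i, j)\<in>pairs.
      (i, j) \<in> E t \<longleftrightarrow>
        norm (x i t - x j t) \<le> r - eps \<or>
        r - eps < norm (x i t - x j t) \<and> norm (x i t - x j t) \<le> r \<and>
          (\<forall>\<^sub>F s in at_left t. (i, j) \<in> E s))"

lemma hybrid_iff:
  "hybrid a T x E u \<longleftrightarrow> (\<forall>t. a \<le> t \<and> ereal t < T \<longrightarrow> right_ok t x E) \<and>
    (\<forall>t. a < t \<and> ereal t < T \<longrightarrow> left_ok t x E) \<and>
    (\<forall>i\<in>A. \<forall>b. ereal b < T \<longrightarrow>
      finite {t. a < t \<and> t \<le> b \<and> \<not> (x i has_vector_derivative u i t) (at t)})"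
    (is "_ \<longleftrightarrow> ?R")
proof
  assume h: "hybrid a T x E u"
  then have rules: "edge_rules a T x E" by (simp add: hybrid_def)
  show ?R
  proof (intro conjI allI impI)
    show "right_ok t x E" if "a \<le> t \<and> ereal t < T" for t
      unfolding right_ok_def using that hybrid_tendsto(1)[OF h] rules
      unfolding edge_rules_def by blast
    show "left_ok t x E" if "a < t \<and> ereal t < T" for t
      unfolding left_ok_def using that hybrid_tendsto(2)[OF h] rules
      unfolding edge_rules_def by blast
  qed (use h in \<open>auto simp: hybrid_def motion_def\<close>)
next
  assume R: ?R
  have "motion a T x u" unfolding motion_def
    using R by (auto intro!: continuous_on_one_sided simp: right_ok_def left_ok_def)
  moreover have "edge_rules a T x E" unfolding edge_rules_def
    using R unfolding right_ok_def left_ok_def by blast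
  ultimately show "hybrid a T x E u" by (simp add: hybrid_def)
qed

lemma right_ok_cong:
  assumes ok: "right_ok t x E" and "t < d"
    and eq: "\<And>q. t \<le> q \<Longrightarrow> q < d \<Longrightarrow> E' q = E q \<and> (\<forall>i\<in>A. x' i q = x i q)"
  shows "right_ok t x' E'"
proof -
  have "\<forall>\<^sub>F q in at_right t. q \<in> {t<..<d}" using \<open>t < d\<close> by (rule eventually_at_right_real)
  then have ev: "\<forall>\<^sub>F q in at_right t. E q = E' q \<and> (\<forall>i\<in>A. x i q = x' i q)"
    by eventually_elim (use eq in auto)
  have t: "E' t = E t" "\<And>i. i \<in> A \<Longrightarrow> x' i t = x i t" using eq[of t] \<open>t < d\<close> by auto
  have lim: "(x' i \<longlongrightarrow> x' i t) (at_right t)" if "i \<in> A" for i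
  proof -
    have "(x i \<longlongrightarrow> x' i t) (at_right t)" using ok that t(2)[OF that] by (simp add: right_ok_def)
    moreover have "\<forall>\<^sub>F q in at_right t. x i q = x' i q" using ev by (rule eventually_mono) (use that in auto)
    ultimately show ?thesis by (rule Lim_transform_eventually)
  qed
  have "(\<forall>\<^sub>F s in at_right t. norm (x' i s - x' j s) \<le> r) \<longleftrightarrow> (\<forall>\<^sub>F s in at_right t. norm (x i s - x j s) \<le> r)"
    if "(i, j) \<in> pairs" for i j
    by (rule eventually_subst, use ev in eventually_elim) (use that in \<open>auto simp: pairs_def\<close>)
  moreover have "(\<forall>\<^sub>F s in at_right t. (i, j) \<in> E' s) \<longleftrightarrow> (\<forall>\<^sub>F s in at_right t. (i, j) \<in> E s)" for i j
    by (rule eventually_subst, use ev in eventually_elim) auto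
  moreover have "(\<forall>\<^sub>F s in at_right t. (i, j) \<notin> E' s) \<longleftrightarrow> (\<forall>\<^sub>F s in at_right t. (i, j) \<notin> E s)" for i j
    by (rule eventually_subst, use ev in eventually_elim) auto
  ultimately show ?thesis using ok lim unfolding right_ok_def t by auto
qed

lemma left_ok_cong:
  assumes ok: "left_ok t x E" and "d < t"
    and eq: "\<And>q. d < q \<Longrightarrow> q \<le> t \<Longrightarrow> E' q = E q \<and> (\<forall>i\<in>A. x' i q = x i q)"
  shows "left_ok t x' E'"
proof -
  have "\<forall>\<^sub>F q in at_left t. q \<in> {d<..<t}" using \<open>d < t\<close> by (rule eventually_at_left_real)
  then have ev: "\<forall>\<^sub>F q in at_left t. E q = E' q \<and> (\<forall>i\<in>A. x i q = x' i q)"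
    by eventually_elim (use eq in auto)
  have t: "E' t = E t" "\<And>i. i \<in> A \<Longrightarrow> x' i t = x i t" using eq[of t] \<open>d < t\<close> by auto
  have lim: "(x' i \<longlongrightarrow> x' i t) (at_left t)" if "i \<in> A" for i
  proof -
    have "(x i \<longlongrightarrow> x' i t) (at_left t)" using ok that t(2)[OF that] by (simp add: left_ok_def)
    moreover have "\<forall>\<^sub>F q in at_left t. x i q = x' i q" using ev by (rule eventually_mono) (use that in auto)
    ultimately show ?thesis by (rule Lim_transform_eventually)
  qed
  have "(\<forall>\<^sub>F s in at_left t. (i, j) \<in> E' s) \<longleftrightarrow> (\<forall>\<^sub>F s in at_left t. (i, j) \<in> E s)" for i j
    by (rule eventually_subst, use ev in eventually_elim) auto
  moreover have "norm (x' i t - x' j t) = norm (x i t - x j t)" if "(i, j) \<in> pairs" for i j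
    using t(2) that by (simp add: pairs_def)
  ultimately show ?thesis using ok lim unfolding left_ok_def t by auto
qed

text \<open>The assumption \<open>fin\<close> is separate because a hybrid trajectory on
  \<open>[a, b)\<close> has finitely many bad instants only up to times before \<open>b\<close>;
  they could accumulate at the junction.\<close>

lemma hybrid_concat:
  fixes a b :: real and x1 x2 u1 u2 :: "nat \<Rightarrow> real \<Rightarrow> real^2"
    and E1 E2 :: "real \<Rightarrow> (nat \<times> nat) set"
  defines "X \<equiv> \<lambda>i t. if t < b then x1 i t else x2 i t"
    and "G \<equiv> \<lambda>t. if t < b then E1 t else E2 t"
    and "U \<equiv> \<lambda>i t. if t < b then u1 i t else u2 i t"
  assumes "a \<le> b" and h1: "hybrid a (ereal b) x1 E1 u1"
    and fin: "\<And>i. i \<in> A \<Longrightarrow> finite {t. a < t \<and> t < b \<and> \<not> (x1 i has_vector_derivative u1 i t) (at t)}"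
    and h2: "hybrid b T x2 E2 u2" and junction: "a < b \<Longrightarrow> left_ok b X G"
  shows "hybrid a T X G U"
  unfolding hybrid_iff
proof (intro conjI allI impI ballI)
  fix t assume t: "a \<le> t \<and> ereal t < T"
  show "right_ok t X G"
  proof (cases "t < b")
    case True
    then have "right_ok t x1 E1" using h1 t by (simp add: hybrid_iff)
    then show ?thesis by (rule right_ok_cong[OF _ True]) (auto simp: X_def G_def)
  next
    case False
    then have "right_ok t x2 E2" using h2 t by (simp add: hybrid_iff)
    then show ?thesis by (rule right_ok_cong[of _ _ _ "t + 1"]) (use False in \<open>auto simp: X_def G_def\<close>)
  qed
next
  fix t assume t: "a < t \<and> ereal t < T"
  show "left_ok t X G"
  proof (cases t b rule: linorder_cases)
    case less
    then have "left_ok t x1 E1" using h1 t by (simp add: hybrid_iff)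
    then show ?thesis by (rule left_ok_cong[of _ _ _ "t - 1"]) (use less in \<open>auto simp: X_def G_def\<close>)
  next
    case equal
    then show ?thesis using junction t by simp
  next
    case greater
    then have "left_ok t x2 E2" using h2 t by (simp add: hybrid_iff)
    then show ?thesis by (rule left_ok_cong[OF _ greater]) (auto simp: X_def G_def)
  qed
next
  fix i q assume i: "i \<in> A" and q: "ereal q < T"
  let ?B1 = "{t. a < t \<and> t < b \<and> \<not> (x1 i has_vector_derivative u1 i t) (at t)}"
  let ?B2 = "{t. b < t \<and> t \<le> q \<and> \<not> (x2 i has_vector_derivative u2 i t) (at t)}"
  have "{t. a < t \<and> t \<le> q \<and> \<not> (X i has_vector_derivative U i t) (at t)} \<subseteq> {b} \<union> ?B1 \<union> ?B2"
  proof
    fix t assume t: "t \<in> {t. a < t \<and> t \<le> q \<and> \<not> (X i has_vector_derivative U i t) (at t)}"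
    show "t \<in> {b} \<union> ?B1 \<union> ?B2"
    proof (cases t b rule: linorder_cases)
      case less
      then show ?thesis using t deriv_cong[of "x1 i" "U i t" t a b "X i"] by (auto simp: X_def U_def)
    next
      case greater
      then show ?thesis using t deriv_cong[of "x2 i" "U i t" t b "t + 1" "X i"] by (auto simp: X_def U_def)
    qed simp
  qed
  moreover have "finite ({b} \<union> ?B1 \<union> ?B2)" using fin[OF i] h2 i q by (simp add: hybrid_iff)
  ultimately show "finite {t. a < t \<and> t \<le> q \<and> \<not> (X i has_vector_derivative U i t) (at t)}"
    by (rule finite_subset)
qed

text \<open>In a safe state edges are short enough to be kept and other pairs too far apart to be
  added, so the rules give no reason for a change.\<close>

lemma hybrid_fixed_graph:
  assumes m: "motion a T x u" and safe: "\<And>t. a \<le> t \<Longrightarrow> ereal t < T \<Longrightarrow> safe (\<lambda>i. x i t) F"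
  shows "hybrid a T x (\<lambda>_. F) u"
proof -
  have "edge_rules a T x (\<lambda>_. F)"
    unfolding edge_rules_def
  proof (intro conjI allI impI ballI; clarify)
    fix t i j assume t: "a \<le> t" "ereal t < T" "(i, j) \<in> F"
    then show "(i, j) \<in> pairs" using safeD(1)[OF safe[OF t(1,2)]] by blast
  next
    fix i j assume ij: "(i, j) \<in> pairs"
    have "(i, j) \<in> F \<longleftrightarrow> norm (x i t - x j t) \<le> r - eps \<or>
        r - eps < norm (x i t - x j t) \<and> norm (x i t - x j t) \<le> r \<and> (i, j) \<in> F"
      if "a < t" "ereal t < T" for t
      using safeD(4,5)[OF safe[of t], of i j] that ij by (cases "(i, j) \<in> F") force+
    then show "(\<forall>t. a < t \<and> ereal t < T \<longrightarrow>
        ((i, j) \<in> F \<longleftrightarrow> norm (x i t - x j t) \<le> r - eps \<or>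
          r - eps < norm (x i t - x j t) \<and> norm (x i t - x j t) \<le> r \<and>
            (\<forall>\<^sub>F s in at_left t. (i, j) \<in> F))) \<and>
      (\<forall>t. a \<le> t \<and> ereal t < T \<longrightarrow>
        ((i, j) \<in> F \<and> (\<forall>\<^sub>F s in at_right t. norm (x i s - x j s) \<le> r) \<longrightarrow>
          (\<forall>\<^sub>F s in at_right t. (i, j) \<in> F)) \<and>
        ((i, j) \<notin> F \<longrightarrow> (\<forall>\<^sub>F s in at_right t. (i, j) \<notin> F)))"
      by simp
  qed
  then show ?thesis using m by (simp add: hybrid_def)
qed

text \<open>Induction on the number of pairs outside the graph. The solution with fixed graph is
  followed until some such pair comes as close as \<open>r - eps\<close>; there all such pairs join
  at once, and the induction hypothesis continues with a strictly larger graph.\<close>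

lemma hybrid_solution:
  assumes "safe p F" and l: "l \<in> A"
  shows "\<exists>x E. (\<forall>i. x i a = p i) \<and> E a = F \<and>
    hybrid a \<infinity> x E (\<lambda>i t. ctrl (E t) l c (\<lambda>j. x j t) i)"
  using assms(1)
proof (induction "card (pairs - F)" arbitrary: F p a rule: less_induct)
  case less
  note safe = less.prems
  obtain y where y: "\<And>i. y i a = p i"
    "\<And>i t. i \<in> A \<Longrightarrow> a < t \<Longrightarrow> (y i has_vector_derivative ctrl F l c (\<lambda>j. y j t) i) (at t)"
    "\<And>i. i \<in> A \<Longrightarrow> continuous_on {a..} (y i)"
    "\<And>i j t. (i, j) \<in> F \<Longrightarrow> a \<le> t \<Longrightarrow> norm (y i t - y j t) < r"
    using fixed_graph_solution[OF safeD(1-3)[OF safe] l, of a c] by blast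
  let ?u = "\<lambda>i t. ctrl F l c (\<lambda>j. y j t) i"
  have "continuous_on {t. a \<le> t \<and> ereal t < T} (y i)" if "i \<in> A" for i T
    by (rule continuous_on_subset[OF y(3)[OF that]]) auto
  moreover have none: "finite {t. a < t \<and> Q t \<and> \<not> (y i has_vector_derivative ?u i t) (at t)}" if "i \<in> A" for i Q
  proof -
    have "{t. a < t \<and> Q t \<and> \<not> (y i has_vector_derivative ?u i t) (at t)} = {}"
      using y(2)[OF that] by auto
    then show ?thesis by (simp only: finite.emptyI)
  qed
  ultimately have motion: "motion a T y ?u" for T by (simp add: motion_def)
  define meet where "meet t \<longleftrightarrow> (\<exists>(i, j)\<in>pairs - F. norm (y i t - y j t) \<le> r - eps)" for t
  have safe_y: "safe (\<lambda>i. y i t) F" if "a \<le> t" "\<not> meet t" for t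
  proof (rule safeI)
    show "norm (y i t - y j t) < r" if "(i, j) \<in> F" for i j using y(4) that \<open>a \<le> t\<close> by blast
    show "r - eps < norm (y i t - y j t)" if "(i, j) \<in> pairs" "(i, j) \<notin> F" for i j
      using \<open>\<not> meet t\<close> that by (force simp: meet_def)
  qed (use safeD(1,2,6)[OF safe] in blast)+
  show ?case
  proof (cases "\<exists>t\<ge>a. meet t")
    case False
    have "hybrid a \<infinity> y (\<lambda>_. F) ?u"
      by (rule hybrid_fixed_graph[OF motion safe_y]) (use False in auto)
    then show ?thesis using y(1) by (intro exI[of _ y] exI[of _ "\<lambda>_. F"]) auto
  next
    case True
    then obtain t0 where t0: "a \<le> t0" "meet t0" by blast
    have "closed {s \<in> {a..t0}. meet s}"
    proof -
      have "closed {s \<in> {a..t0}. norm (y i s - y j s) \<le> r - eps}" if "(i, j) \<in> pairs" for i j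
      proof (rule continuous_on_closed_Collect_le)
        show "continuous_on {a..t0} (\<lambda>s. norm (y i s - y j s))"
          using that by (intro continuous_intros continuous_on_subset[OF y(3)]) (auto simp: pairs_def)
      qed (auto intro!: continuous_intros)
      then have "closed (\<Union>e\<in>pairs - F. {s \<in> {a..t0}. norm (y (fst e) s - y (snd e) s) \<le> r - eps})"
        by (intro closed_UN) auto
      moreover have "{s \<in> {a..t0}. meet s} =
          (\<Union>e\<in>pairs - F. {s \<in> {a..t0}. norm (y (fst e) s - y (snd e) s) \<le> r - eps})"
        by (auto simp: meet_def)
      ultimately show ?thesis by simp
    qed
    from first_time[OF t0 this] obtain b where b: "a \<le> b" "meet b"
      "\<forall>s. a \<le> s \<and> s < b \<longrightarrow> \<not> meet s" by blast
    define F' where "F' = F \<union> {(i, j)\<in>pairs. norm (y i b - y j b) \<le> r - eps}"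
    have F': "safe (\<lambda>i. y i b) F'"
    proof (rule safeI)
      show "F' \<subseteq> pairs" using safeD(1)[OF safe] by (auto simp: F'_def)
      show "sym F'"
        using safeD(2)[OF safe] by (auto simp: F'_def sym_def pairs_def norm_minus_commute)
      show "norm (y i b - y j b) < r" if "(i, j) \<in> F'" for i j
        using that y(4)[OF _ b(1)] radius_bounds(1) by (fastforce simp: F'_def)
      show "r - eps < norm (y i b - y j b)" if "(i, j) \<in> pairs" "(i, j) \<notin> F'" for i j
        using that by (auto simp: F'_def)
      show "connected_graph A F'"
        using safeD(6)[OF safe] connected_graph_mono[of A F F'] by (auto simp: F'_def)
    qed
    have "card (pairs - F') < card (pairs - F)"
      using b(2) by (intro psubset_card_mono) (auto simp: F'_def meet_def)
    from less.hyps[OF this F', of b] obtain x2 E2 where s2: "\<forall>i. x2 i b = y i b" "E2 b = F'"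
      "hybrid b \<infinity> x2 E2 (\<lambda>i t. ctrl (E2 t) l c (\<lambda>j. x2 j t) i)" by blast
    let ?X = "\<lambda>i t. if t < b then y i t else x2 i t"
    let ?G = "\<lambda>t. if t < b then F else E2 t"
    have "hybrid a \<infinity> ?X ?G (\<lambda>i t. if t < b then ?u i t else ctrl (E2 t) l c (\<lambda>j. x2 j t) i)"
    proof (rule hybrid_concat[OF b(1) _ _ s2(3)])
      show "hybrid a (ereal b) y (\<lambda>_. F) ?u"
        by (rule hybrid_fixed_graph[OF motion safe_y]) (use b(3) in auto)
      show "finite {t. a < t \<and> t < b \<and> \<not> (y i has_vector_derivative ?u i t) (at t)}" if "i \<in> A" for i
        using none[OF that, of "\<lambda>t. t < b"] by simp
      assume "a < b"
      have ev: "\<forall>\<^sub>F s in at_left b. s < b" by (simp add: eventually_at_filter)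
      have lim: "(?X i \<longlongrightarrow> ?X i b) (at_left b)" if "i \<in> A" for i
      proof -
        have "continuous_on {a..b} (y i)" by (rule continuous_on_subset[OF y(3)[OF that]]) auto
        then have "(y i \<longlongrightarrow> x2 i b) (at_left b)"
          using continuous_on_Icc_at_leftD[of a b "y i"] \<open>a < b\<close> s2(1) by simp
        moreover have "\<forall>\<^sub>F s in at_left b. y i s = ?X i s" using ev by (rule eventually_mono) simp
        ultimately show ?thesis by (simp add: Lim_transform_eventually)
      qed
      have "(\<forall>\<^sub>F s in at_left b. (i, j) \<in> ?G s) \<longleftrightarrow> (\<forall>\<^sub>F s in at_left b. (i, j) \<in> F)" for i j
        by (rule eventually_subst) (use ev in \<open>eventually_elim, simp\<close>)
      then have before: "(\<forall>\<^sub>F s in at_left b. (i, j) \<in> ?G s) \<longleftrightarrow> (i, j) \<in> F" for i j by simp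
      have "(i, j) \<in> ?G b \<longleftrightarrow> norm (?X i b - ?X j b) \<le> r - eps \<or>
          r - eps < norm (?X i b - ?X j b) \<and> norm (?X i b - ?X j b) \<le> r \<and> (i, j) \<in> F"
        if "(i, j) \<in> pairs" for i j
        using that s2(1,2) y(4)[of i j b] b(1) by (auto simp: F'_def)
      then show "left_ok b ?X ?G" unfolding left_ok_def before using lim by blast
    qed
    moreover have "(\<lambda>i t. if t < b then ?u i t else ctrl (E2 t) l c (\<lambda>j. x2 j t) i) =
        (\<lambda>i t. ctrl (?G t) l c (\<lambda>j. ?X j t) i)"
      by (intro ext) simp
    moreover have "?G a = F"
    proof -
      \<comment> \<open>In the safe initial state no missing pair is within \<open>r - eps\<close>,
        so the first meeting happens strictly later and the initial graph is kept at
        \<open>a\<close>.\<close>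
      have "a \<noteq> b" using b(2) safeD(5)[OF safe] y(1) by (force simp: meet_def)
      then show ?thesis using b(1) by simp
    qed
    moreover have "?X i a = p i" for i using y(1) s2(1) b(1) by (cases "a = b") auto
    ultimately show ?thesis by (intro exI[of _ ?X] exI[of _ ?G]) auto
  qed
qed

text \<open>The new trajectory again lasts forever, since the agents rest after the service; a later
  round can thus overwrite it from any instant after \<open>s\<close>. The first arrival of the team
  exists because \<open>goal_reached\<close> brings all agents near the centre at some time.\<close>

lemma next_round:
  assumes h: "hybrid 0 \<infinity> x E u" and safe: "safe (\<lambda>i. x i e) (E e)" and "0 \<le> e"
    and E: "\<And>t. E t \<subseteq> pairs" and l: "l \<in> A"
    and R: "closed R" "cball c (min_radius S) \<subseteq> R" and M: "M \<subseteq> A"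
  obtains s x' E' u' where "e \<le> s" "hybrid 0 \<infinity> x' E' u'"
    "\<And>t i. t < e \<Longrightarrow> x' i t = x i t" "\<And>t i. t < e \<Longrightarrow> u' i t = u i t" "\<And>t. t < e \<Longrightarrow> E' t = E t"
    "\<And>i. x' i e = x i e" "E' e = E e" "\<And>t. E' t \<subseteq> pairs"
    "\<And>i. i \<in> M \<Longrightarrow> x' i s \<in> R" "\<And>t. e \<le> t \<Longrightarrow> t < s \<Longrightarrow> \<exists>i\<in>M. x' i t \<notin> R"
    "\<And>t i. e \<le> t \<Longrightarrow> t < s \<Longrightarrow> i \<in> A \<Longrightarrow> u' i t = ctrl (E' t) l c (\<lambda>j. x' j t) i"
    "\<And>t i. s \<le> t \<Longrightarrow> u' i t = 0" "\<And>t. e \<le> t \<Longrightarrow> safe (\<lambda>i. x' i t) (E' t)"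
proof -
  obtain x2 E2 where s2: "\<forall>i. x2 i e = x i e" "E2 e = E e"
    "hybrid e \<infinity> x2 E2 (\<lambda>i t. ctrl (E2 t) l c (\<lambda>j. x2 j t) i)"
    using hybrid_solution[OF safe l] by blast
  let ?u2 = "\<lambda>i t. ctrl (E2 t) l c (\<lambda>j. x2 j t) i"
  have safe2: "safe (\<lambda>i. x2 i e) (E2 e)" using safe s2 by simp
  obtain t0 where t0: "e \<le> t0" "\<forall>i\<in>A. x2 i t0 \<in> cball c (min_radius S)"
    using goal_reached[OF s2(3) safe2 l _ radius_bounds(4)] by blast
  have "closed {s \<in> {e..t0}. \<forall>i\<in>M. x2 i s \<in> R}"
  proof -
    have "closed {s \<in> {e..t0}. x2 i s \<in> R}" if "i \<in> M" for i
    proof -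
      have "continuous_on {e..t0} (x2 i)"
        using hybrid_tendsto(3)[OF s2(3)] that M by auto
      then have "closed ({e..t0} \<inter> x2 i -` R)" using R(1) by (intro continuous_closed_preimage) auto
      moreover have "{e..t0} \<inter> x2 i -` R = {s \<in> {e..t0}. x2 i s \<in> R}" by auto
      ultimately show ?thesis by simp
    qed
    then have "closed ({e..t0} \<inter> (\<Inter>i\<in>M. {s \<in> {e..t0}. x2 i s \<in> R}))" by (intro closed_Int closed_INT) auto
    moreover have "{e..t0} \<inter> (\<Inter>i\<in>M. {s \<in> {e..t0}. x2 i s \<in> R}) = {s \<in> {e..t0}. \<forall>i\<in>M. x2 i s \<in> R}" by auto
    ultimately show ?thesis by simp
  qed
  moreover have "\<forall>i\<in>M. x2 i t0 \<in> R" using t0(2) R(2) M by blast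
  moreover define inside where "inside s \<longleftrightarrow> (\<forall>i\<in>M. x2 i s \<in> R)" for s
  ultimately have "inside t0" "closed {s \<in> {e..t0}. inside s}" by simp_all
  from first_time[OF t0(1) this] obtain s where s0: "e \<le> s" "inside s"
    "\<forall>t. e \<le> t \<and> t < s \<longrightarrow> \<not> inside t" by blast
  note s = s0[unfolded inside_def]
  have S2: "safe (\<lambda>i. x2 i t) (E2 t)" if "e \<le> t" for t
    using safe_preserved[OF s2(3) that _ safe2 l, where mu = 1] that by auto
  \<comment> \<open>Three pieces are glued: the given trajectory before \<open>e\<close>, the closed
    loop between \<open>e\<close> and \<open>s\<close>, and rest from \<open>s\<close> on.\<close>
  let ?x3 = "\<lambda>i t. if t < s then x2 i t else x2 i s"
  let ?E3 = "\<lambda>t. if t < s then E2 t else E2 s"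
  let ?u3 = "\<lambda>i t. if t < s then ?u2 i t else 0"
  have h3: "hybrid e \<infinity> ?x3 ?E3 ?u3"
  proof (rule hybrid_concat[OF s(1) hybrid_restrict[OF s2(3) order_refl]])
    show "finite {t. e < t \<and> t < s \<and> \<not> (x2 i has_vector_derivative ?u2 i t) (at t)}" if "i \<in> A" for i
      by (rule finite_subset[of _ "{t. e < t \<and> t \<le> s \<and> \<not> (x2 i has_vector_derivative ?u2 i t) (at t)}"])
        (use s2(3) that in \<open>auto simp: hybrid_iff\<close>)
    show "hybrid s \<infinity> (\<lambda>i t. x2 i s) (\<lambda>_. E2 s) (\<lambda>_ _. 0)"
      by (rule hybrid_fixed_graph) (use S2[OF s(1)] in \<open>auto simp: motion_def\<close>)
    assume "e < s"
    then have "left_ok s x2 E2" using s2(3) by (simp add: hybrid_iff)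
    then show "left_ok s ?x3 ?E3" by (rule left_ok_cong[of _ _ _ "s - 1"]) auto
  qed simp
  have start: "?x3 i e = x i e" "?E3 e = E e" for i using s2(1,2) s(1) by (cases "e = s"; auto)+
  let ?x4 = "\<lambda>i t. if t < e then x i t else ?x3 i t"
  let ?E4 = "\<lambda>t. if t < e then E t else ?E3 t"
  let ?u4 = "\<lambda>i t. if t < e then u i t else ?u3 i t"
  have h4: "hybrid 0 \<infinity> ?x4 ?E4 ?u4"
  proof (rule hybrid_concat[OF \<open>0 \<le> e\<close> hybrid_restrict[OF h order_refl]])
    show "finite {t. 0 < t \<and> t < e \<and> \<not> (x i has_vector_derivative u i t) (at t)}" if "i \<in> A" for i
      by (rule finite_subset[of _ "{t. 0 < t \<and> t \<le> e \<and> \<not> (x i has_vector_derivative u i t) (at t)}"])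
        (use h that in \<open>auto simp: hybrid_iff\<close>)
    show "hybrid e \<infinity> ?x3 ?E3 ?u3" by (rule h3)
    assume "0 < e"
    then have "left_ok e x E" using h by (simp add: hybrid_iff)
    then show "left_ok e ?x4 ?E4" by (rule left_ok_cong[of _ _ _ "e - 1"]) (use start in auto)
  qed simp
  have safe3: "safe (\<lambda>i. ?x3 i t) (?E3 t)" if "e \<le> t" for t
    using S2[OF that] S2[OF s(1)] by auto
  show thesis
  proof (rule that[OF s(1) h4])
    show "?E4 t \<subseteq> pairs" for t using E[of t] safeD(1)[OF safe3[of t]] by (cases "t < e") auto
    show "safe (\<lambda>i. ?x4 i t) (?E4 t)" if "e \<le> t" for t using safe3[OF that] that by simp
    show "\<exists>i\<in>M. ?x4 i t \<notin> R" if "e \<le> t" "t < s" for t using s(3) that by auto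
  qed (use start s in auto)
qed

end

section \<open>Every run satisfies the tasks\<close>

locale procedure_execution = agent_network S for S :: mas +
  fixes ready :: real and delay :: "nat \<Rightarrow> real" and pick :: "nat \<Rightarrow> nat \<Rightarrow> service \<Rightarrow> nat"
    and \<rho> :: run
  assumes ready_nonneg: "0 \<le> ready" and delay_nonneg: "\<And>k. 0 \<le> delay k"
    and pick: "goal_selection S pick" and run: "procedure_run S ready delay pick \<rho>"
begin

section \<open>Completion of all rounds\<close>

lemma
  shows elect_0: "elect \<rho> 0 = election_time S (position \<rho>) (ereal ready)"
    and elect_Suc: "\<And>k. elect \<rho> (Suc k) = election_time S (position \<rho>) (serve \<rho> k + ereal (delay k))"
    and leader_agent: "\<And>k. elect \<rho> k < \<infinity> \<Longrightarrow> leader \<rho> k \<in> A"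
    and leader_urge: "\<And>k j. elect \<rho> k < \<infinity> \<Longrightarrow> j \<in> A \<Longrightarrow> j \<noteq> leader \<rho> k \<Longrightarrow>
      urge_less (urge \<rho> k j) (urge \<rho> k (leader \<rho> k))"
    and serve_Inf: "\<And>k. serve \<rho> k = Inf (ereal ` {t. elect \<rho> k \<le> ereal t \<and>
          (\<forall>i\<in>team S \<rho> k. position \<rho> i t \<in> region S (leader \<rho> k) (goal S pick \<rho> k) \<and>
             (leader \<rho> k, i) \<in> (message_links S (position \<rho>) t)\<^sup>*)})"
    and disjoint_teams: "\<And>k m. k \<noteq> m \<Longrightarrow> serve \<rho> k = serve \<rho> m \<Longrightarrow> serve \<rho> k < \<infinity> \<Longrightarrow>
        team S \<rho> k \<inter> team S \<rho> m = {}"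
    and input_before: "\<And>i t. i \<in> A \<Longrightarrow> ereal t < elect \<rho> 0 \<Longrightarrow> input \<rho> i t = 0"
    and input_feedback: "\<And>i k t. i \<in> A \<Longrightarrow> elect \<rho> k \<le> ereal t \<Longrightarrow> ereal t < serve \<rho> k \<Longrightarrow>
           input \<rho> i t = feedback S pick \<rho> k i t"
    and input_rest: "\<And>i k t. i \<in> A \<Longrightarrow> serve \<rho> k \<le> ereal t \<Longrightarrow> ereal t < elect \<rho> (Suc k) \<Longrightarrow>
           input \<rho> i t = 0"
    and trajectories: "\<And>i. i \<in> A \<Longrightarrow>
        trajectory (horizon \<rho>) (init_pos S i) (input \<rho> i) (position \<rho> i)"
    and graph: "connectivity_graph S (horizon \<rho>) (position \<rho>) (edges \<rho>)"
  using run unfolding procedure_run_def by blast+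

definition safe_at :: "real \<Rightarrow> bool" where
  "safe_at t \<longleftrightarrow> safe (\<lambda>i. position \<rho> i t) (edges \<rho> t)"

lemma hybrid_run: "hybrid 0 (horizon \<rho>) (position \<rho>) (edges \<rho>) (input \<rho>)"
  using trajectories graph
    trajectories_iff[of "horizon \<rho>" "init_pos S" "input \<rho>" "position \<rho>"]
  by (auto simp: hybrid_def connectivity_graph_iff)

lemma safe_at_0: "safe_at 0"
proof -
  have init: "position \<rho> i 0 = init_pos S i" if "i \<in> A" for i
    using trajectories[OF that] by (simp add: trajectory_def)
  have "edges \<rho> 0 = initial_edges S"
    using graph by (auto simp: connectivity_graph_iff initial_edges_def pairs_def init)
  moreover have "safe (\<lambda>i. position \<rho> i 0) (initial_edges S)"
    by (rule safe_cong[OF _ safe_initial]) (simp add: init)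
  ultimately show ?thesis by (simp add: safe_at_def)
qed

lemma elect_le_serve: "elect \<rho> k \<le> serve \<rho> k"
  unfolding serve_Inf by (rule Inf_greatest) auto

lemma serve_le_elect: "serve \<rho> k \<le> elect \<rho> (Suc k)"
proof -
  have "serve \<rho> k + 0 \<le> serve \<rho> k + ereal (delay k)"
    using delay_nonneg by (intro add_left_mono) simp
  then show ?thesis using election_time_ge elect_Suc[of k] by (metis add.right_neutral order_trans)
qed

lemma elect_mono: "k \<le> m \<Longrightarrow> elect \<rho> k \<le> elect \<rho> m"
  by (rule lift_Suc_mono_le[of "elect \<rho>"]) (use elect_le_serve serve_le_elect order_trans in blast)+

lemma serve_mono: "k \<le> m \<Longrightarrow> serve \<rho> k \<le> serve \<rho> m"
  by (rule lift_Suc_mono_le[of "serve \<rho>"]) (use elect_le_serve serve_le_elect order_trans in blast)+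

lemma elect_nonneg: "0 \<le> elect \<rho> k"
proof -
  have "0 \<le> elect \<rho> 0" unfolding elect_0
    using ready_nonneg election_time_ge[of "ereal ready" "position \<rho>"] by (metis ereal_less_eq(5) order_trans)
  then show ?thesis using elect_mono[of 0 k] by simp
qed

lemma elect_le_horizon: "elect \<rho> k \<le> horizon \<rho>"
  unfolding horizon_def by (rule SUP_upper) simp

lemma leader_in_team: "leader \<rho> k \<in> team S \<rho> k"
  by (simp add: team_def)

text \<open>With zero delays several rounds may end at one instant. Their teams are disjoint, so
  their leaders are distinct, and there are finitely many agents.\<close>

lemma serve_fibre_finite: "s < \<infinity> \<Longrightarrow> finite {k. serve \<rho> k = s}"
proof -
  assume s: "s < \<infinity>"
  let ?K = "{k. serve \<rho> k = s}"
  have "inj_on (leader \<rho>) ?K"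
  proof (rule inj_onI, rule ccontr)
    fix k m assume km: "k \<in> ?K" "m \<in> ?K" "leader \<rho> k = leader \<rho> m" "k \<noteq> m"
    then have "team S \<rho> k \<inter> team S \<rho> m = {}" using s by (intro disjoint_teams) auto
    then show False using leader_in_team[of k] leader_in_team[of m] km(3) by auto
  qed
  moreover have "leader \<rho> ` ?K \<subseteq> A"
    using leader_agent s le_less_trans[OF elect_le_serve] by blast
  ultimately show ?thesis using finite_A by (meson finite_imageD finite_subset)
qed

text \<open>If an election took place at the horizon, all later rounds would be served at that same
  instant. Staying strictly below matters because the dynamics is only prescribed there.\<close>

lemma elect_less_horizon:
  assumes "elect \<rho> k < \<infinity>"
  shows "elect \<rho> k < horizon \<rho>"
proof (rule ccontr)
  assume "\<not> ?thesis"
  then have T: "elect \<rho> k = horizon \<rho>" using elect_le_horizon[of k] by simp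
  have "serve \<rho> m = horizon \<rho>" if "k \<le> m" for m
    using elect_mono[OF that] elect_le_serve[of m] serve_le_elect[of m] elect_le_horizon[of "Suc m"] T
    by simp
  then have "{k..} \<subseteq> {m. serve \<rho> m = horizon \<rho>}" by auto
  moreover have "finite {m. serve \<rho> m = horizon \<rho>}" using T assms by (intro serve_fibre_finite) simp
  ultimately show False using infinite_Ici finite_subset by blast
qed

lemma serve_less_horizon:
  assumes "serve \<rho> k < \<infinity>"
  shows "serve \<rho> k < horizon \<rho>"
proof (cases "elect \<rho> (Suc k) < \<infinity>")
  case True
  then show ?thesis using elect_less_horizon serve_le_elect le_less_trans by blast
next
  case False
  then have "horizon \<rho> = \<infinity>" using elect_le_horizon[of "Suc k"] by auto
  then show ?thesis using assms by simp
qed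

lemma safe_at_preserved:
  assumes "0 \<le> a" "ereal b < horizon \<rho>" "safe_at a" "l \<in> A" "0 \<le> mu"
    and "\<And>t i. a < t \<Longrightarrow> t < b \<Longrightarrow> i \<in> A \<Longrightarrow>
      input \<rho> i t = mu *\<^sub>R ctrl (edges \<rho> t) l c (\<lambda>i. position \<rho> i t) i"
    and "a \<le> t" "t \<le> b"
  shows "safe_at t"
  using safe_preserved[OF hybrid_restrict[OF hybrid_run assms(1) order_refl] _ assms(2) _ assms(4,5,6)]
    assms(3,7,8) by (auto simp: safe_at_def)

lemma safe_at_rest:
  assumes "0 \<le> a" "ereal b < horizon \<rho>" "safe_at a"
    and "\<And>t i. a < t \<Longrightarrow> t < b \<Longrightarrow> i \<in> A \<Longrightarrow> input \<rho> i t = 0"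
    and "a \<le> t" "t \<le> b"
  shows "safe_at t"
proof -
  \<comment> \<open>Rest is the controller with factor 0, so any agent can act as leader and the
    centre can be \<open>undefined\<close>.\<close>
  obtain l where "l \<in> A" using A_nonempty by blast
  then show ?thesis
    using safe_at_preserved[OF assms(1-3), of l 0 undefined t] assms(4-6) by auto
qed

text \<open>Finiteness of \<open>elect \<rho> k\<close> is not known beforehand, but if it is
  infinite then so is the horizon. In either case \<open>e\<close> lies below the horizon, safety
  persists up to \<open>e\<close> while the agents rest, and the message links connect all
  agents.\<close>

lemma election_succeeds:
  assumes el: "elect \<rho> k = election_time S (position \<rho>) (ereal e)"
    and a: "0 \<le> a" "a \<le> e" "\<forall>t\<in>{0..a}. safe_at t"
    and rest: "\<And>t i. a < t \<Longrightarrow> ereal t < elect \<rho> k \<Longrightarrow> i \<in> A \<Longrightarrow> input \<rho> i t = 0"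
  shows "elect \<rho> k = ereal e \<and> (\<forall>t\<in>{0..e}. safe_at t)"
proof -
  have le: "ereal e \<le> elect \<rho> k" unfolding el by (rule election_time_ge)
  have dom: "ereal e < horizon \<rho>"
  proof (cases "elect \<rho> k < \<infinity>")
    case True
    then show ?thesis using elect_less_horizon le le_less_trans by blast
  next
    case False
    then show ?thesis using elect_le_horizon[of k] by auto
  qed
  have S: "safe_at t" if "a \<le> t" "t \<le> e" for t
  proof (rule safe_at_rest[OF a(1) dom])
    show "input \<rho> i t = 0" if "a < t" "t < e" "i \<in> A" for t i
      using that le by (intro rest) (auto intro: less_le_trans[of "ereal t" "ereal e"])
  qed (use a that in auto)
  have "connected_graph A (message_links S (position \<rho>) e)"
    using S[of e] a safe_message_links by (simp add: safe_at_def)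
  then have "elect \<rho> k = ereal e" by (simp add: el election_time_def)
  then show ?thesis using S a by (metis atLeastAtMost_iff linear)
qed

lemma goal_region:
  assumes "elect \<rho> k < \<infinity>"
  shows "goal S pick \<rho> k \<in> {1..num_regions S (leader \<rho> k)}"
    and "round_service S \<rho> k \<in> labelling S (leader \<rho> k) (region S (leader \<rho> k) (goal S pick \<rho> k))"
    and "round_service S \<rho> k \<in> services S (leader \<rho> k)"
    and "cball (centre S (leader \<rho> k) (goal S pick \<rho> k)) (min_radius S) \<subseteq>
      region S (leader \<rho> k) (goal S pick \<rho> k)"
proof -
  have l: "leader \<rho> k \<in> A" using leader_agent assms by blast
  have "round_service S \<rho> k \<in> range (plan S (leader \<rho> k))"
    by (simp add: round_service_def next_service_def)
  then show 1: "goal S pick \<rho> k \<in> {1..num_regions S (leader \<rho> k)}"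
    and "round_service S \<rho> k \<in> labelling S (leader \<rho> k) (region S (leader \<rho> k) (goal S pick \<rho> k))"
    and "round_service S \<rho> k \<in> services S (leader \<rho> k)"
    using pick l plan_range[OF l] unfolding goal_selection_def goal_def by blast+
  have "min_radius S \<le> region_radius S (leader \<rho> k) (goal S pick \<rho> k)"
    using mas l 1 unfolding multi_agent_system_def by blast
  then show "cball (centre S (leader \<rho> k) (goal S pick \<rho> k)) (min_radius S) \<subseteq>
      region S (leader \<rho> k) (goal S pick \<rho> k)"
    by (auto simp: region_def)
qed

lemma team_agents:
  assumes "elect \<rho> k < \<infinity>"
  shows "team S \<rho> k \<subseteq> A" and "leader \<rho> k \<notin> cooperators S (leader \<rho> k) (snd (round_service S \<rho> k))"
    and "snd (round_service S \<rho> k) \<in> {1..num_services S (leader \<rho> k)}"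
    and "round_service S \<rho> k = (leader \<rho> k, snd (round_service S \<rho> k))"
proof -
  have l: "leader \<rho> k \<in> A" using leader_agent assms by blast
  show h: "snd (round_service S \<rho> k) \<in> {1..num_services S (leader \<rho> k)}"
    and "round_service S \<rho> k = (leader \<rho> k, snd (round_service S \<rho> k))"
    using goal_region(3)[OF assms] by (auto simp: services_def)
  have "cooperators S (leader \<rho> k) (snd (round_service S \<rho> k)) \<subseteq> A - {leader \<rho> k}"
    using mas l h unfolding multi_agent_system_def by blast
  then show "team S \<rho> k \<subseteq> A" and "leader \<rho> k \<notin> cooperators S (leader \<rho> k) (snd (round_service S \<rho> k))"
    using l by (auto simp: team_def)
qed

lemma input_ctrl:
  assumes "i \<in> A" "elect \<rho> k \<le> ereal t" "ereal t < serve \<rho> k"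
  shows "input \<rho> i t = ctrl (edges \<rho> t) (leader \<rho> k) (centre S (leader \<rho> k) (goal S pick \<rho> k))
    (\<lambda>i. position \<rho> i t) i"
  using input_feedback[OF assms] by (simp add: feedback_def ctrl_def Let_def)

text \<open>A round that never ends would make the horizon infinite and keep the controller on
  forever, and then \<open>goal_reached\<close> produces an instant that completes the
  round.\<close>

lemma service_finite:
  assumes el: "elect \<rho> k = ereal a" and safe: "safe_at a"
  shows "serve \<rho> k < \<infinity>"
proof (rule ccontr)
  let ?c = "centre S (leader \<rho> k) (goal S pick \<rho> k)"
  assume "\<not> ?thesis"
  then have inf: "serve \<rho> k = \<infinity>" by simp
  then have T: "horizon \<rho> = \<infinity>" using serve_le_elect[of k] elect_le_horizon[of "Suc k"] by auto
  have fin: "elect \<rho> k < \<infinity>" using el by simp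
  have "0 \<le> a" using elect_nonneg[of k] el by simp
  have "\<exists>t\<ge>a. safe (\<lambda>i. position \<rho> i t) (edges \<rho> t) \<and>
      (\<forall>i\<in>A. position \<rho> i t \<in> cball ?c (min_radius S))"
  proof (rule goal_reached)
    show "hybrid a \<infinity> (position \<rho>) (edges \<rho>) (input \<rho>)"
      using hybrid_restrict[OF hybrid_run \<open>0 \<le> a\<close> order_refl] T by simp
    show "leader \<rho> k \<in> A" using leader_agent[OF fin] .
    show "input \<rho> i t = ctrl (edges \<rho> t) (leader \<rho> k) ?c (\<lambda>i. position \<rho> i t) i"
      if "a < t" "i \<in> A" for t i
      using input_ctrl[OF that(2), of k t] that(1) el inf by simp
  qed (use safe radius_bounds in \<open>auto simp: safe_at_def\<close>)
  then obtain t where t: "a \<le> t" "safe (\<lambda>i. position \<rho> i t) (edges \<rho> t)"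
    "\<forall>i\<in>A. position \<rho> i t \<in> cball ?c (min_radius S)" by blast
  have "serve \<rho> k \<le> ereal t" unfolding serve_Inf
  proof (rule Inf_lower, rule imageI, rule CollectI, intro conjI ballI)
    show "elect \<rho> k \<le> ereal t" using el t by simp
    fix i assume "i \<in> team S \<rho> k"
    then have i: "i \<in> A" using team_agents[OF fin] by blast
    show "position \<rho> i t \<in> region S (leader \<rho> k) (goal S pick \<rho> k)"
      using t(3) goal_region(4)[OF fin] i by blast
    show "(leader \<rho> k, i) \<in> (message_links S (position \<rho>) t)\<^sup>*"
      using safe_message_links[where x = "position \<rho>", OF t(2)] i leader_agent[OF fin] by (auto simp: connected_graph_def)
  qed
  then show False using inf by simp
qed

text \<open>Finiteness and safety go through the induction together: safety at an election makes the
  service happen, and finiteness of the service time carries safety to the next election.\<close>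

lemma rounds_complete:
  "\<exists>e. elect \<rho> k = ereal e \<and> (\<forall>t\<in>{0..e}. safe_at t) \<and>
    (\<exists>s. serve \<rho> k = ereal s \<and> (\<forall>t\<in>{0..s}. safe_at t))"
proof -
  have round: "\<exists>s. serve \<rho> k = ereal s \<and> (\<forall>t\<in>{0..s}. safe_at t)"
    if e: "elect \<rho> k = ereal e" "\<forall>t\<in>{0..e}. safe_at t" for k e
  proof -
    have "0 \<le> e" using elect_nonneg[of k] e(1) by simp
    then have se: "safe_at e" using e(2) by simp
    have fin: "serve \<rho> k < \<infinity>" by (rule service_finite[OF e(1) se])
    moreover have "ereal e \<le> serve \<rho> k" using elect_le_serve[of k] e(1) by simp
    ultimately obtain s where s: "serve \<rho> k = ereal s" "e \<le> s"
      by (cases "serve \<rho> k") auto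
    have "safe_at t" if "e \<le> t" "t \<le> s" for t
    proof (rule safe_at_preserved[OF \<open>0 \<le> e\<close> _ se, where mu = 1])
      show "ereal s < horizon \<rho>" using serve_less_horizon[OF fin] s by simp
      show "leader \<rho> k \<in> A" using leader_agent e(1) by simp
      show "input \<rho> i t = 1 *\<^sub>R ctrl (edges \<rho> t) (leader \<rho> k)
          (centre S (leader \<rho> k) (goal S pick \<rho> k)) (\<lambda>i. position \<rho> i t) i"
        if "e < t" "t < s" "i \<in> A" for t i
        using input_ctrl[OF that(3), of k t] that s e by simp
    qed (use that in auto)
    then show ?thesis using s e(2) by (metis atLeastAtMost_iff linear)
  qed
  have "\<exists>e. elect \<rho> k = ereal e \<and> (\<forall>t\<in>{0..e}. safe_at t)"
  proof (induction k)
    case 0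
    have "elect \<rho> 0 = ereal ready \<and> (\<forall>t\<in>{0..ready}. safe_at t)"
      using elect_0 ready_nonneg safe_at_0 input_before
      by (intro election_succeeds[where a = 0]) auto
    then show ?case by blast
  next
    case (Suc k)
    then obtain s where s: "serve \<rho> k = ereal s" "\<forall>t\<in>{0..s}. safe_at t" using round by blast
    have "0 \<le> s" using elect_nonneg[of k] elect_le_serve[of k] s(1)
      by (metis ereal_less_eq(5) order_trans)
    have "elect \<rho> (Suc k) = ereal (s + delay k) \<and> (\<forall>t\<in>{0..s + delay k}. safe_at t)"
      using elect_Suc[of k] s delay_nonneg[of k] \<open>0 \<le> s\<close> input_rest[of _ k]
      by (intro election_succeeds[where a = s]) auto
    then show ?case by blast
  qed
  then show ?thesis using round by blast
qed

section \<open>Service times\<close>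

definition sv :: "nat \<Rightarrow> real" where "sv k = real_of_ereal (serve \<rho> k)"

lemma serve_sv: "serve \<rho> k = ereal (sv k)" and elect_finite: "elect \<rho> k < \<infinity>"
  using rounds_complete[of k] by (auto simp: sv_def)

lemma sv_mono: "k \<le> m \<Longrightarrow> sv k \<le> sv m"
  using serve_mono[of k m] by (simp add: serve_sv)

lemma sv_nonneg: "0 \<le> sv k"
  using order_trans[OF elect_nonneg elect_le_serve, of k] by (simp add: serve_sv)

lemma sv_less_horizon: "ereal (sv k) < horizon \<rho>"
  using serve_less_horizon[of k] by (simp add: serve_sv)

lemma sv_strict: "k < m \<Longrightarrow> i \<in> team S \<rho> k \<Longrightarrow> i \<in> team S \<rho> m \<Longrightarrow> sv k < sv m"
  using disjoint_teams[of k m] sv_mono[of k m] by (force simp: serve_sv)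

text \<open>Attainment of the infimum defining \<open>serve\<close>: the region is closed and the
  motion continuous from the right, so an agent outside at \<open>sv k\<close> would stay outside
  for a while and delay the infimum.\<close>

lemma served_in_region:
  assumes "i \<in> team S \<rho> k"
  shows "position \<rho> i (sv k) \<in> region S (leader \<rho> k) (goal S pick \<rho> k)"
proof (rule ccontr)
  let ?R = "region S (leader \<rho> k) (goal S pick \<rho> k)"
  let ?Q = "{t. elect \<rho> k \<le> ereal t \<and> (\<forall>i\<in>team S \<rho> k. position \<rho> i t \<in> ?R \<and>
    (leader \<rho> k, i) \<in> (message_links S (position \<rho>) t)\<^sup>*)}"
  assume out: "position \<rho> i (sv k) \<notin> ?R"
  have "i \<in> A" using assms team_agents(1)[OF elect_finite] by blast
  have "(position \<rho> i \<longlongrightarrow> position \<rho> i (sv k)) (at_right (sv k))"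
    by (rule hybrid_tendsto(1)[OF hybrid_run \<open>i \<in> A\<close> sv_nonneg sv_less_horizon])
  moreover have "open (- ?R)" by (auto simp: region_def)
  ultimately have "\<forall>\<^sub>F t in at_right (sv k). position \<rho> i t \<in> - ?R"
    using out by (intro topological_tendstoD) auto
  then obtain d where d: "sv k < d" "\<And>t. sv k < t \<Longrightarrow> t < d \<Longrightarrow> position \<rho> i t \<notin> ?R"
    by (auto simp: eventually_at_right_field)
  have "ereal d \<le> serve \<rho> k" unfolding serve_Inf
  proof (rule Inf_greatest)
    fix q assume "q \<in> ereal ` ?Q"
    then obtain t where t: "q = ereal t" "t \<in> ?Q" by blast
    have "serve \<rho> k \<le> ereal t" unfolding serve_Inf using t(2) by (intro Inf_lower) auto
    then have "sv k \<le> t" by (simp add: serve_sv)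
    moreover have "position \<rho> i t \<in> ?R" using t(2) assms by blast
    ultimately have "d \<le> t" using d(2)[of t] out by (cases "t = sv k") force+
    then show "ereal d \<le> q" using t(1) by simp
  qed
  then show False using d(1) by (simp add: serve_sv)
qed

section \<open>Fairness of the elections\<close>

definition led :: "nat \<Rightarrow> nat set" where "led i = {k. leader \<rho> k = i}"

definition acted :: "nat \<Rightarrow> nat set" where "acted i = {k. i \<in> team S \<rho> k}"

lemma last_served_le: "last_served \<rho> i k \<le> sv k"
proof (induction k)
  case (Suc k)
  then show ?case using sv_mono[of k "Suc k"] by (auto simp: sv_def)
qed (simp add: sv_nonneg)

lemma last_served_ge: "leader \<rho> k = i \<Longrightarrow> k < m \<Longrightarrow> sv k \<le> last_served \<rho> i m"
proof (induction m)
  case (Suc m)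
  show ?case
  proof (cases "leader \<rho> m = i")
    case True
    then show ?thesis using sv_mono[of k m] Suc.prems by (simp add: sv_def)
  next
    case False
    then have "k < m" using Suc.prems by (metis less_antisym)
    then show ?thesis using False Suc by simp
  qed
qed simp

text \<open>An agent that no longer leads keeps its last service time \<open>c\<close>, so whoever leads instead was
  last served at time \<open>c\<close> or earlier. Hence every agent leads at most once after time \<open>c\<close>.\<close>
lemma infinite_led:
  assumes "i \<in> A"
  shows "infinite (led i)"
proof
  assume "finite (led i)"
  then obtain K where K: "\<And>k. k \<in> led i \<Longrightarrow> k < K"
    using finite_nat_set_iff_bounded[of "led i"] by auto
  define c where "c = last_served \<rho> i K"
  have const: "last_served \<rho> i k = c" if "K \<le> k" for k
    using that
  proof (induction k rule: dec_induct)
    case (step k)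
    then have "leader \<rho> k \<noteq> i" using K[of k] by (auto simp: led_def)
    then show ?case using step by simp
  qed (simp add: c_def)
  \<comment> \<open>Service times need not increase strictly, but only finitely many rounds share an
    instant, so some later round has \<open>sv m > sv K \<ge> c\<close>.\<close>
  have "finite {k. serve \<rho> k = serve \<rho> K}" by (intro serve_fibre_finite) (simp add: serve_sv)
  then have "\<not> {K..} \<subseteq> {k. serve \<rho> k = serve \<rho> K}" using infinite_Ici finite_subset by blast
  then obtain m where "K \<le> m" "sv m \<noteq> sv K" by (auto simp: serve_sv)
  then have m: "K \<le> m" "c < sv m"
    using sv_mono[of K m] last_served_le[of i K] by (auto simp: c_def)
  \<comment> \<open>All urges in one election carry the same time stamp, so a larger urge means an
    earlier or equal last service.\<close>
  have early: "last_served \<rho> (leader \<rho> k) k \<le> c" if "m \<le> k" for k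
  proof -
    have "k \<notin> led i" using K[of k] m(1) that by force
    then have "urge_less (urge \<rho> k i) (urge \<rho> k (leader \<rho> k))"
      using elect_finite assms by (intro leader_urge) (auto simp: led_def)
    then show ?thesis using const[of k] m(1) that by (auto simp: urge_less_def urge_def)
  qed
  \<comment> \<open>At a second lead after round \<open>m\<close> the agent's last service would be
    no earlier than \<open>sv m\<close>, contradicting \<open>early\<close>.\<close>
  have "inj_on (leader \<rho>) {m..}"
  proof (rule linorder_inj_onI)
    fix k k' assume "k < k'" "k \<in> {m..}" "k' \<in> {m..}"
    then have "last_served \<rho> (leader \<rho> k) k' \<ge> sv m"
      using last_served_ge[of k "leader \<rho> k" k'] sv_mono[of m k] by auto
    then show "leader \<rho> k \<noteq> leader \<rho> k'"
      using early[of k'] \<open>k' \<in> {m..}\<close> m(2) by auto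
  qed auto
  moreover have "leader \<rho> ` {m..} \<subseteq> A" using leader_agent[OF elect_finite] by auto
  ultimately show False using finite_A infinite_Ici by (meson finite_imageD finite_subset)
qed

lemma led_subset_acted: "led i \<subseteq> acted i"
  using leader_in_team by (auto simp: led_def acted_def)

lemma infinite_acted: "i \<in> A \<Longrightarrow> infinite (acted i)"
  using infinite_led led_subset_acted finite_subset by blast

lemma sv_enumerate_strict_mono:
  assumes "infinite K" "K \<subseteq> acted i"
  shows "strict_mono (\<lambda>n. sv (enumerate K n))"
proof (rule strict_monoI)
  fix n m :: nat assume "n < m"
  then have "enumerate K n < enumerate K m" by (rule enumerate_mono[OF _ assms(1)])
  moreover have "enumerate K n \<in> K" "enumerate K m \<in> K" by (rule enumerate_in_set[OF assms(1)])+
  ultimately show "sv (enumerate K n) < sv (enumerate K m)"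
    using assms(2) by (intro sv_strict[of _ _ i]) (auto simp: acted_def)
qed

text \<open>The plan index counts the rounds that the agent has led before.\<close>

lemma plan_index_enumerate:
  assumes "infinite (led i)"
  shows "plan_index \<rho> i (enumerate (led i) n) = n"
proof -
  have count: "plan_index \<rho> i k = card {m \<in> led i. m < k}" for k
  proof (induction k)
    case (Suc k)
    have "{m \<in> led i. m < Suc k} = (if leader \<rho> k = i then {k} else {}) \<union> {m \<in> led i. m < k}"
      by (auto simp: led_def less_Suc_eq)
    then show ?case using Suc by simp
  qed simp
  have "{m \<in> led i. m < enumerate (led i) n} = enumerate (led i) ` {..<n}"
  proof (intro equalityI subsetI)
    fix m assume m: "m \<in> {m \<in> led i. m < enumerate (led i) n}"
    then obtain n' where "m = enumerate (led i) n'"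
      using range_enumerate[OF assms] by (metis (no_types, lifting) CollectD imageE)
    then show "m \<in> enumerate (led i) ` {..<n}"
      using m enumerate_mono_iff[OF assms] by auto
  next
    fix m assume "m \<in> enumerate (led i) ` {..<n}"
    then show "m \<in> {m \<in> led i. m < enumerate (led i) n}"
      using enumerate_in_set[OF assms] enumerate_mono[OF _ assms] by auto
  qed
  moreover have "inj (enumerate (led i))" using strict_mono_enumerate[OF assms] strict_mono_imp_inj_on by blast
  ultimately show ?thesis by (simp add: count card_image inj_on_subset)
qed

section \<open>The trace of a run\<close>

text \<open>A trace is indexed by time and a run by rounds; this inverts \<open>sv\<close> on the
  rounds in which agent \<open>i\<close> acts, where \<open>sv_strict\<close> makes it
  injective.\<close>

definition service_round :: "nat \<Rightarrow> real \<Rightarrow> nat" where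
  "service_round i t = (SOME k. sv k = t \<and> k \<in> acted i)"

lemma service_round:
  assumes "k \<in> acted i"
  shows "service_round i (sv k) = k"
  unfolding service_round_def
proof (rule some_equality)
  fix m assume "sv m = sv k \<and> m \<in> acted i"
  then show "m = k"
    using sv_strict[of m k i] sv_strict[of k m i] assms by (cases m k rule: linorder_cases) (auto simp: acted_def)
qed (use assms in simp)

definition \<theta> :: "nat \<Rightarrow> trace" where
  "\<theta> i = \<lparr> traj = position \<rho> i,
     action_times = (\<lambda>n. sv (enumerate (acted i) n)),
     action_at = (\<lambda>t. round_action S \<rho> (service_round i t) i),
     service_times = (\<lambda>n. sv (enumerate (led i) n)),
     service_at = (\<lambda>t. round_service S \<rho> (service_round i t)) \<rparr>"

lemma range_times:
  assumes "i \<in> A"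
  shows "range (action_times (\<theta> i)) = sv ` acted i" "range (service_times (\<theta> i)) = sv ` led i"
proof -
  have "range (action_times (\<theta> i)) = sv ` range (enumerate (acted i))"
    "range (service_times (\<theta> i)) = sv ` range (enumerate (led i))"
    by (simp_all add: \<theta>_def image_image)
  then show "range (action_times (\<theta> i)) = sv ` acted i" "range (service_times (\<theta> i)) = sv ` led i"
    using range_enumerate[OF infinite_acted[OF assms]] range_enumerate[OF infinite_led[OF assms]]
    by simp_all
qed

lemma trace_resulting: "i \<in> A \<Longrightarrow> resulting_trace S \<rho> i (\<theta> i)"
  unfolding resulting_trace_def
proof (intro conjI allI impI)
  assume i: "i \<in> A"
  show "strict_mono (action_times (\<theta> i))" "strict_mono (service_times (\<theta> i))"
    using sv_enumerate_strict_mono[OF infinite_acted[OF i], of i]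
      sv_enumerate_strict_mono[OF infinite_led[OF i], of i] led_subset_acted by (simp_all add: \<theta>_def)
  show "range (action_times (\<theta> i)) = {t. \<exists>k. serve \<rho> k = ereal t \<and> i \<in> team S \<rho> k}"
    using range_times(1)[OF i] by (auto simp: serve_sv acted_def)
  show "range (service_times (\<theta> i)) = {t. \<exists>k. serve \<rho> k = ereal t \<and> i = leader \<rho> k}"
    using range_times(2)[OF i] by (auto simp: serve_sv led_def)
  show "action_at (\<theta> i) t = round_action S \<rho> k i"
    if "serve \<rho> k = ereal t \<and> i \<in> team S \<rho> k" for k t
    using service_round[of k i] that by (auto simp: \<theta>_def serve_sv acted_def)
  show "service_at (\<theta> i) t = round_service S \<rho> k"
    if "serve \<rho> k = ereal t \<and> i = leader \<rho> k" for k t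
    using service_round[of k i] that leader_in_team by (auto simp: \<theta>_def serve_sv acted_def)
qed (simp add: \<theta>_def)

lemma action_at_sv:
  "k \<in> acted i \<Longrightarrow> action_at (\<theta> i) (sv k) = round_action S \<rho> k i"
  "k \<in> acted i \<Longrightarrow> service_at (\<theta> i) (sv k) = round_service S \<rho> k"
  using service_round by (simp_all add: \<theta>_def)

lemma cooperator_acted:
  "j \<in> cooperators S (leader \<rho> k) (snd (round_service S \<rho> k)) \<Longrightarrow> k \<in> acted j \<and> j \<noteq> leader \<rho> k"
  using team_agents(2)[OF elect_finite] by (auto simp: acted_def team_def)

lemma trace_valid:
  assumes i: "i \<in> A"
  shows "valid_trace S (horizon \<rho>) (input \<rho>) \<theta> i"
  unfolding valid_trace_def Let_def
proof (intro conjI allI)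
  note res = trace_resulting[OF i, unfolded resulting_trace_def]
  show "trajectory (horizon \<rho>) (init_pos S i) (input \<rho> i) (traj (\<theta> i))"
    using trajectories[OF i] by (simp add: \<theta>_def)
  show "strict_mono (action_times (\<theta> i))" using res by blast
  fix n
  have n: "enumerate (acted i) n \<in> acted i" by (rule enumerate_in_set[OF infinite_acted[OF i]])
  show "0 \<le> action_times (\<theta> i) n" "ereal (action_times (\<theta> i) n) < horizon \<rho>"
    using sv_nonneg sv_less_horizon by (simp_all add: \<theta>_def)
  have "round_action S \<rho> k i \<in> actions S i" if k: "k \<in> acted i" for k
  proof -
    have l: "leader \<rho> k \<in> A" and h: "snd (round_service S \<rho> k) \<in> {1..num_services S (leader \<rho> k)}"
      using leader_agent[OF elect_finite] team_agents(3)[OF elect_finite] by auto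
    have "Provide (leader \<rho> k) (snd (round_service S \<rho> k)) \<in> actions S (leader \<rho> k)"
      "\<forall>j\<in>cooperators S (leader \<rho> k) (snd (round_service S \<rho> k)).
        Cooperate j (leader \<rho> k) (snd (round_service S \<rho> k)) \<in> actions S j"
      using mas l h unfolding multi_agent_system_def by blast+
    then show ?thesis using k by (auto simp: round_action_def Let_def acted_def team_def)
  qed
  then show "action_at (\<theta> i) (action_times (\<theta> i) n) \<in> actions S i"
    using action_at_sv(1)[OF n] n by (simp add: \<theta>_def)
next
  \<comment> \<open>The place of the n-th led round in the enumeration of all rounds in which the
    agent acts.\<close>
  let ?f = "\<lambda>n. inv_into UNIV (enumerate (acted i)) (enumerate (led i) n)"
  have f: "enumerate (acted i) (?f n) = enumerate (led i) n" for n
  proof (rule f_inv_into_f)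
    show "enumerate (led i) n \<in> range (enumerate (acted i))"
      using range_enumerate[OF infinite_acted[OF i]] enumerate_in_set[OF infinite_led[OF i]]
        led_subset_acted by blast
  qed
  have "strict_mono ?f"
  proof (rule strict_monoI)
    fix n m :: nat assume "n < m"
    then have "enumerate (acted i) (?f n) < enumerate (acted i) (?f m)"
      using enumerate_mono[OF _ infinite_led[OF i]] by (simp only: f)
    then show "?f n < ?f m" using enumerate_mono_iff[OF infinite_acted[OF i]] by blast
  qed
  moreover have "service_times (\<theta> i) = action_times (\<theta> i) \<circ> ?f"
    by (simp add: \<theta>_def fun_eq_iff f)
  ultimately show "\<exists>f. strict_mono f \<and> service_times (\<theta> i) = action_times (\<theta> i) \<circ> f" by blast
next
  \<comment> \<open>An agent acts by \<open>Provide\<close> exactly when it leads and by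
    \<open>Cooperate\<close> otherwise, so the service-providing actions single out the led
    rounds.\<close>
  have "(\<exists>h. action_at (\<theta> i) (sv k) = Provide i h) \<longleftrightarrow> k \<in> led i" if "k \<in> acted i" for k
    using action_at_sv(1)[OF that] by (auto simp: round_action_def Let_def led_def)
  then show "range (service_times (\<theta> i)) =
      {t \<in> range (action_times (\<theta> i)). \<exists>h. action_at (\<theta> i) t = Provide i h}"
    using led_subset_acted unfolding range_times[OF i] by blast
next
  fix n
  define k where "k = enumerate (led i) n"
  have k: "k \<in> led i" unfolding k_def by (rule enumerate_in_set[OF infinite_led[OF i]])
  then have ka: "k \<in> acted i" and l: "leader \<rho> k = i" using led_subset_acted by (auto simp: led_def)
  have t: "service_times (\<theta> i) n = sv k" by (simp add: \<theta>_def k_def)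
  note at = action_at_sv[OF ka]
  show "service_at (\<theta> i) (service_times (\<theta> i) n) \<in> services S i"
    using goal_region(3)[OF elect_finite, of k] l t at by simp
  show "\<exists>g\<in>{1..num_regions S i}.
      traj (\<theta> i) (service_times (\<theta> i) n) \<in> region S i g \<and>
      service_at (\<theta> i) (service_times (\<theta> i) n) \<in> labelling S i (region S i g) \<and>
      (\<forall>h. service_at (\<theta> i) (service_times (\<theta> i) n) = (i, h) \<longrightarrow>
        action_at (\<theta> i) (service_times (\<theta> i) n) = Provide i h \<and>
        (\<forall>j\<in>cooperators S i h.
          traj (\<theta> j) (service_times (\<theta> i) n) \<in> region S i g \<and>
          service_times (\<theta> i) n \<in> range (action_times (\<theta> j)) \<and>
          action_at (\<theta> j) (service_times (\<theta> i) n) = Cooperate j i h))"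
    unfolding t at
  proof (intro bexI[of _ "goal S pick \<rho> k"] conjI allI impI ballI)
    show "traj (\<theta> i) (sv k) \<in> region S i (goal S pick \<rho> k)"
      using served_in_region[OF leader_in_team, of k] l by (simp add: \<theta>_def)
    show "round_service S \<rho> k \<in> labelling S i (region S i (goal S pick \<rho> k))"
      and "goal S pick \<rho> k \<in> {1..num_regions S i}"
      using goal_region(1,2)[OF elect_finite, of k] l by auto
    fix h assume h: "round_service S \<rho> k = (i, h)"
    show "round_action S \<rho> k i = Provide i h" using l h by (simp add: round_action_def)
    fix j assume "j \<in> cooperators S i h"
    then have j: "k \<in> acted j" "j \<noteq> leader \<rho> k" using cooperator_acted[of j k] h l by auto
    then have "j \<in> A" using team_agents(1)[OF elect_finite, of k] by (auto simp: acted_def)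
    show "traj (\<theta> j) (sv k) \<in> region S i (goal S pick \<rho> k)"
      using served_in_region[of j k] j l by (simp add: \<theta>_def acted_def)
    show "sv k \<in> range (action_times (\<theta> j))" using range_times(1)[OF \<open>j \<in> A\<close>] j by auto
    show "action_at (\<theta> j) (sv k) = Cooperate j i h"
      using action_at_sv(1)[OF j(1)] j l h by (simp add: round_action_def)
  qed
qed

lemma trace_satisfies:
  assumes i: "i \<in> A"
  shows "satisfies (\<theta> i) (task S i)"
proof -
  have "service_at (\<theta> i) (service_times (\<theta> i) n) = plan S i n" for n
  proof -
    define k where "k = enumerate (led i) n"
    have k: "k \<in> led i" unfolding k_def by (rule enumerate_in_set[OF infinite_led[OF i]])
    then have "service_at (\<theta> i) (sv k) = round_service S \<rho> k"
      using led_subset_acted by (intro action_at_sv) blast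
    also have "\<dots> = plan S i (plan_index \<rho> i k)"
      using k by (simp add: round_service_def next_service_def led_def)
    also have "plan_index \<rho> i k = n"
      unfolding k_def by (rule plan_index_enumerate[OF infinite_led[OF i]])
    finally show ?thesis by (simp add: \<theta>_def k_def)
  qed
  moreover have "models (plan S i) (task S i)"
    using mas i by (simp add: multi_agent_system_def)
  ultimately show ?thesis by (simp add: satisfies_def)
qed

end

section \<open>Existence of runs\<close>

text \<open>The fields \<open>stage_last\<close> and \<open>stage_index\<close> store what
  \<open>last_served\<close> and \<open>plan_index\<close> accumulate over earlier rounds, so that
  each stage can be chosen from its predecessor alone.\<close>

record stage =
  stage_elect :: real
  stage_serve :: real
  stage_leader :: nat
  stage_last :: "nat \<Rightarrow> real"
  stage_index :: "nat \<Rightarrow> nat"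
  stage_pos :: "nat \<Rightarrow> real \<Rightarrow> real^2"
  stage_edges :: "real \<Rightarrow> (nat \<times> nat) set"
  stage_input :: "nat \<Rightarrow> real \<Rightarrow> real^2"

context agent_network begin

lemma urge_maximal:
  fixes v :: "nat \<Rightarrow> real"
  shows "\<exists>l\<in>A. \<forall>j\<in>A - {l}. urge_less (v j, j) (v l, l)"
proof -
  define m where "m = Max (v ` A)"
  define l where "l = Max {i \<in> A. v i = m}"
  have "m \<in> v ` A" unfolding m_def using A_nonempty by (intro Max_in) auto
  then have ne: "{i \<in> A. v i = m} \<noteq> {}" by auto
  have l: "l \<in> {i \<in> A. v i = m}" unfolding l_def by (rule Max_in[OF _ ne]) simp
  have "urge_less (v j, j) (v l, l)" if "j \<in> A - {l}" for j
  proof -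
    have "v j \<le> m" unfolding m_def using that by (intro Max_ge) auto
    moreover have "j \<le> l" if "v j = m" unfolding l_def using that \<open>j \<in> A - {l}\<close> by (intro Max_ge) auto
    ultimately show ?thesis using l that by (auto simp: urge_less_def less_le)
  qed
  then show ?thesis using l by blast
qed

definition stage_service :: "stage \<Rightarrow> service" where
  "stage_service \<sigma> = plan S (stage_leader \<sigma>) (stage_index \<sigma> (stage_leader \<sigma>))"

definition stage_team :: "stage \<Rightarrow> nat set" where
  "stage_team \<sigma> = insert (stage_leader \<sigma>) (cooperators S (stage_leader \<sigma>) (snd (stage_service \<sigma>)))"

definition stage_goal :: "(nat \<Rightarrow> nat \<Rightarrow> service \<Rightarrow> nat) \<Rightarrow> nat \<Rightarrow> stage \<Rightarrow> nat" where
  "stage_goal pick k \<sigma> = pick k (stage_leader \<sigma>) (stage_service \<sigma>)"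

text \<open>A stage describes a run up to the end of round \<open>k\<close>, after which the agents rest forever.\<close>
definition stage_ok :: "(nat \<Rightarrow> nat \<Rightarrow> service \<Rightarrow> nat) \<Rightarrow> nat \<Rightarrow> stage \<Rightarrow> bool" where
  "stage_ok pick k \<sigma> \<longleftrightarrow>
    (let e = stage_elect \<sigma>; s = stage_serve \<sigma>; l = stage_leader \<sigma>; x = stage_pos \<sigma>;
       E = stage_edges \<sigma>; u = stage_input \<sigma>; g = stage_goal pick k \<sigma> in
     0 \<le> e \<and> e \<le> s \<and> l \<in> A \<and>
     (\<forall>j\<in>A - {l}. urge_less (e - stage_last \<sigma> j, j) (e - stage_last \<sigma> l, l)) \<and>
     hybrid 0 \<infinity> x E u \<and> (\<forall>t. E t \<subseteq> pairs) \<and> (\<forall>t\<ge>e. safe (\<lambda>i. x i t) (E t)) \<and>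
     stage_team \<sigma> \<subseteq> A \<and>
     (\<forall>i\<in>stage_team \<sigma>. x i s \<in> region S l g) \<and>
     (\<forall>t. e \<le> t \<and> t < s \<longrightarrow> (\<exists>i\<in>stage_team \<sigma>. x i t \<notin> region S l g)) \<and>
     (\<forall>t i. e \<le> t \<and> t < s \<and> i \<in> A \<longrightarrow> u i t = ctrl (E t) l (centre S l g) (\<lambda>j. x j t) i) \<and>
     (\<forall>t i. s \<le> t \<longrightarrow> u i t = 0))"

text \<open>At the election instant itself positions and graph agree but inputs need not, since the
  controller may be switched on there.\<close>

definition extends ::
  "(nat \<Rightarrow> real \<Rightarrow> real^2) \<Rightarrow> (real \<Rightarrow> (nat \<times> nat) set) \<Rightarrow> (nat \<Rightarrow> real \<Rightarrow> real^2) \<Rightarrow> stage \<Rightarrow> bool"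
  where "extends x E u \<sigma> \<longleftrightarrow>
    (\<forall>t<stage_elect \<sigma>. (\<forall>i. stage_pos \<sigma> i t = x i t \<and> stage_input \<sigma> i t = u i t) \<and> stage_edges \<sigma> t = E t) \<and>
    (\<forall>i. stage_pos \<sigma> i (stage_elect \<sigma>) = x i (stage_elect \<sigma>)) \<and>
    stage_edges \<sigma> (stage_elect \<sigma>) = E (stage_elect \<sigma>)"

lemma new_stage:
  assumes pick: "goal_selection S pick"
    and h: "hybrid 0 \<infinity> x E u" and safe: "safe (\<lambda>i. x i e) (E e)" and "0 \<le> e"
    and E: "\<And>t. E t \<subseteq> pairs"
  shows "\<exists>\<sigma>. stage_ok pick k \<sigma> \<and> stage_elect \<sigma> = e \<and> stage_last \<sigma> = la \<and> stage_index \<sigma> = ix \<and>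
    extends x E u \<sigma>"
proof -
  obtain l where l: "l \<in> A" "\<forall>j\<in>A - {l}. urge_less (e - la j, j) (e - la l, l)"
    using urge_maximal[of "\<lambda>j. e - la j"] by blast
  define sv where "sv = plan S l (ix l)"
  define g where "g = pick k l sv"
  define M where "M = insert l (cooperators S l (snd sv))"
  have sv: "sv \<in> range (plan S l)" by (simp add: sv_def)
  then have "sv \<in> services S l" using plan_range[OF l(1)] by blast
  then have "snd sv \<in> {1..num_services S l}" by (auto simp: services_def)
  then have "cooperators S l (snd sv) \<subseteq> A - {l}"
    using mas l(1) unfolding multi_agent_system_def by blast
  then have M: "M \<subseteq> A" using l(1) by (auto simp: M_def)
  have "g \<in> {1..num_regions S l}"
    using pick l(1) sv unfolding goal_selection_def g_def by blast
  then have "min_radius S \<le> region_radius S l g"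
    using mas l(1) unfolding multi_agent_system_def by blast
  then have R: "closed (region S l g)" "cball (centre S l g) (min_radius S) \<subseteq> region S l g"
    by (auto simp: region_def)
  show ?thesis
  proof (rule next_round[OF h safe \<open>0 \<le> e\<close> E l(1) R M], goal_cases)
    case n: (1 s x' E' u')
    let ?s = "\<lparr>stage_elect = e, stage_serve = s, stage_leader = l, stage_last = la, stage_index = ix,
      stage_pos = x', stage_edges = E', stage_input = u'\<rparr>"
    have "stage_service ?s = sv" "stage_team ?s = M" "stage_goal pick k ?s = g"
      by (simp_all add: stage_service_def stage_team_def stage_goal_def sv_def M_def g_def)
    then have "stage_ok pick k ?s"
      unfolding stage_ok_def Let_def using n l M \<open>0 \<le> e\<close> by simp
    moreover have "extends x E u ?s" unfolding extends_def using n by simp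
    ultimately show ?case by (intro exI[of _ ?s]) simp
  qed
qed

definition next_stage :: "(nat \<Rightarrow> real) \<Rightarrow> nat \<Rightarrow> stage \<Rightarrow> stage \<Rightarrow> bool" where
  "next_stage delay k \<sigma> \<sigma>' \<longleftrightarrow>
    stage_elect \<sigma>' = stage_serve \<sigma> + delay k \<and>
    stage_last \<sigma>' = (stage_last \<sigma>)(stage_leader \<sigma> := stage_serve \<sigma>) \<and>
    stage_index \<sigma>' = (stage_index \<sigma>)(stage_leader \<sigma> := Suc (stage_index \<sigma> (stage_leader \<sigma>))) \<and>
    extends (stage_pos \<sigma>) (stage_edges \<sigma>) (stage_input \<sigma>) \<sigma>'"

definition first_stage :: "real \<Rightarrow> stage \<Rightarrow> bool" where
  "first_stage ready \<sigma> \<longleftrightarrow> stage_elect \<sigma> = ready \<and> stage_last \<sigma> = (\<lambda>_. 0) \<and> stage_index \<sigma> = (\<lambda>_. 0) \<and>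
    extends (\<lambda>i t. init_pos S i) (\<lambda>_. initial_edges S) (\<lambda>_ _. 0) \<sigma>"

lemma stages_exist:
  assumes "0 \<le> ready" "\<And>k. 0 < delay k" and pick: "goal_selection S pick"
  shows "\<exists>f. (\<forall>k. stage_ok pick k (f k)) \<and> first_stage ready (f 0) \<and> (\<forall>k. next_stage delay k (f k) (f (Suc k)))"
proof -
  have "\<exists>\<sigma>. stage_ok pick 0 \<sigma> \<and> first_stage ready \<sigma>"
  proof -
    have "hybrid 0 \<infinity> (\<lambda>i t. init_pos S i) (\<lambda>_. initial_edges S) (\<lambda>_ _. 0)"
      by (rule hybrid_fixed_graph) (use safe_initial in \<open>auto simp: motion_def\<close>)
    from new_stage[OF pick this _ assms(1), of 0 "\<lambda>_. 0" "\<lambda>_. 0"] safe_initial safeD(1)[OF safe_initial]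
    show ?thesis unfolding first_stage_def by auto
  qed
  \<comment> \<open>Dependent choice works with one predicate for all indices, so the condition on
    the first stage is carried as an implication that is void from index 1 on.\<close>
  moreover have "\<exists>\<sigma>'. (stage_ok pick (Suc k) \<sigma>' \<and> (Suc k = 0 \<longrightarrow> first_stage ready \<sigma>')) \<and> next_stage delay k \<sigma> \<sigma>'"
    if "stage_ok pick k \<sigma> \<and> (k = 0 \<longrightarrow> first_stage ready \<sigma>)" for k \<sigma>
  proof -
    have d: "0 \<le> stage_serve \<sigma> + delay k" "stage_elect \<sigma> \<le> stage_serve \<sigma> + delay k"
      "hybrid 0 \<infinity> (stage_pos \<sigma>) (stage_edges \<sigma>) (stage_input \<sigma>)" "\<And>t. stage_edges \<sigma> t \<subseteq> pairs"
      "\<And>t. stage_elect \<sigma> \<le> t \<Longrightarrow> safe (\<lambda>i. stage_pos \<sigma> i t) (stage_edges \<sigma> t)"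
      using that assms(2)[of k] by (auto simp: stage_ok_def Let_def)
    show ?thesis
      using new_stage[OF pick d(3) d(5)[OF d(2)] d(1) d(4)] unfolding next_stage_def by blast
  qed
  ultimately have "\<exists>f. \<forall>k. (stage_ok pick k (f k) \<and> (k = 0 \<longrightarrow> first_stage ready (f k))) \<and>
      next_stage delay k (f k) (f (Suc k))"
    by (intro dependent_nat_choice) auto
  then show ?thesis by blast
qed

end

locale staged_run = agent_network S for S :: mas +
  fixes ready :: real and delay :: "nat \<Rightarrow> real" and pick :: "nat \<Rightarrow> nat \<Rightarrow> service \<Rightarrow> nat"
    and f :: "nat \<Rightarrow> stage"
  assumes ready_nonneg: "0 \<le> ready" and delay_pos: "\<And>k. 0 < delay k"
    and stages: "\<And>k. stage_ok pick k (f k)" and first: "first_stage ready (f 0)"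
    and steps: "\<And>k. next_stage delay k (f k) (f (Suc k))"
begin

section \<open>The run as the limit of its stages\<close>

abbreviation "e k \<equiv> stage_elect (f k)"
abbreviation "s k \<equiv> stage_serve (f k)"
abbreviation "x k \<equiv> stage_pos (f k)"
abbreviation "G k \<equiv> stage_edges (f k)"
abbreviation "u k \<equiv> stage_input (f k)"
abbreviation "l k \<equiv> stage_leader (f k)"

lemma stage_facts:
  shows "0 \<le> e k" "e k \<le> s k" "l k \<in> A"
    "\<And>j. j \<in> A - {l k} \<Longrightarrow> urge_less (e k - stage_last (f k) j, j) (e k - stage_last (f k) (l k), l k)"
    "hybrid 0 \<infinity> (x k) (G k) (u k)" "G k t \<subseteq> pairs" "\<And>t. e k \<le> t \<Longrightarrow> safe (\<lambda>i. x k i t) (G k t)"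
    "stage_team (f k) \<subseteq> A"
    "\<And>i. i \<in> stage_team (f k) \<Longrightarrow> x k i (s k) \<in> region S (l k) (stage_goal pick k (f k))"
    "\<And>t. e k \<le> t \<Longrightarrow> t < s k \<Longrightarrow>
      \<exists>i\<in>stage_team (f k). x k i t \<notin> region S (l k) (stage_goal pick k (f k))"
    "\<And>t i. e k \<le> t \<Longrightarrow> t < s k \<Longrightarrow> i \<in> A \<Longrightarrow>
      u k i t = ctrl (G k t) (l k) (centre S (l k) (stage_goal pick k (f k))) (\<lambda>j. x k j t) i"
    "\<And>t i. s k \<le> t \<Longrightarrow> u k i t = 0"
  using stages[of k] unfolding stage_ok_def Let_def by blast+

lemma e_Suc: "e (Suc k) = s k + delay k"
  using steps by (simp add: next_stage_def)

lemma s_less_e: "s k < e (Suc k)"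
  using e_Suc delay_pos by simp

lemma e_strict_mono: "k < m \<Longrightarrow> e k < e m"
  by (rule lift_Suc_mono_less[of e]) (use stage_facts(2) s_less_e le_less_trans in blast)+

lemma e_mono: "k \<le> m \<Longrightarrow> e k \<le> e m"
  using e_strict_mono[of k m] by (cases "k = m") auto

lemma s_strict_mono: "k < m \<Longrightarrow> s k < s m"
  using s_less_e[of k] e_mono[of "Suc k" m] stage_facts(2)[of m] by simp

lemma stages_agree:
  assumes "k \<le> m" "t < e (Suc k)"
  shows "x m i t = x k i t \<and> u m i t = u k i t \<and> G m t = G k t"
  using assms
proof (induction m rule: dec_induct)
  case (step m)
  then have "t < e (Suc m)" using e_mono[of "Suc k" "Suc m"] by simp
  then have "x (Suc m) i t = x m i t \<and> u (Suc m) i t = u m i t \<and> G (Suc m) t = G m t"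
    using steps[of m] by (simp add: next_stage_def extends_def)
  then show ?case using step by simp
qed simp

text \<open>Below the horizon this selects the first stage that is final at \<open>t\<close>. Beyond
  all elections the value is unspecified, but every stage keeps its graph inside
  \<open>pairs\<close> at all times.\<close>

definition J :: "real \<Rightarrow> nat" where "J t = (LEAST k. t < e (Suc k))"

definition \<rho> :: run where
  "\<rho> = \<lparr>position = (\<lambda>i t. x (J t) i t), edges = (\<lambda>t. G (J t) t), input = (\<lambda>i t. u (J t) i t),
    elect = (\<lambda>k. ereal (e k)), serve = (\<lambda>k. ereal (s k)), leader = l\<rparr>"

lemma at_stage:
  assumes "t < e (Suc k)"
  shows "position \<rho> i t = x k i t" "edges \<rho> t = G k t" "input \<rho> i t = u k i t"
proof -
  have "J t \<le> k" "t < e (Suc (J t))" unfolding J_def using assms by (auto intro: Least_le LeastI)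
  from stages_agree[OF this] show "position \<rho> i t = x k i t" "edges \<rho> t = G k t" "input \<rho> i t = u k i t"
    by (auto simp: \<rho>_def)
qed

lemma run_simps [simp]: "elect \<rho> k = ereal (e k)" "serve \<rho> k = ereal (s k)" "leader \<rho> k = l k"
  by (simp_all add: \<rho>_def)

lemma below_horizon:
  assumes "ereal t < horizon \<rho>"
  obtains k where "t < e (Suc k)"
proof -
  obtain k where "ereal t < ereal (e k)" using assms by (auto simp: horizon_def less_SUP_iff)
  then show thesis using that[of k] e_strict_mono[of k "Suc k"] by simp
qed

text \<open>Near each instant below the horizon the run coincides with a single stage, so the local
  conditions are inherited from it.\<close>

lemma hybrid_\<rho>: "hybrid 0 (horizon \<rho>) (position \<rho>) (edges \<rho>) (input \<rho>)"
  unfolding hybrid_iff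
proof (intro conjI allI impI ballI)
  fix t assume t: "0 \<le> t \<and> ereal t < horizon \<rho>"
  then obtain k where k: "t < e (Suc k)" using below_horizon by blast
  have "right_ok t (x k) (G k)" using stage_facts(5)[of k] t by (simp add: hybrid_iff)
  then show "right_ok t (position \<rho>) (edges \<rho>)"
    by (rule right_ok_cong[OF _ k]) (simp add: at_stage)
next
  fix t assume t: "0 < t \<and> ereal t < horizon \<rho>"
  then obtain k where k: "t < e (Suc k)" using below_horizon by blast
  have "left_ok t (x k) (G k)" using stage_facts(5)[of k] t by (simp add: hybrid_iff)
  then show "left_ok t (position \<rho>) (edges \<rho>)"
    by (rule left_ok_cong[of _ _ _ "t - 1"]) (use k in \<open>auto simp: at_stage[of _ k]\<close>)
next
  fix i b assume i: "i \<in> A" and "ereal b < horizon \<rho>"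
  then obtain k where k: "b < e (Suc k)" using below_horizon by blast
  have "{t. 0 < t \<and> t \<le> b \<and> \<not> (position \<rho> i has_vector_derivative input \<rho> i t) (at t)} \<subseteq>
      {t. 0 < t \<and> t \<le> b \<and> \<not> (x k i has_vector_derivative u k i t) (at t)}"
  proof
    fix t assume t: "t \<in> {t. 0 < t \<and> t \<le> b \<and> \<not> (position \<rho> i has_vector_derivative input \<rho> i t) (at t)}"
    then have tk: "t \<in> {t - 1<..<e (Suc k)}" using k by auto
    have "input \<rho> i t = u k i t" using tk by (simp add: at_stage)
    then show "t \<in> {t. 0 < t \<and> t \<le> b \<and> \<not> (x k i has_vector_derivative u k i t) (at t)}"
      using t deriv_cong[OF _ tk, of "x k i" "u k i t" "position \<rho> i"] at_stage(1)[of _ k] by auto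
  qed
  moreover have "finite {t. 0 < t \<and> t \<le> b \<and> \<not> (x k i has_vector_derivative u k i t) (at t)}"
    using stage_facts(5)[of k] i by (simp add: hybrid_iff)
  ultimately show "finite {t. 0 < t \<and> t \<le> b \<and> \<not> (position \<rho> i has_vector_derivative input \<rho> i t) (at t)}"
    by (rule finite_subset)
qed

lemma initial_state: "position \<rho> i 0 = init_pos S i" "edges \<rho> 0 = initial_edges S"
proof -
  have "0 < e (Suc 0)" using stage_facts(1)[of 0] e_strict_mono[of 0 1] by simp
  note at = at_stage[OF this]
  have "x 0 i 0 = init_pos S i" "G 0 0 = initial_edges S"
    using first stage_facts(1)[of 0] by (auto simp: first_stage_def extends_def less_le)
  then show "position \<rho> i 0 = init_pos S i" "edges \<rho> 0 = initial_edges S" by (simp_all add: at)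
qed

lemma election_ok: "e k \<le> t \<Longrightarrow> t < e (Suc k) \<Longrightarrow> connected_graph A (message_links S (position \<rho>) t)"
proof -
  assume t: "e k \<le> t" "t < e (Suc k)"
  have "message_links S (position \<rho>) t = message_links S (x k) t"
    using at_stage(1)[OF t(2)] by (simp add: message_links_def)
  then show ?thesis using safe_message_links[where x = "x k", OF stage_facts(7)[OF t(1)]] by simp
qed

lemma bookkeeping:
  "last_served \<rho> i k = stage_last (f k) i" "plan_index \<rho> i k = stage_index (f k) i"
proof (induction k)
  case 0
  show "last_served \<rho> i 0 = stage_last (f 0) i" "plan_index \<rho> i 0 = stage_index (f 0) i"
    using first by (auto simp: first_stage_def)
next
  case (Suc k)
  then show "last_served \<rho> i (Suc k) = stage_last (f (Suc k)) i"
    "plan_index \<rho> i (Suc k) = stage_index (f (Suc k)) i"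
    using steps[of k] by (auto simp: next_stage_def)
qed

lemma round_simps:
  "round_service S \<rho> k = stage_service (f k)" "team S \<rho> k = stage_team (f k)"
  "goal S pick \<rho> k = stage_goal pick k (f k)"
  by (simp_all add: round_service_def next_service_def stage_service_def team_def stage_team_def
      goal_def stage_goal_def bookkeeping)

lemma serve_Inf:
  "serve \<rho> k = Inf (ereal ` {t. elect \<rho> k \<le> ereal t \<and>
    (\<forall>i\<in>team S \<rho> k. position \<rho> i t \<in> region S (leader \<rho> k) (goal S pick \<rho> k) \<and>
      (leader \<rho> k, i) \<in> (message_links S (position \<rho>) t)\<^sup>*)})" (is "_ = Inf (ereal ` ?Q)")
proof (rule antisym)
  show "serve \<rho> k \<le> Inf (ereal ` ?Q)"
  proof (rule Inf_greatest)
    fix q assume "q \<in> ereal ` ?Q"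
    then obtain t where t: "q = ereal t" "t \<in> ?Q" by blast
    have "s k \<le> t"
    proof (rule ccontr)
      assume "\<not> s k \<le> t"
      then have "t < s k" "t < e (Suc k)" using s_less_e[of k] by auto
      moreover have "e k \<le> t" using t(2) by simp
      ultimately show False
        using stage_facts(10)[of k t] t(2) at_stage(1)[of t k] by (auto simp: round_simps)
    qed
    then show "serve \<rho> k \<le> q" using t(1) by simp
  qed
  have "s k \<in> ?Q"
  proof (intro CollectI conjI ballI)
    show "elect \<rho> k \<le> ereal (s k)" using stage_facts(2) by simp
    fix i assume i: "i \<in> team S \<rho> k"
    show "position \<rho> i (s k) \<in> region S (leader \<rho> k) (goal S pick \<rho> k)"
      using stage_facts(9)[of i k] i s_less_e[of k] by (simp add: at_stage round_simps)
    have "i \<in> A" using i stage_facts(8)[of k] by (auto simp: round_simps)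
    then show "(leader \<rho> k, i) \<in> (message_links S (position \<rho>) (s k))\<^sup>*"
      using election_ok[OF stage_facts(2) s_less_e] stage_facts(3) by (simp add: connected_graph_def)
  qed
  then show "Inf (ereal ` ?Q) \<le> serve \<rho> k" by (auto intro: Inf_lower)
qed

lemma is_run: "procedure_run S ready delay pick \<rho>"
  unfolding procedure_run_def
proof (intro conjI allI impI ballI)
  have e0: "e 0 = ready" using first by (simp add: first_stage_def)
  show "elect \<rho> 0 = election_time S (position \<rho>) (ereal ready)"
    using election_ok[of 0 ready] e_strict_mono[of 0 1] by (simp add: election_time_def e0)
  show "elect \<rho> (Suc k) = election_time S (position \<rho>) (serve \<rho> k + ereal (delay k))" for k
    using election_ok[of "Suc k" "e (Suc k)"] e_strict_mono[of "Suc k" "Suc (Suc k)"]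
    by (simp add: election_time_def e_Suc)
  show "leader \<rho> k \<in> A" for k using stage_facts(3) by simp
  show "urge_less (urge \<rho> k j) (urge \<rho> k (leader \<rho> k))" if "j \<in> A - {leader \<rho> k}" for k j
    using stage_facts(4)[of j k] that by (simp add: urge_def bookkeeping)
  show "serve \<rho> k = Inf (ereal ` {t. elect \<rho> k \<le> ereal t \<and>
      (\<forall>i\<in>team S \<rho> k. position \<rho> i t \<in> region S (leader \<rho> k) (goal S pick \<rho> k) \<and>
        (leader \<rho> k, i) \<in> (message_links S (position \<rho>) t)\<^sup>*)})" for k
    by (rule serve_Inf)
  \<comment> \<open>Positive delays make the service times strictly increasing, so no two rounds end
    together.\<close>
  show "team S \<rho> k \<inter> team S \<rho> m = {}"
    if "k \<noteq> m \<and> serve \<rho> k = serve \<rho> m \<and> serve \<rho> k < \<infinity>" for k m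
    using that s_strict_mono[of k m] s_strict_mono[of m k] by (auto simp: neq_iff)
  fix i assume i: "i \<in> A"
  show "input \<rho> i t = 0" if "ereal t < elect \<rho> 0" for t
  proof -
    have t: "t < e 0" using that by simp
    then have "t < e (Suc 0)" using e_strict_mono[of 0 1] by simp
    then show ?thesis using first t by (simp add: at_stage first_stage_def extends_def)
  qed
  show "input \<rho> i t = feedback S pick \<rho> k i t" if "elect \<rho> k \<le> ereal t \<and> ereal t < serve \<rho> k" for k t
  proof -
    have t: "e k \<le> t" "t < s k" "t < e (Suc k)" using that s_less_e[of k] by auto
    then show ?thesis using stage_facts(11)[OF t(1,2) i]
      by (simp add: feedback_def ctrl_def Let_def round_simps at_stage[OF t(3)])
  qed
  show "input \<rho> i t = 0" if "serve \<rho> k \<le> ereal t \<and> ereal t < elect \<rho> (Suc k)" for k t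
    using that stage_facts(12)[of k t i] at_stage(3)[of t k i] by simp
  show "trajectory (horizon \<rho>) (init_pos S i) (input \<rho> i) (position \<rho> i)"
    using i hybrid_\<rho> initial_state trajectories_iff[of "horizon \<rho>" "init_pos S" "input \<rho>" "position \<rho>"]
    by (auto simp: hybrid_def)
next
  have "edges \<rho> t \<subseteq> pairs" for t using stage_facts(6) by (simp add: \<rho>_def)
  then show "connectivity_graph S (horizon \<rho>) (position \<rho>) (edges \<rho>)"
    using hybrid_\<rho> by (auto simp: connectivity_graph_iff hybrid_def initial_state initial_edges_def pairs_def)
qed

end

text \<open>The first half keeps the second from being vacuous. With delay 0 two rounds could end at
  the same instant with a common agent; positive delays separate them.\<close>

theorem corollary1:
  fixes S :: mas
    and ready :: real
    and delay :: "nat \<Rightarrow> real"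
    and pick :: "nat \<Rightarrow> nat \<Rightarrow> service \<Rightarrow> nat"
  assumes "multi_agent_system S"
    and "0 \<le> ready"
    and "\<And>k. 0 \<le> delay k"
    and "goal_selection S pick"
  shows "((\<forall>k. 0 < delay k) \<longrightarrow> (\<exists>\<rho>. procedure_run S ready delay pick \<rho>)) \<and>
    (\<forall>\<rho>. procedure_run S ready delay pick \<rho> \<longrightarrow>
       (\<exists>\<theta>. \<forall>i\<in>agents S.
          resulting_trace S \<rho> i (\<theta> i) \<and>
          valid_trace S (horizon \<rho>) (input \<rho>) \<theta> i \<and>
          satisfies (\<theta> i) (task S i)))"
proof -
  interpret agent_network S by unfold_locales (rule assms(1))
  show ?thesis
  proof (intro conjI impI allI)
    assume "\<forall>k. 0 < delay k"
    then obtain f where "\<forall>k. stage_ok pick k (f k)" "first_stage ready (f 0)"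
      "\<forall>k. next_stage delay k (f k) (f (Suc k))"
      using stages_exist[OF assms(2) _ assms(4)] by blast
    then interpret staged_run S ready delay pick f
      using assms(2) \<open>\<forall>k. 0 < delay k\<close> by unfold_locales auto
    show "\<exists>\<rho>. procedure_run S ready delay pick \<rho>" using is_run by blast
  next
    fix \<rho> assume "procedure_run S ready delay pick \<rho>"
    then interpret procedure_execution S ready delay pick \<rho>
      using assms by unfold_locales auto
    show "\<exists>\<theta>. \<forall>i\<in>A. resulting_trace S \<rho> i (\<theta> i) \<and>
        valid_trace S (horizon \<rho>) (input \<rho>) \<theta> i \<and> satisfies (\<theta> i) (task S i)"
      using trace_resulting trace_valid trace_satisfies by blast
  qed
qed

end
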